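(* Let $G=(V,(c_{xy})_{x,y\in V})$ be a finite connected weighted graph, $\alpha=(\alpha_x)_{x\in V}$ positive site weights, and $\omega=(\omega_x)_{x\in V}$, $\theta=(\theta_x)_{x\in V}$ non-negative site weights. Fix $\varrho>0$. (a) Let $k\ge 0$, and let $(\lambda,\psi)$, $\psi\in\mathbb R^{\Xi_k}$, be an eigenpair of the $k$-particle purely absorbing system, i.e. $-L_{G,\alpha,\omega,k}\psi=\lambda\psi$. Then $$L_{G,\alpha,\omega,\theta}F_{\alpha,\varrho}^{\psi}=-\lambda\,F_{\alpha,\varrho}^{\psi}+F_{\alpha,\varrho}^{\,\mathfrak b^{\theta}_{\alpha,\omega,\varrho,k-1}\psi}\qquad\text{on }\Xi,$$ where the last term is understood to be $0$ if $k=0$. (b) The functions $F_{\alpha,\varrho}^{\psi}$ ($\psi\in\mathbb R^{\Xi_k}$, $k\ge0$) may be chosen to form an orthogonal basis of $L^2(\nu_{\alpha,\varrho})$.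
   Context: $G$ is a finite graph with symmetric conductances $c_{xy}=c_{yx}\ge 0$, $c_{xx}=0$, connected (any two distinct sites are joined by a sequence of sites with positive consecutive conductances). $|\alpha|=\sum_x\alpha_x$, $|\eta|=\sum_x\eta_x$. For $k\in\mathbb N_0$, $\Xi_k=\{\eta\in\mathbb N_0^V:|\eta|=k\}$ ($\Xi_0$ consists of the empty configuration only) and $\Xi=\bigcup_{k\ge0}\Xi_k$. Open system: the generator of the symmetric inclusion process in contact with reservoirs is $$L_{G,\alpha,\omega,\theta}f(\eta)=\sum_{x,y\in V}c_{xy}\eta_x(\alpha_y+\eta_y)\big(f(\eta-\delta_x+\delta_y)-f(\eta)\big)+\sum_{x\in V}\omega_x\Big\{\eta_x(1+\theta_x)\big(f(\eta-\delta_x)-f(\eta)\big)+\theta_x(\alpha_x+\eta_x)\big(f(\eta+\delta_x)-f(\eta)\big)\Big\},$$ $\eta\in\Xi$; since for each $\eta$ this is a finite sum, the expression is well defined pointwise for every $f:\Xi\to\mathbb R$, in particular for polynomials. Purely absorbing $k$-particle system: on $\mathbb R^{\Xi_k}$, $$L_{G,\alpha,\omega,k}f(\eta)=\sum_{x,y\in V}c_{xy}\eta_x(\alpha_y+\eta_y)\big(f(\eta-\delta_x+\delta_y)-f(\eta)\big)-f(\eta)\sum_{x\in V}\omega_x\eta_x$$ (for $k=0$ it is the zero operator). Measures: $\mu_{\alpha,k}(\eta)=\frac{1}{Z_{\alpha,k}}\prod_{x}\frac{\Gamma(\alpha_x+\eta_x)}{\Gamma(\alpha_x)\eta_x!}$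 on $\Xi_k$, $Z_{\alpha,k}=\frac{\Gamma(|\alpha|+k)}{\Gamma(|\alpha|)k!}$; and $\nu_{\alpha,\varrho}(\eta)=(1+\varrho)^{-|\alpha|}\big(\frac{\varrho}{1+\varrho}\big)^{|\eta|}\prod_x\frac{\Gamma(\alpha_x+\eta_x)}{\Gamma(\alpha_x)\eta_x!}$ on $\Xi$. Duality functions: for $\eta\in\Xi$, $\xi\in\Xi_k$, $D_{\alpha,\varrho}(\xi,\eta)=\prod_{x\in V}d_{\alpha_x,\varrho}(\xi_x,\eta_x)$, where $$d_{\alpha_x,0}(\xi_x,\eta_x)=\frac{\eta_x!}{(\eta_x-\xi_x)!}\frac{\Gamma(\alpha_x)}{\Gamma(\alpha_x+\xi_x)}\mathbf 1_{\{\xi_x\le\eta_x\}},\qquad d_{\alpha_x,\varrho}(\xi_x,\eta_x)=\sum_{\ell=0}^{\xi_x}\binom{\xi_x}{\ell}d_{\alpha_x,0}(\ell,\eta_x)(-\varrho)^{\xi_x-\ell}\quad(\varrho>0).$$ Lifted functions: for $k\ge1$ and $\psi\in\mathbb R^{\Xi_k}$, $F_{\alpha,\varrho}^{\psi}(\eta)=\sum_{\xi\in\Xi_k}\mu_{\alpha,k}(\xi)\psi(\xi)D_{\alpha,\varrho}(\xi,\eta)$, $\eta\in\Xi$; for $k=0$ and $\psi\in\mathbb R$ a scalar, $F_{\alpha,\varrho}^{\psi}\equiv\psi$. Lowering operator: for $k\ge1$, $\mathfrak b^{\theta}_{\alpha,\omega,\varrho,k-1}:\mathbb R^{\Xi_k}\to\mathbb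 R^{\Xi_{k-1}}$, $$\mathfrak b^{\theta}_{\alpha,\omega,\varrho,k-1}\psi(\zeta)=k\sum_{x\in V}\omega_x(\theta_x-\varrho)\frac{\alpha_x+\zeta_x}{|\alpha|+k-1}\,\psi(\zeta+\delta_x),\qquad\zeta\in\Xi_{k-1}.$$ *)

theory Defs
  imports "HOL-Analysis.Analysis"
begin

text \<open>
  The vertex set is the finite type \<open>'v\<close>, so that \<open>\<Xi>\<close> is the full type of configurations
  \<open>'v config\<close>.
\<close>

type_synonym 'v config = "'v \<Rightarrow> nat"

definition connected_weighted_graph :: "('v::finite \<Rightarrow> 'v \<Rightarrow> real) \<Rightarrow> bool" where
  "connected_weighted_graph c \<longleftrightarrow>
     (\<forall>x y. c x y = c y x) \<and> (\<forall>x y. 0 \<le> c x y) \<and> (\<forall>x. c x x = 0) \<and>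
     (\<forall>x y. (x, y) \<in> {(u, v). 0 < c u v}\<^sup>*)"

definition \<Xi> :: "nat \<Rightarrow> ('v::finite) config set" where
  "\<Xi> k = {\<eta>. (\<Sum>x\<in>UNIV. \<eta> x) = k}"

text \<open>
  The space of real functions on \<open>\<Xi> k\<close>; as usual for function spaces with an explicit domain, its
  elements take the value \<open>undefined\<close> off \<open>\<Xi> k\<close>, so distinct elements differ on \<open>\<Xi> k\<close>.
\<close>
definition fun_\<Xi> :: "nat \<Rightarrow> (('v::finite) config \<Rightarrow> real) set" where
  "fun_\<Xi> k = (\<Xi> k \<rightarrow>\<^sub>E UNIV)"

definition add_at :: "'v \<Rightarrow> 'v config \<Rightarrow> 'v config" where
  "add_at x \<eta> = \<eta>(x := \<eta> x + 1)"

text \<open>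
  Subtraction is truncated, but in the generators below particles are only removed with a rate
  proportional to \<open>\<eta> x\<close>, which vanishes for \<open>\<eta> x = 0\<close>.
\<close>
definition remove_at :: "'v \<Rightarrow> 'v config \<Rightarrow> 'v config" where
  "remove_at x \<eta> = \<eta>(x := \<eta> x - 1)"

definition open_gen ::
  "('v::finite \<Rightarrow> 'v \<Rightarrow> real) \<Rightarrow> ('v \<Rightarrow> real) \<Rightarrow> ('v \<Rightarrow> real) \<Rightarrow> ('v \<Rightarrow> real) \<Rightarrow>
   ('v config \<Rightarrow> real) \<Rightarrow> 'v config \<Rightarrow> real" where
  "open_gen c \<alpha> \<omega> \<theta> f \<eta> =
     (\<Sum>x\<in>UNIV. \<Sum>y\<in>UNIV.
        c x y * real (\<eta> x) * (\<alpha> y + real (\<eta> y)) * (f (add_at y (remove_at x \<eta>)) - f \<eta>)) +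
     (\<Sum>x\<in>UNIV. \<omega> x *
        (real (\<eta> x) * (1 + \<theta> x) * (f (remove_at x \<eta>) - f \<eta>) +
         \<theta> x * (\<alpha> x + real (\<eta> x)) * (f (add_at x \<eta>) - f \<eta>)))"

definition absorbing_gen ::
  "('v::finite \<Rightarrow> 'v \<Rightarrow> real) \<Rightarrow> ('v \<Rightarrow> real) \<Rightarrow> ('v \<Rightarrow> real) \<Rightarrow> nat \<Rightarrow>
   ('v config \<Rightarrow> real) \<Rightarrow> 'v config \<Rightarrow> real" where
  "absorbing_gen c \<alpha> \<omega> k f = (\<lambda>\<eta>\<in>\<Xi> k.
     (\<Sum>x\<in>UNIV. \<Sum>y\<in>UNIV.
        c x y * real (\<eta> x) * (\<alpha> y + real (\<eta> y)) * (f (add_at y (remove_at x \<eta>)) - f \<eta>)) -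
     f \<eta> * (\<Sum>x\<in>UNIV. \<omega> x * real (\<eta> x)))"

definition absorbing_eigenpair ::
  "('v::finite \<Rightarrow> 'v \<Rightarrow> real) \<Rightarrow> ('v \<Rightarrow> real) \<Rightarrow> ('v \<Rightarrow> real) \<Rightarrow> nat \<Rightarrow>
   real \<Rightarrow> ('v config \<Rightarrow> real) \<Rightarrow> bool" where
  "absorbing_eigenpair c \<alpha> \<omega> k lam \<psi> \<longleftrightarrow>
     \<psi> \<in> fun_\<Xi> k \<and> (\<exists>\<xi>\<in>\<Xi> k. \<psi> \<xi> \<noteq> 0) \<and>
     (\<forall>\<xi>\<in>\<Xi> k. - absorbing_gen c \<alpha> \<omega> k \<psi> \<xi> = lam * \<psi> \<xi>)"

definition weight :: "('v::finite \<Rightarrow> real) \<Rightarrow> 'v config \<Rightarrow> real" where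
  "weight \<alpha> \<eta> =
     (\<Prod>x\<in>UNIV. Gamma (\<alpha> x + real (\<eta> x)) / (Gamma (\<alpha> x) * fact (\<eta> x)))"

definition \<mu> :: "('v::finite \<Rightarrow> real) \<Rightarrow> nat \<Rightarrow> 'v config \<Rightarrow> real" where
  "\<mu> \<alpha> k \<eta> =
     weight \<alpha> \<eta> /
     (Gamma ((\<Sum>x\<in>UNIV. \<alpha> x) + real k) / (Gamma (\<Sum>x\<in>UNIV. \<alpha> x) * fact k))"

definition \<nu> :: "('v::finite \<Rightarrow> real) \<Rightarrow> real \<Rightarrow> 'v config measure" where
  "\<nu> \<alpha> \<rho> = point_measure UNIV (\<lambda>\<eta>. ennreal (
     (1 + \<rho>) powr (- (\<Sum>x\<in>UNIV. \<alpha> x)) * (\<rho> / (1 + \<rho>)) ^ (\<Sum>x\<in>UNIV. \<eta> x) * weight \<alpha> \<eta>))"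

definition d0 :: "real \<Rightarrow> nat \<Rightarrow> nat \<Rightarrow> real" where
  "d0 a m n =
     (if m \<le> n then fact n / fact (n - m) * (Gamma a / Gamma (a + real m)) else 0)"

definition d :: "real \<Rightarrow> real \<Rightarrow> nat \<Rightarrow> nat \<Rightarrow> real" where
  "d a \<rho> m n =
     (if \<rho> = 0 then d0 a m n
      else (\<Sum>l=0..m. real (m choose l) * d0 a l n * (- \<rho>) ^ (m - l)))"

definition D :: "('v::finite \<Rightarrow> real) \<Rightarrow> real \<Rightarrow> 'v config \<Rightarrow> 'v config \<Rightarrow> real" where
  "D \<alpha> \<rho> \<xi> \<eta> = (\<Prod>x\<in>UNIV. d (\<alpha> x) \<rho> (\<xi> x) (\<eta> x))"

text \<open>
  For \<open>k = 0\<close>, a function on \<open>\<Xi> 0\<close>, which consists of the empty configuration only, is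
  identified with its value there.
\<close>
definition lifted ::
  "('v::finite \<Rightarrow> real) \<Rightarrow> real \<Rightarrow> nat \<Rightarrow> ('v config \<Rightarrow> real) \<Rightarrow> 'v config \<Rightarrow> real" where
  "lifted \<alpha> \<rho> k \<psi> \<eta> =
     (if k = 0 then \<psi> (\<lambda>_. 0) else (\<Sum>\<xi>\<in>\<Xi> k. \<mu> \<alpha> k \<xi> * \<psi> \<xi> * D \<alpha> \<rho> \<xi> \<eta>))"

text \<open>
  The index \<open>j\<close> is the number of particles after lowering: \<open>lowering \<alpha> \<omega> \<theta> \<rho> j\<close> maps functions
  on \<open>\<Xi> (j + 1)\<close> to functions on \<open>\<Xi> j\<close>.
\<close>
definition lowering ::
  "('v::finite \<Rightarrow> real) \<Rightarrow> ('v \<Rightarrow> real) \<Rightarrow> ('v \<Rightarrow> real) \<Rightarrow> real \<Rightarrow> nat \<Rightarrow>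
   ('v config \<Rightarrow> real) \<Rightarrow> 'v config \<Rightarrow> real" where
  "lowering \<alpha> \<omega> \<theta> \<rho> j \<psi> = (\<lambda>\<zeta>\<in>\<Xi> j.
     real (j + 1) * (\<Sum>x\<in>UNIV.
        \<omega> x * (\<theta> x - \<rho>) * ((\<alpha> x + real (\<zeta> x)) / ((\<Sum>y\<in>UNIV. \<alpha> y) + real j)) *
        \<psi> (add_at x \<zeta>)))"

definition square_integrable :: "'a measure \<Rightarrow> ('a \<Rightarrow> real) \<Rightarrow> bool" where
  "square_integrable M f \<longleftrightarrow> f \<in> borel_measurable M \<and> integrable M (\<lambda>x. (f x)\<^sup>2)"

text \<open>
  An orthogonal basis in the Hilbert space sense: nonzero, pairwise orthogonal vectors whose
  finite linear combinations are dense in \<open>L\<^sup>2(M)\<close>.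
\<close>
definition orthogonal_basis_L2 :: "'a measure \<Rightarrow> 'i set \<Rightarrow> ('i \<Rightarrow> 'a \<Rightarrow> real) \<Rightarrow> bool" where
  "orthogonal_basis_L2 M I e \<longleftrightarrow>
     (\<forall>i\<in>I. square_integrable M (e i) \<and> (\<integral>x. (e i x)\<^sup>2 \<partial>M) \<noteq> 0) \<and>
     (\<forall>i\<in>I. \<forall>j\<in>I. i \<noteq> j \<longrightarrow> (\<integral>x. e i x * e j x \<partial>M) = 0) \<and>
     (\<forall>f. square_integrable M f \<longrightarrow>
        (\<forall>\<epsilon>>0. \<exists>J a. finite J \<and> J \<subseteq> I \<and>
           sqrt (\<integral>x. (f x - (\<Sum>i\<in>J. a i * e i x))\<^sup>2 \<partial>M) < \<epsilon>))"

end

theory Submission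
  imports Defs
begin

text \<open>
  The proof rests on one-site identities for the functions \<open>d a \<rho> m n\<close>, which are Meixner
  polynomials in \<open>n\<close>. The three operators

    \<open>f n \<mapsto> n * f (n - 1)\<close>, \<open>f n \<mapsto> n * f n\<close>, \<open>f n \<mapsto> (a + n) * f (n + 1)\<close>

  out of which the open generator is built become, when applied to \<open>d a \<rho> m n\<close>, three-term
  expressions in the other variable \<open>m\<close> (lemmas \<open>d_remove\<close>, \<open>d_mult\<close>, \<open>d_add\<close>). For the
  unshifted functions \<open>d0\<close> this is elementary, and \<open>d\<close> arises from \<open>d0\<close> by a binomial transform in
  \<open>m\<close>, which is the exponential of \<open>- \<rho>\<close> times the lowering operator \<open>g m \<mapsto> m * g (m - 1)\<close>;
  conjugation with this exponential gives the relations for every \<open>\<rho>\<close>.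

  Part (a). The two orientations of an edge together form a bilinear expression in these operators
  which keeps its shape when the operators in \<open>\<eta>\<close> are replaced by the corresponding operators in
  \<open>\<xi>\<close> (the invariance of the Casimir element of \<open>su(1,1)\<close>; lemma \<open>edge_identity\<close>). In a
  reservoir term the same replacement leaves killing at rate \<open>\<omega> x * \<xi> x\<close> plus
  \<open>\<omega> x * (\<theta> x - \<rho>) * \<xi> x\<close> times the removal of a \<open>\<xi>\<close>-particle. Hence the open generator
  acting on \<open>D \<alpha> \<rho> \<xi>\<close> is the absorbing generator acting on \<open>\<xi>\<close>, up to a term with one particle
  less (\<open>open_gen_D\<close>). Averaging over \<open>\<xi>\<close> against \<open>\<mu> \<alpha> k \<xi> * \<psi> \<xi>\<close>, and using that the
  absorbing generator is symmetric with respect to \<open>\<mu> \<alpha> k\<close>, moves both terms onto \<open>\<psi>\<close>.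

  Part (b). For every site \<open>x\<close>, the function \<open>D \<alpha> \<rho> \<xi>\<close> is an eigenfunction with eigenvalue
  \<open>\<xi> x\<close> of an operator that is symmetric in \<open>L\<^sup>2(\<nu>)\<close>; so the functions \<open>D \<alpha> \<rho> \<xi>\<close> are pairwise
  orthogonal. A ladder relation gives their norms: \<open>weight \<alpha> \<xi> * \<parallel>D \<alpha> \<rho> \<xi>\<parallel>\<^sup>2\<close> depends on the
  number of particles of \<open>\<xi>\<close> only. Lifting is therefore, on every level \<open>k\<close>, an isometry up to a
  constant from \<open>L\<^sup>2(\<mu> \<alpha> k)\<close> to \<open>L\<^sup>2(\<nu>)\<close>, with orthogonal images for different levels, and the
  lifts of orthogonal eigenbases of the symmetric absorbing generators form an orthogonal system.

  Completeness comes from self-duality: up to powers of \<open>- \<rho>\<close>, \<open>D\<close> is symmetric under the exchange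
  of \<open>\<xi>\<close> and \<open>\<eta>\<close>. Under this exchange, the formula for the norm of \<open>D \<alpha> \<rho> \<zeta>\<close> turns into
  Parseval's identity for the indicator function of the single configuration \<open>\<zeta>\<close>
  (\<open>point_mass_parseval\<close>). So every such indicator lies in the closed span of the duality
  functions, and the finite linear combinations of these indicators are dense.
\<close>

section \<open>One-site recurrences\<close>

text \<open>
  The matrix of \<open>exp (- \<rho> * M)\<close>, where \<open>M g m = m * g (m - 1)\<close>: it turns the duality function
  with parameter \<open>0\<close> into the one with parameter \<open>\<rho>\<close>.
\<close>

definition binomial_transform :: "real \<Rightarrow> (nat \<Rightarrow> real) \<Rightarrow> nat \<Rightarrow> real" where
  "binomial_transform \<rho> g m = (\<Sum>l\<le>m. real (m choose l) * g l * (- \<rho>) ^ (m - l))"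

lemma binomial_transform_add:
  "binomial_transform \<rho> (\<lambda>l. g l + h l) m = binomial_transform \<rho> g m + binomial_transform \<rho> h m"
  by (simp add: binomial_transform_def algebra_simps sum.distrib)

lemma binomial_transform_cmult:
  "binomial_transform \<rho> (\<lambda>l. b * g l) m = b * binomial_transform \<rho> g m"
  by (simp add: binomial_transform_def sum_distrib_left algebra_simps)

text \<open>
  Pascal's rule. Equivalently, the transform of \<open>g\<close> at \<open>m\<close> is \<open>(S - \<rho>) ^ m\<close> applied to \<open>g\<close>
  and evaluated at \<open>0\<close>, where \<open>S\<close> is the shift.
\<close>

lemma binomial_transform_Suc:
  "binomial_transform \<rho> g (Suc m) =
     binomial_transform \<rho> (\<lambda>l. g (Suc l)) m - \<rho> * binomial_transform \<rho> g m"
proof -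
  have "binomial_transform \<rho> g (Suc m) =
      g 0 * (- \<rho>) ^ Suc m + (\<Sum>l\<le>m. real (Suc m choose Suc l) * g (Suc l) * (- \<rho>) ^ (m - l))"
    unfolding binomial_transform_def by (subst sum.atMost_Suc_shift) simp
  also have "(\<Sum>l\<le>m. real (Suc m choose Suc l) * g (Suc l) * (- \<rho>) ^ (m - l)) =
      binomial_transform \<rho> (\<lambda>l. g (Suc l)) m +
      (\<Sum>l\<le>m. real (m choose Suc l) * g (Suc l) * (- \<rho>) ^ (m - l))"
    by (simp add: binomial_transform_def algebra_simps sum.distrib)
  also have "(\<Sum>l\<le>m. real (m choose Suc l) * g (Suc l) * (- \<rho>) ^ (m - l)) =
      (\<Sum>l<m. - \<rho> * (real (m choose Suc l) * g (Suc l) * (- \<rho>) ^ (m - Suc l)))"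
  proof -
    have "(\<Sum>l\<le>m. real (m choose Suc l) * g (Suc l) * (- \<rho>) ^ (m - l)) =
        (\<Sum>l<m. real (m choose Suc l) * g (Suc l) * (- \<rho>) ^ (m - l))"
      by (rule sum.mono_neutral_right) (auto simp: not_less)
    also have "\<dots> = (\<Sum>l<m. - \<rho> * (real (m choose Suc l) * g (Suc l) * (- \<rho>) ^ (m - Suc l)))"
    proof (rule sum.cong, simp)
      fix l assume "l \<in> {..<m}"
      then have "m - l = Suc (m - Suc l)" by simp
      then show "real (m choose Suc l) * g (Suc l) * (- \<rho>) ^ (m - l) =
          - \<rho> * (real (m choose Suc l) * g (Suc l) * (- \<rho>) ^ (m - Suc l))" by simp
    qed
    finally show ?thesis .
  qed
  also have "g 0 * (- \<rho>) ^ Suc m + (binomial_transform \<rho> (\<lambda>l. g (Suc l)) m +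
      (\<Sum>l<m. - \<rho> * (real (m choose Suc l) * g (Suc l) * (- \<rho>) ^ (m - Suc l)))) =
      binomial_transform \<rho> (\<lambda>l. g (Suc l)) m - \<rho> * binomial_transform \<rho> g m"
  proof -
    have "binomial_transform \<rho> g m =
        g 0 * (- \<rho>) ^ m + (\<Sum>l<m. real (m choose Suc l) * g (Suc l) * (- \<rho>) ^ (m - Suc l))"
      unfolding binomial_transform_def by (subst sum.atMost_shift) simp
    then show ?thesis
      by (simp add: sum_distrib_left[symmetric] sum_negf algebra_simps)
  qed
  finally show ?thesis .
qed

text \<open>
  The lowering operator commutes with its own exponential. The next two lemmas conjugate the
  operators \<open>m\<close> and \<open>g m \<mapsto> (a + m) * g (m + 1)\<close> with this exponential; the series of iterated
  commutators ends after one and after two steps, respectively.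
\<close>

lemma binomial_transform_lower:
  "binomial_transform \<rho> (\<lambda>l. real l * g (l - 1)) m = real m * binomial_transform \<rho> g (m - 1)"
proof (cases m)
  case (Suc j)
  have "binomial_transform \<rho> (\<lambda>l. real l * g (l - 1)) (Suc j) =
      (\<Sum>l\<le>j. (real (Suc l) * real (Suc j choose Suc l)) * g l * (- \<rho>) ^ (j - l))"
    unfolding binomial_transform_def
    by (subst sum.atMost_Suc_shift) (simp add: mult_ac del: binomial_Suc_Suc of_nat_Suc)
  also have "\<dots> = (\<Sum>l\<le>j. (real (Suc j) * real (j choose l)) * g l * (- \<rho>) ^ (j - l))"
    by (intro sum.cong refl) (metis Suc_times_binomial of_nat_mult)
  finally show ?thesis
    using Suc by (simp add: binomial_transform_def sum_distrib_left mult_ac)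
qed (simp add: binomial_transform_def)

lemma binomial_transform_mult_index:
  "binomial_transform \<rho> (\<lambda>l. real l * g l) m =
     real m * (binomial_transform \<rho> g m + \<rho> * binomial_transform \<rho> g (m - 1))"
proof -
  have eq: "(\<lambda>l. real l * g l) = (\<lambda>l. real l * g (Suc (l - 1)))"
  proof
    fix l show "real l * g l = real l * g (Suc (l - 1))" by (cases l) simp_all
  qed
  show ?thesis
    using binomial_transform_lower[of \<rho> "\<lambda>l. g (Suc l)" m] binomial_transform_Suc[of \<rho> g "m - 1"]
    unfolding eq by (cases m) simp_all
qed

lemma binomial_transform_raise:
  "binomial_transform \<rho> (\<lambda>l. (a + real l) * g (Suc l)) m =
     (a + real m) * binomial_transform \<rho> g (Suc m) + \<rho> * (a + 2 * real m) * binomial_transform \<rho> g m +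
     \<rho>\<^sup>2 * (real m * binomial_transform \<rho> g (m - 1))"
proof -
  have "binomial_transform \<rho> (\<lambda>l. (a + real l) * g (Suc l)) m =
      a * binomial_transform \<rho> (\<lambda>l. g (Suc l)) m +
      binomial_transform \<rho> (\<lambda>l. real l * g (Suc l)) m"
    by (simp only: distrib_right binomial_transform_add binomial_transform_cmult)
  also have "binomial_transform \<rho> (\<lambda>l. g (Suc l)) m =
      binomial_transform \<rho> g (Suc m) + \<rho> * binomial_transform \<rho> g m"
    by (simp add: binomial_transform_Suc)
  also have "binomial_transform \<rho> (\<lambda>l. real l * g (Suc l)) m =
      real m * (binomial_transform \<rho> g (Suc m) + \<rho> * binomial_transform \<rho> g m) +
      \<rho> * (real m * (binomial_transform \<rho> g m + \<rho> * binomial_transform \<rho> g (m - 1)))"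
    using binomial_transform_mult_index[of \<rho> "\<lambda>l. g (Suc l)" m] binomial_transform_Suc[of \<rho> g m]
      binomial_transform_Suc[of \<rho> g "m - 1"]
    by (cases m) (simp_all add: algebra_simps)
  finally show ?thesis
    by (simp add: algebra_simps power2_eq_square)
qed

lemma Gamma_ratio_pochhammer:
  assumes "0 < (a::real)"
  shows "Gamma (a + real m) = pochhammer a m * Gamma a"
proof -
  have "a \<notin> \<int>\<^sub>\<le>\<^sub>0" using assms by (auto elim!: nonpos_Ints_cases)
  then show ?thesis
    using pochhammer_Gamma[of a m] Gamma_real_pos[OF assms] by simp
qed

lemma d0_eq_binomial:
  assumes "0 < a"
  shows "d0 a m n = fact m * real (n choose m) / pochhammer a m"
proof (cases "m \<le> n")
  case True
  then show ?thesis
    using pochhammer_pos[OF assms, of m] less_imp_neq[OF Gamma_real_pos[OF assms]]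
    by (simp add: d0_def Gamma_ratio_pochhammer assms binomial_fact)
qed (simp add: d0_def binomial_eq_0)

lemma d0_raise:
  assumes "0 < a"
  shows "(a + real m) * d0 a (Suc m) n = fact m * (real (Suc m) * real (n choose Suc m)) / pochhammer a m"
  using assms by (simp add: d0_eq_binomial pochhammer_Suc del: of_nat_Suc)

lemma d0_remove:
  assumes "0 < a"
  shows "real n * d0 a m (n - 1) = (a + real m) * d0 a (Suc m) n"
proof -
  have "real n * real ((n - 1) choose m) = real (Suc m) * real (n choose Suc m)"
    by (metis binomial_absorption of_nat_mult)
  then show ?thesis
    by (simp add: d0_raise assms) (simp add: d0_eq_binomial assms del: of_nat_Suc)
qed

lemma d0_mult:
  assumes "0 < a"
  shows "real n * d0 a m n = (a + real m) * d0 a (Suc m) n + real m * d0 a m n"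
proof -
  have "real (Suc m) * real (n choose Suc m) = (real n - real m) * real (n choose m)"
  proof (cases "m \<le> n")
    case True
    have "Suc m * (n choose Suc m) = (n - m) * (n choose m)"
      by (metis binomial_absorb_comp binomial_absorption)
    then show ?thesis using True by (metis of_nat_diff of_nat_mult)
  qed (simp add: binomial_eq_0)
  then have "(a + real m) * d0 a (Suc m) n = (real n - real m) * d0 a m n"
    unfolding d0_raise[OF assms] unfolding d0_eq_binomial[OF assms] by simp
  then show ?thesis by (simp add: algebra_simps)
qed

text \<open>
  Pascal's rule relates \<open>d0 a m (n + 1)\<close> to \<open>d0 a m n\<close> and \<open>d0 a (m - 1) n\<close>; multiplication by
  \<open>n\<close> is then resolved with \<open>d0_mult\<close>.
\<close>

lemma d0_add:
  assumes "0 < a"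
  shows "(a + real n) * d0 a m (Suc n) =
    (a + real m) * d0 a (Suc m) n + (a + 2 * real m) * d0 a m n + real m * d0 a (m - 1) n"
proof (cases m)
  case 0
  then show ?thesis using d0_mult[OF assms, of n 0] assms
    by (simp add: d0_eq_binomial algebra_simps)
next
  case (Suc j)
  have pascal: "(a + real j) * d0 a (Suc j) (Suc n) =
      (a + real j) * d0 a (Suc j) n + real (Suc j) * d0 a j n"
    unfolding d0_raise[OF assms] unfolding d0_eq_binomial[OF assms]
    by (simp add: add_divide_distrib algebra_simps)
  have 1: "(a + real n) * d0 a (Suc j) n =
      (a + real (Suc j)) * d0 a (Suc (Suc j)) n + (a + real (Suc j)) * d0 a (Suc j) n"
    using d0_mult[OF assms, of n "Suc j"] by (simp add: algebra_simps)
  have 2: "(a + real n) * d0 a j n = (a + real j) * (d0 a (Suc j) n + d0 a j n)"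
    using d0_mult[OF assms, of n j] by (simp add: algebra_simps)
  have "(a + real j) * ((a + real n) * d0 a (Suc j) (Suc n)) =
      (a + real n) * ((a + real j) * d0 a (Suc j) n + real (Suc j) * d0 a j n)"
    using pascal by (metis mult.left_commute)
  also have "\<dots> = (a + real j) * ((a + real n) * d0 a (Suc j) n) +
      real (Suc j) * ((a + real n) * d0 a j n)"
    by (simp add: algebra_simps)
  also have "\<dots> = (a + real j) * ((a + real (Suc j)) * d0 a (Suc (Suc j)) n +
      (a + 2 * real (Suc j)) * d0 a (Suc j) n + real (Suc j) * d0 a j n)"
    unfolding 1 2 by (simp add: algebra_simps)
  finally show ?thesis
    using assms Suc by simp
qed

lemma d_eq_binomial_transform:
  assumes "0 < \<rho>"
  shows "d a \<rho> m n = binomial_transform \<rho> (\<lambda>l. d0 a l n) m"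
  using assms by (simp add: d_def binomial_transform_def atLeast0AtMost)

text \<open>
  The next three relations are the images of \<open>d0_remove\<close>, \<open>d0_mult\<close> and \<open>d0_add\<close> under the
  binomial transform.
\<close>

lemma d_remove:
  assumes "0 < a" "0 < \<rho>"
  shows "real n * d a \<rho> m (n - 1) = (a + real m) * d a \<rho> (Suc m) n +
    \<rho> * (a + 2 * real m) * d a \<rho> m n + \<rho>\<^sup>2 * (real m * d a \<rho> (m - 1) n)"
proof -
  have "real n * d a \<rho> m (n - 1) =
      binomial_transform \<rho> (\<lambda>l. (a + real l) * d0 a (Suc l) n) m"
    unfolding d_eq_binomial_transform[OF assms(2)] binomial_transform_cmult[symmetric]
    by (simp only: d0_remove[OF assms(1)])
  then show ?thesis
    unfolding d_eq_binomial_transform[OF assms(2)] by (simp only: binomial_transform_raise[of \<rho> a "\<lambda>l. d0 a l n"])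
qed

lemma d_mult:
  assumes "0 < a" "0 < \<rho>"
  shows "real n * d a \<rho> m n = (a + real m) * d a \<rho> (Suc m) n +
    (\<rho> * a + (2 * \<rho> + 1) * real m) * d a \<rho> m n + \<rho> * (1 + \<rho>) * (real m * d a \<rho> (m - 1) n)"
proof -
  have "real n * d a \<rho> m n =
      binomial_transform \<rho> (\<lambda>l. (a + real l) * d0 a (Suc l) n + real l * d0 a l n) m"
    unfolding d_eq_binomial_transform[OF assms(2)] binomial_transform_cmult[symmetric]
    by (simp only: d0_mult[OF assms(1)])
  then show ?thesis
    unfolding binomial_transform_add binomial_transform_raise[of \<rho> a "\<lambda>l. d0 a l n"]
      binomial_transform_mult_index d_eq_binomial_transform[OF assms(2), symmetric]
    by (simp add: algebra_simps power2_eq_square)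
qed

lemma d_add:
  assumes "0 < a" "0 < \<rho>"
  shows "(a + real n) * d a \<rho> m (Suc n) = (a + real m) * d a \<rho> (Suc m) n +
    (1 + \<rho>) * (a + 2 * real m) * d a \<rho> m n + (1 + \<rho>)\<^sup>2 * (real m * d a \<rho> (m - 1) n)"
proof -
  have "(\<lambda>l. (a + real n) * d0 a l (Suc n)) =
      (\<lambda>l. ((a + real l) * d0 a (Suc l) n + (a * d0 a l n + 2 * (real l * d0 a l n))) +
        real l * d0 a (l - 1) n)"
    unfolding d0_add[OF assms(1)] by (simp add: algebra_simps)
  then have "(a + real n) * d a \<rho> m (Suc n) =
      binomial_transform \<rho> (\<lambda>l. ((a + real l) * d0 a (Suc l) n + (a * d0 a l n +
        2 * (real l * d0 a l n))) + real l * d0 a (l - 1) n) m"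
    unfolding d_eq_binomial_transform[OF assms(2)] binomial_transform_cmult[symmetric] by simp
  then show ?thesis
    unfolding binomial_transform_add binomial_transform_raise[of \<rho> a "\<lambda>l. d0 a l n"]
      binomial_transform_cmult binomial_transform_mult_index[of \<rho> "\<lambda>l. d0 a l n"]
      binomial_transform_lower[of \<rho> "\<lambda>l. d0 a l n"] d_eq_binomial_transform[OF assms(2), symmetric]
    by (simp add: algebra_simps power2_eq_square)
qed

text \<open>
  Both sides equal the expression
  \<open>\<Sum>l. (m choose l) * (n choose l) * l! / pochhammer a l * (- \<rho>) ^ (m + n - l)\<close>,
  which is symmetric in \<open>m\<close> and \<open>n\<close>.
\<close>

lemma d_self_dual:
  assumes "0 < a" "0 < \<rho>"
  shows "(- \<rho>) ^ n * d a \<rho> m n = (- \<rho>) ^ m * d a \<rho> n m"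
proof -
  have expand: "(- \<rho>) ^ n * d a \<rho> m n = (\<Sum>l\<le>m + n. real (m choose l) * real (n choose l) *
      (fact l / pochhammer a l) * (- \<rho>) ^ (m + n - l))" for m n
  proof -
    have "(- \<rho>) ^ n * d a \<rho> m n = (\<Sum>l\<le>m. real (m choose l) * real (n choose l) *
        (fact l / pochhammer a l) * (- \<rho>) ^ (m + n - l))"
    proof -
      have "(- \<rho>) ^ n * (- \<rho>) ^ (m - l) = (- \<rho>) ^ (m + n - l)" if "l \<le> m" for l
        using that by (metis Nat.add_diff_assoc2 add.commute power_add)
      then show ?thesis
        unfolding d_eq_binomial_transform[OF assms(2)] binomial_transform_def sum_distrib_left
        by (intro sum.cong) (auto simp: d0_eq_binomial[OF assms(1)] mult.assoc mult.left_commute)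
    qed
    \<comment> \<open>The added terms vanish; the new range is symmetric in \<open>m\<close> and \<open>n\<close>.\<close>
    also have "\<dots> = (\<Sum>l\<le>m + n. real (m choose l) * real (n choose l) *
        (fact l / pochhammer a l) * (- \<rho>) ^ (m + n - l))"
      by (rule sum.mono_neutral_left) (auto simp: binomial_eq_0)
    finally show ?thesis .
  qed
  show ?thesis
    unfolding expand[of n m] expand[of m n] by (simp add: add.commute mult.commute)
qed

lemma d_zero: "0 < a \<Longrightarrow> 0 < \<rho> \<Longrightarrow> d a \<rho> 0 n = 1"
  by (simp add: d_eq_binomial_transform binomial_transform_def d0_eq_binomial)

text \<open>
  Polynomial growth in \<open>n\<close> is all that the integrability of the duality functions requires.
\<close>

lemma abs_d_le:
  assumes "0 < a" "0 < \<rho>"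
  shows "\<exists>b\<ge>0. \<forall>n. \<bar>d a \<rho> m n\<bar> \<le> b * (1 + real n) ^ m"
proof -
  have d0: "\<bar>d0 a l n\<bar> \<le> (1 + real n) ^ m / pochhammer a l" if "l \<le> m" for l n
  proof -
    have "real (fact l * (n choose l)) \<le> real (n ^ l)"
      using binomial_fact_pow[of n l] by (simp only: of_nat_le_iff mult.commute)
    also have "\<dots> \<le> (1 + real n) ^ l" by (simp add: power_mono)
    also have "\<dots> \<le> (1 + real n) ^ m" by (rule power_increasing[OF that]) simp
    finally show ?thesis
      using assms(1) pochhammer_pos[of a l] by (simp add: d0_eq_binomial divide_right_mono)
  qed
  let ?b = "\<Sum>l\<le>m. real (m choose l) * \<rho> ^ (m - l) / pochhammer a l"
  have "\<bar>d a \<rho> m n\<bar> \<le> ?b * (1 + real n) ^ m" for n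
  proof -
    have "\<bar>d a \<rho> m n\<bar> \<le> (\<Sum>l\<le>m. \<bar>real (m choose l) * d0 a l n * (- \<rho>) ^ (m - l)\<bar>)"
      unfolding d_eq_binomial_transform[OF assms(2)] binomial_transform_def by (rule sum_abs)
    also have "\<dots> = (\<Sum>l\<le>m. (real (m choose l) * \<rho> ^ (m - l)) * \<bar>d0 a l n\<bar>)"
      using assms(2) by (simp add: abs_mult power_abs mult_ac)
    also have "\<dots> \<le> (\<Sum>l\<le>m. (real (m choose l) * \<rho> ^ (m - l)) *
        ((1 + real n) ^ m / pochhammer a l))"
      using assms(2) d0 by (intro sum_mono mult_left_mono) auto
    finally show ?thesis by (simp add: sum_distrib_right)
  qed
  moreover have "0 \<le> ?b"
    using assms pochhammer_pos[of a] by (intro sum_nonneg) (auto intro!: divide_nonneg_pos)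
  ultimately show ?thesis by blast
qed

section \<open>Configurations and weights\<close>

lemma add_at_apply: "add_at x \<eta> y = (if y = x then \<eta> x + 1 else \<eta> y)"
  by (simp add: add_at_def)

lemma remove_at_apply: "remove_at x \<eta> y = (if y = x then \<eta> x - 1 else \<eta> y)"
  by (simp add: remove_at_def)

lemma remove_at_add_at [simp]: "remove_at x (add_at x \<eta>) = \<eta>"
  by (simp add: remove_at_def add_at_def)

lemma add_at_remove_at: "0 < \<eta> x \<Longrightarrow> add_at x (remove_at x \<eta>) = \<eta>"
  by (simp add: remove_at_def add_at_def)

lemma sum_fun_upd:
  fixes \<eta> :: "'v::finite \<Rightarrow> nat"
  shows "(\<Sum>y\<in>UNIV. (\<eta>(x := n)) y) + \<eta> x = (\<Sum>y\<in>UNIV. \<eta> y) + n"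
proof -
  have "(\<Sum>y\<in>UNIV. (\<eta>(x := n)) y) = n + (\<Sum>y\<in>UNIV - {x}. \<eta> y)"
    by (subst sum.remove[of UNIV x]) auto
  moreover have "(\<Sum>y\<in>UNIV. \<eta> y) = \<eta> x + (\<Sum>y\<in>UNIV - {x}. \<eta> y)"
    by (subst sum.remove[of UNIV x]) auto
  ultimately show ?thesis by simp
qed

lemma add_at_in_\<Xi>_iff: "add_at x \<eta> \<in> \<Xi> (Suc k) \<longleftrightarrow> \<eta> \<in> \<Xi> k"
  using sum_fun_upd[of \<eta> x "\<eta> x + 1"] by (simp add: \<Xi>_def add_at_def)

lemma remove_at_in_\<Xi>: "\<eta> \<in> \<Xi> (Suc k) \<Longrightarrow> 0 < \<eta> x \<Longrightarrow> remove_at x \<eta> \<in> \<Xi> k"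
  using add_at_in_\<Xi>_iff[of x "remove_at x \<eta>" k] by (simp add: add_at_remove_at)

lemma \<Xi>_pos: "\<eta> \<in> \<Xi> k \<Longrightarrow> 0 < \<eta> x \<Longrightarrow> 0 < k"
  using sum_pos2[of UNIV x \<eta>] by (auto simp: \<Xi>_def)

lemma move_in_\<Xi>: "\<eta> \<in> \<Xi> k \<Longrightarrow> 0 < \<eta> x \<Longrightarrow> add_at y (remove_at x \<eta>) \<in> \<Xi> k"
  using \<Xi>_pos[of \<eta> k x] remove_at_in_\<Xi>[of \<eta> "k - 1" x] add_at_in_\<Xi>_iff[of y "remove_at x \<eta>" "k - 1"]
  by auto

lemma finite_\<Xi> [simp]: "finite (\<Xi> k :: ('v::finite \<Rightarrow> nat) set)"
proof (rule finite_subset)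
  show "(\<Xi> k :: ('v \<Rightarrow> nat) set) \<subseteq> UNIV \<rightarrow>\<^sub>E {..k}"
    by (auto simp: \<Xi>_def intro!: member_le_sum)
qed (simp add: finite_PiE)

lemma \<Xi>_0: "\<Xi> 0 = {\<lambda>_. 0}"
  by (auto simp: \<Xi>_def)

text \<open>
  Configurations with a particle at \<open>x\<close> correspond to configurations with one particle less. All
  changes of variables in sums over \<open>\<Xi> k\<close> reduce to this one.
\<close>

lemma sum_\<Xi>_Suc:
  fixes h :: "('v::finite \<Rightarrow> nat) \<Rightarrow> real"
  shows "(\<Sum>\<xi>\<in>\<Xi> (Suc k). real (\<xi> x) * h \<xi>) = (\<Sum>\<zeta>\<in>\<Xi> k. real (\<zeta> x + 1) * h (add_at x \<zeta>))"
proof -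
  have "(\<Sum>\<xi>\<in>\<Xi> (Suc k). real (\<xi> x) * h \<xi>) = (\<Sum>\<xi>\<in>{\<xi> \<in> \<Xi> (Suc k). 0 < \<xi> x}. real (\<xi> x) * h \<xi>)"
    by (rule sum.mono_neutral_right) auto
  also have "\<dots> = (\<Sum>\<zeta>\<in>\<Xi> k. real (\<zeta> x + 1) * h (add_at x \<zeta>))"
    by (rule sum.reindex_bij_witness[of _ "add_at x" "remove_at x"])
      (auto simp: add_at_in_\<Xi>_iff remove_at_in_\<Xi> add_at_remove_at remove_at_apply add_at_apply)
  finally show ?thesis .
qed

lemma weight_eq_pochhammer:
  fixes \<alpha> :: "'v::finite \<Rightarrow> real"
  assumes "\<forall>x. 0 < \<alpha> x"
  shows "weight \<alpha> \<eta> = (\<Prod>x\<in>UNIV. pochhammer (\<alpha> x) (\<eta> x) / fact (\<eta> x))"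
  unfolding weight_def
proof (intro prod.cong refl)
  fix x
  show "Gamma (\<alpha> x + real (\<eta> x)) / (Gamma (\<alpha> x) * fact (\<eta> x)) =
      pochhammer (\<alpha> x) (\<eta> x) / fact (\<eta> x)"
    using less_imp_neq[OF Gamma_real_pos[OF assms[rule_format, of x]]]
    by (simp add: Gamma_ratio_pochhammer assms)
qed

lemma weight_pos:
  fixes \<alpha> :: "'v::finite \<Rightarrow> real"
  assumes "\<forall>x. 0 < \<alpha> x"
  shows "0 < weight \<alpha> \<eta>"
  unfolding weight_eq_pochhammer[OF assms] using assms by (intro prod_pos) (auto simp: pochhammer_pos)

text \<open>
  Detailed balance of the weight with respect to adding and removing a single particle.
\<close>

lemma weight_add_at:
  fixes \<alpha> :: "'v::finite \<Rightarrow> real"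
  assumes "\<forall>x. 0 < \<alpha> x"
  shows "real (\<zeta> x + 1) * weight \<alpha> (add_at x \<zeta>) = (\<alpha> x + real (\<zeta> x)) * weight \<alpha> \<zeta>"
proof -
  have "weight \<alpha> (add_at x \<zeta>) = pochhammer (\<alpha> x) (Suc (\<zeta> x)) / fact (Suc (\<zeta> x)) *
      (\<Prod>y\<in>UNIV - {x}. pochhammer (\<alpha> y) (\<zeta> y) / fact (\<zeta> y))"
    unfolding weight_eq_pochhammer[OF assms] by (subst prod.remove[of UNIV x]) (auto simp: add_at_apply)
  moreover have "weight \<alpha> \<zeta> = pochhammer (\<alpha> x) (\<zeta> x) / fact (\<zeta> x) *
      (\<Prod>y\<in>UNIV - {x}. pochhammer (\<alpha> y) (\<zeta> y) / fact (\<zeta> y))"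
    unfolding weight_eq_pochhammer[OF assms] by (subst prod.remove[of UNIV x]) auto
  ultimately show ?thesis
    by (simp add: pochhammer_Suc del: of_nat_Suc)
qed

section \<open>Duality of the open and the absorbing system\<close>

text \<open>
  Since \<open>D\<close> is a product over the sites, a change of the configurations at one site, or at two
  sites, only affects the factors of these sites; the rest is a common factor.
\<close>

lemma D_factor_site:
  "\<exists>r. \<forall>i k. D \<alpha> \<rho> (\<xi>(x := i)) (\<eta>(x := k)) = d (\<alpha> x) \<rho> i k * r"
proof -
  have "D \<alpha> \<rho> (\<xi>(x := i)) (\<eta>(x := k)) =
      d (\<alpha> x) \<rho> i k * (\<Prod>z\<in>UNIV - {x}. d (\<alpha> z) \<rho> (\<xi> z) (\<eta> z))" for i k
    unfolding D_def by (subst prod.remove[of UNIV x]) auto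
  then show ?thesis by blast
qed

lemma D_factor_edge:
  assumes "x \<noteq> y"
  shows "\<exists>r. \<forall>i j k l. D \<alpha> \<rho> (\<xi>(x := i, y := j)) (\<eta>(x := k, y := l)) =
    d (\<alpha> x) \<rho> i k * d (\<alpha> y) \<rho> j l * r"
proof -
  have "D \<alpha> \<rho> (\<xi>(x := i, y := j)) (\<eta>(x := k, y := l)) =
      d (\<alpha> x) \<rho> i k * d (\<alpha> y) \<rho> j l * (\<Prod>z\<in>UNIV - {x} - {y}. d (\<alpha> z) \<rho> (\<xi> z) (\<eta> z))" for i j k l
    unfolding D_def using assms
    by (subst prod.remove[of UNIV x], simp, simp, subst prod.remove[of _ y]) auto
  then show ?thesis by blast
qed

lemma
  fixes \<alpha> :: "'v::finite \<Rightarrow> real" and \<rho> :: real and \<xi> \<eta> :: "'v \<Rightarrow> nat"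
  assumes "\<forall>x. 0 < \<alpha> x" "0 < \<rho>"
  shows D_remove: "real (\<eta> x) * D \<alpha> \<rho> \<xi> (remove_at x \<eta>) =
      (\<alpha> x + real (\<xi> x)) * D \<alpha> \<rho> (add_at x \<xi>) \<eta> + \<rho> * (\<alpha> x + 2 * real (\<xi> x)) * D \<alpha> \<rho> \<xi> \<eta> +
      \<rho>\<^sup>2 * (real (\<xi> x) * D \<alpha> \<rho> (remove_at x \<xi>) \<eta>)"
    and D_mult: "real (\<eta> x) * D \<alpha> \<rho> \<xi> \<eta> =
      (\<alpha> x + real (\<xi> x)) * D \<alpha> \<rho> (add_at x \<xi>) \<eta> +
      (\<rho> * \<alpha> x + (2 * \<rho> + 1) * real (\<xi> x)) * D \<alpha> \<rho> \<xi> \<eta> +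
      \<rho> * (1 + \<rho>) * (real (\<xi> x) * D \<alpha> \<rho> (remove_at x \<xi>) \<eta>)"
    and D_add: "(\<alpha> x + real (\<eta> x)) * D \<alpha> \<rho> \<xi> (add_at x \<eta>) =
      (\<alpha> x + real (\<xi> x)) * D \<alpha> \<rho> (add_at x \<xi>) \<eta> +
      (1 + \<rho>) * (\<alpha> x + 2 * real (\<xi> x)) * D \<alpha> \<rho> \<xi> \<eta> +
      (1 + \<rho>)\<^sup>2 * (real (\<xi> x) * D \<alpha> \<rho> (remove_at x \<xi>) \<eta>)"
proof -
  obtain r where r: "\<And>i k. D \<alpha> \<rho> (\<xi>(x := i)) (\<eta>(x := k)) = d (\<alpha> x) \<rho> i k * r"
    using D_factor_site by blast
  have eqs: "D \<alpha> \<rho> \<xi> \<eta> = d (\<alpha> x) \<rho> (\<xi> x) (\<eta> x) * r"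
    "D \<alpha> \<rho> \<xi> (remove_at x \<eta>) = d (\<alpha> x) \<rho> (\<xi> x) (\<eta> x - 1) * r"
    "D \<alpha> \<rho> \<xi> (add_at x \<eta>) = d (\<alpha> x) \<rho> (\<xi> x) (Suc (\<eta> x)) * r"
    "D \<alpha> \<rho> (add_at x \<xi>) \<eta> = d (\<alpha> x) \<rho> (Suc (\<xi> x)) (\<eta> x) * r"
    "D \<alpha> \<rho> (remove_at x \<xi>) \<eta> = d (\<alpha> x) \<rho> (\<xi> x - 1) (\<eta> x) * r"
    using r[of "\<xi> x" "\<eta> x"] r[of "\<xi> x" "\<eta> x - 1"] r[of "\<xi> x" "\<eta> x + 1"] r[of "\<xi> x + 1" "\<eta> x"]
      r[of "\<xi> x - 1" "\<eta> x"]
    by (simp_all add: add_at_def remove_at_def)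
  show "real (\<eta> x) * D \<alpha> \<rho> \<xi> (remove_at x \<eta>) =
      (\<alpha> x + real (\<xi> x)) * D \<alpha> \<rho> (add_at x \<xi>) \<eta> + \<rho> * (\<alpha> x + 2 * real (\<xi> x)) * D \<alpha> \<rho> \<xi> \<eta> +
      \<rho>\<^sup>2 * (real (\<xi> x) * D \<alpha> \<rho> (remove_at x \<xi>) \<eta>)"
    unfolding eqs using arg_cong[OF d_remove[OF assms(1)[rule_format] assms(2)], of "\<lambda>t. t * r" "\<eta> x" x "\<xi> x"]
    by (simp add: algebra_simps)
  show "real (\<eta> x) * D \<alpha> \<rho> \<xi> \<eta> =
      (\<alpha> x + real (\<xi> x)) * D \<alpha> \<rho> (add_at x \<xi>) \<eta> +
      (\<rho> * \<alpha> x + (2 * \<rho> + 1) * real (\<xi> x)) * D \<alpha> \<rho> \<xi> \<eta> +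
      \<rho> * (1 + \<rho>) * (real (\<xi> x) * D \<alpha> \<rho> (remove_at x \<xi>) \<eta>)"
    unfolding eqs using arg_cong[OF d_mult[OF assms(1)[rule_format] assms(2)], of "\<lambda>t. t * r" "\<eta> x" x "\<xi> x"]
    by (simp add: algebra_simps)
  show "(\<alpha> x + real (\<eta> x)) * D \<alpha> \<rho> \<xi> (add_at x \<eta>) =
      (\<alpha> x + real (\<xi> x)) * D \<alpha> \<rho> (add_at x \<xi>) \<eta> +
      (1 + \<rho>) * (\<alpha> x + 2 * real (\<xi> x)) * D \<alpha> \<rho> \<xi> \<eta> +
      (1 + \<rho>)\<^sup>2 * (real (\<xi> x) * D \<alpha> \<rho> (remove_at x \<xi>) \<eta>)"
    unfolding eqs using arg_cong[OF d_add[OF assms(1)[rule_format] assms(2)], of "\<lambda>t. t * r" x "\<eta> x" "\<xi> x"]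
    by (simp add: algebra_simps)
qed

text \<open>
  Here \<open>p\<close>, \<open>f\<close>, \<open>q\<close> stand for the one-site function after raising, without change and after
  lowering the variable \<open>m\<close>, and \<open>A\<close>, \<open>N\<close>, \<open>B\<close> for the results of the three operators in \<open>n\<close>. The
  claim is that the Casimir form \<open>A * B' + B * A' - \<dots>\<close> of a pair of sites does not change under
  this change of representation; the parameter \<open>\<rho>\<close> cancels.
\<close>

lemma edge_identity:
  fixes a b m j p q f p' q' f' \<rho> A B N A' B' N' :: real
  assumes "A = p + \<rho> * (a + 2 * m) * f + \<rho>\<^sup>2 * q"
    and "N = p + (\<rho> * a + (2 * \<rho> + 1) * m) * f + \<rho> * (1 + \<rho>) * q"
    and "B = p + (1 + \<rho>) * (a + 2 * m) * f + (1 + \<rho>)\<^sup>2 * q"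
    and "A' = p' + \<rho> * (b + 2 * j) * f' + \<rho>\<^sup>2 * q'"
    and "N' = p' + (\<rho> * b + (2 * \<rho> + 1) * j) * f' + \<rho> * (1 + \<rho>) * q'"
    and "B' = p' + (1 + \<rho>) * (b + 2 * j) * f' + (1 + \<rho>)\<^sup>2 * q'"
  shows "A * B' - N * (b * f' + N') + (A' * B - N' * (a * f + N)) =
    q * p' - m * f * ((b + j) * f') + (q' * p - j * f' * ((a + m) * f))"
  unfolding assms by algebra

text \<open>
  A single orientation of an edge is not self-dual; only the sum over both orientations is. This is
  where the symmetry of the conductances enters, through \<open>sum_edges_eqI\<close>.
\<close>

lemma D_edge_duality:
  fixes \<alpha> :: "'v::finite \<Rightarrow> real" and \<rho> :: real and \<xi> \<eta> :: "'v \<Rightarrow> nat"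
  assumes "\<forall>x. 0 < \<alpha> x" "0 < \<rho>" "x \<noteq> y"
  defines "T \<equiv> \<lambda>x y. real (\<eta> x) * (\<alpha> y + real (\<eta> y)) *
      (D \<alpha> \<rho> \<xi> (add_at y (remove_at x \<eta>)) - D \<alpha> \<rho> \<xi> \<eta>)"
    and "T' \<equiv> \<lambda>x y. real (\<xi> x) * (\<alpha> y + real (\<xi> y)) *
      (D \<alpha> \<rho> (add_at y (remove_at x \<xi>)) \<eta> - D \<alpha> \<rho> \<xi> \<eta>)"
  shows "T x y + T y x = T' x y + T' y x"
proof -
  obtain r where r: "\<And>i j k l. D \<alpha> \<rho> (\<xi>(x := i, y := j)) (\<eta>(x := k, y := l)) =
      d (\<alpha> x) \<rho> i k * d (\<alpha> y) \<rho> j l * r"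
    using D_factor_edge[OF assms(3)] by meson
  let ?dx = "d (\<alpha> x) \<rho>" and ?dy = "d (\<alpha> y) \<rho>"
  have eqs: "D \<alpha> \<rho> \<xi> \<eta> = ?dx (\<xi> x) (\<eta> x) * ?dy (\<xi> y) (\<eta> y) * r"
    "D \<alpha> \<rho> \<xi> (add_at y (remove_at x \<eta>)) = ?dx (\<xi> x) (\<eta> x - 1) * ?dy (\<xi> y) (Suc (\<eta> y)) * r"
    "D \<alpha> \<rho> \<xi> (add_at x (remove_at y \<eta>)) = ?dx (\<xi> x) (Suc (\<eta> x)) * ?dy (\<xi> y) (\<eta> y - 1) * r"
    "D \<alpha> \<rho> (add_at y (remove_at x \<xi>)) \<eta> = ?dx (\<xi> x - 1) (\<eta> x) * ?dy (Suc (\<xi> y)) (\<eta> y) * r"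
    "D \<alpha> \<rho> (add_at x (remove_at y \<xi>)) \<eta> = ?dx (Suc (\<xi> x)) (\<eta> x) * ?dy (\<xi> y - 1) (\<eta> y) * r"
    using r[of "\<xi> x" "\<xi> y" "\<eta> x" "\<eta> y"] r[of "\<xi> x" "\<xi> y" "\<eta> x - 1" "\<eta> y + 1"]
      r[of "\<xi> x" "\<xi> y" "\<eta> x + 1" "\<eta> y - 1"] r[of "\<xi> x - 1" "\<xi> y + 1" "\<eta> x" "\<eta> y"]
      r[of "\<xi> x + 1" "\<xi> y - 1" "\<eta> x" "\<eta> y"] assms(3)
    by (simp_all add: add_at_def remove_at_def fun_upd_twist)
  note id = edge_identity[OF
      d_remove[of "\<alpha> x" \<rho> "\<eta> x" "\<xi> x", OF assms(1)[rule_format] assms(2)]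
      d_mult[of "\<alpha> x" \<rho> "\<eta> x" "\<xi> x", OF assms(1)[rule_format] assms(2)]
      d_add[of "\<alpha> x" \<rho> "\<eta> x" "\<xi> x", OF assms(1)[rule_format] assms(2)]
      d_remove[of "\<alpha> y" \<rho> "\<eta> y" "\<xi> y", OF assms(1)[rule_format] assms(2)]
      d_mult[of "\<alpha> y" \<rho> "\<eta> y" "\<xi> y", OF assms(1)[rule_format] assms(2)]
      d_add[of "\<alpha> y" \<rho> "\<eta> y" "\<xi> y", OF assms(1)[rule_format] assms(2)]]
  show ?thesis
    unfolding T_def T'_def eqs using arg_cong[OF id, of "\<lambda>t. t * r"]
    by (simp add: algebra_simps)
qed

lemma sum_edges_eqI:
  fixes c :: "'v::finite \<Rightarrow> 'v \<Rightarrow> real"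
  assumes "connected_weighted_graph c"
    and "\<And>x y. x \<noteq> y \<Longrightarrow> T x y + T y x = T' x y + T' y x"
  shows "(\<Sum>x\<in>UNIV. \<Sum>y\<in>UNIV. c x y * T x y) = (\<Sum>x\<in>UNIV. \<Sum>y\<in>UNIV. c x y * T' x y)"
proof -
  have c: "c x y = c y x" "c x x = 0" for x y
    using assms(1) by (auto simp: connected_weighted_graph_def)
  have sym: "2 * (\<Sum>x\<in>UNIV. \<Sum>y\<in>UNIV. c x y * S x y) =
      (\<Sum>x\<in>UNIV. \<Sum>y\<in>UNIV. c x y * (S x y + S y x))" for S :: "'v \<Rightarrow> 'v \<Rightarrow> real"
  proof -
    have "(\<Sum>x\<in>UNIV. \<Sum>y\<in>UNIV. c x y * S x y) = (\<Sum>x\<in>UNIV. \<Sum>y\<in>UNIV. c y x * S y x)"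
      by (rule sum.swap)
    also have "\<dots> = (\<Sum>x\<in>UNIV. \<Sum>y\<in>UNIV. c x y * S y x)"
      by (intro sum.cong refl arg_cong2[where f = "(*)"] c(1))
    finally show ?thesis by (simp add: distrib_left sum.distrib)
  qed
  have "c x y * (T x y + T y x) = c x y * (T' x y + T' y x)" for x y
    using assms(2)[of x y] c(2)[of x] by (cases "x = y") auto
  then have "2 * (\<Sum>x\<in>UNIV. \<Sum>y\<in>UNIV. c x y * T x y) = 2 * (\<Sum>x\<in>UNIV. \<Sum>y\<in>UNIV. c x y * T' x y)"
    unfolding sym by (simp only:)
  then show ?thesis by simp
qed

text \<open>
  Duality of the open and the absorbing system up to one particle less. In the reservoir at \<open>x\<close>, the
  one-site relations give \<open>(1 + \<theta> x) * (- m - \<rho> * M) + \<theta> x * ((1 + \<rho>) * M + m) = - m + (\<theta> x - \<rho>) * M\<close>,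
  where \<open>m\<close> is multiplication by \<open>\<xi> x\<close> and \<open>M\<close> is \<open>\<xi> x\<close> times the removal of a particle.
\<close>

lemma open_gen_D:
  fixes \<alpha> :: "'v::finite \<Rightarrow> real"
  assumes "connected_weighted_graph c" "\<forall>x. 0 < \<alpha> x" "0 < \<rho>" "\<xi> \<in> \<Xi> k"
  shows "open_gen c \<alpha> \<omega> \<theta> (D \<alpha> \<rho> \<xi>) \<eta> = absorbing_gen c \<alpha> \<omega> k (\<lambda>\<xi>. D \<alpha> \<rho> \<xi> \<eta>) \<xi> +
    (\<Sum>x\<in>UNIV. \<omega> x * (\<theta> x - \<rho>) * (real (\<xi> x) * D \<alpha> \<rho> (remove_at x \<xi>) \<eta>))"
proof -
  have edges: "(\<Sum>x\<in>UNIV. \<Sum>y\<in>UNIV. c x y * real (\<eta> x) * (\<alpha> y + real (\<eta> y)) *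
        (D \<alpha> \<rho> \<xi> (add_at y (remove_at x \<eta>)) - D \<alpha> \<rho> \<xi> \<eta>)) =
      (\<Sum>x\<in>UNIV. \<Sum>y\<in>UNIV. c x y * real (\<xi> x) * (\<alpha> y + real (\<xi> y)) *
        (D \<alpha> \<rho> (add_at y (remove_at x \<xi>)) \<eta> - D \<alpha> \<rho> \<xi> \<eta>))"
  proof -
    have "(\<Sum>x\<in>UNIV. \<Sum>y\<in>UNIV. c x y * (real (\<eta> x) * (\<alpha> y + real (\<eta> y)) *
          (D \<alpha> \<rho> \<xi> (add_at y (remove_at x \<eta>)) - D \<alpha> \<rho> \<xi> \<eta>))) =
        (\<Sum>x\<in>UNIV. \<Sum>y\<in>UNIV. c x y * (real (\<xi> x) * (\<alpha> y + real (\<xi> y)) *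
          (D \<alpha> \<rho> (add_at y (remove_at x \<xi>)) \<eta> - D \<alpha> \<rho> \<xi> \<eta>)))"
      by (rule sum_edges_eqI[OF assms(1)]) (rule D_edge_duality[where \<eta> = \<eta> and \<xi> = \<xi>, OF assms(2,3)])
    then show ?thesis by (simp only: mult.assoc)
  qed
  have reservoir: "real (\<eta> x) * (1 + \<theta> x) * (D \<alpha> \<rho> \<xi> (remove_at x \<eta>) - D \<alpha> \<rho> \<xi> \<eta>) +
      \<theta> x * (\<alpha> x + real (\<eta> x)) * (D \<alpha> \<rho> \<xi> (add_at x \<eta>) - D \<alpha> \<rho> \<xi> \<eta>) =
      - real (\<xi> x) * D \<alpha> \<rho> \<xi> \<eta> + (\<theta> x - \<rho>) * (real (\<xi> x) * D \<alpha> \<rho> (remove_at x \<xi>) \<eta>)" for x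
    using D_remove[of \<alpha> \<rho> \<eta> x \<xi>, OF assms(2,3)] D_mult[of \<alpha> \<rho> \<eta> x \<xi>, OF assms(2,3)]
      D_add[of \<alpha> \<rho> x \<eta> \<xi>, OF assms(2,3)]
    by algebra
  have "(\<Sum>x\<in>UNIV. \<omega> x * (- real (\<xi> x) * D \<alpha> \<rho> \<xi> \<eta> +
        (\<theta> x - \<rho>) * (real (\<xi> x) * D \<alpha> \<rho> (remove_at x \<xi>) \<eta>))) =
      - (D \<alpha> \<rho> \<xi> \<eta> * (\<Sum>x\<in>UNIV. \<omega> x * real (\<xi> x))) +
      (\<Sum>x\<in>UNIV. \<omega> x * (\<theta> x - \<rho>) * (real (\<xi> x) * D \<alpha> \<rho> (remove_at x \<xi>) \<eta>))"
    unfolding sum_distrib_left sum_negf[symmetric] sum.distrib[symmetric]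
    by (intro sum.cong refl) (simp add: algebra_simps)
  then show ?thesis
    unfolding open_gen_def absorbing_gen_def reservoir edges restrict_apply'[OF assms(4)] by linarith
qed

section \<open>Symmetry of the absorbing generator\<close>

text \<open>
  Detailed balance for jumps: after removal of the jumping particle, both sides are sums over the
  remaining \<open>k - 1\<close> particles, with the symmetric factor
  \<open>(\<alpha> x + \<zeta> x) * (\<alpha> y + \<zeta> y)\<close>.
\<close>

lemma sum_weight_exchange:
  fixes \<alpha> :: "'v::finite \<Rightarrow> real" and f g :: "('v \<Rightarrow> nat) \<Rightarrow> real"
  assumes "\<forall>x. 0 < \<alpha> x" "x \<noteq> y"
  shows "(\<Sum>\<xi>\<in>\<Xi> k. weight \<alpha> \<xi> * (real (\<xi> x) * (\<alpha> y + real (\<xi> y))) *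
        (f \<xi> * g (add_at y (remove_at x \<xi>)))) =
      (\<Sum>\<xi>\<in>\<Xi> k. weight \<alpha> \<xi> * (real (\<xi> y) * (\<alpha> x + real (\<xi> x))) *
        (g \<xi> * f (add_at x (remove_at y \<xi>))))"
proof (cases k)
  case 0
  then show ?thesis by (simp add: \<Xi>_0)
next
  case (Suc j)
  have shift: "(\<Sum>\<xi>\<in>\<Xi> (Suc j). weight \<alpha> \<xi> * (real (\<xi> x) * (\<alpha> y + real (\<xi> y))) *
        (f \<xi> * g (add_at y (remove_at x \<xi>)))) =
      (\<Sum>\<zeta>\<in>\<Xi> j. weight \<alpha> \<zeta> * (\<alpha> x + real (\<zeta> x)) * (\<alpha> y + real (\<zeta> y)) *
        (f (add_at x \<zeta>) * g (add_at y \<zeta>)))"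
    if "x \<noteq> y" for x y and f g :: "('v \<Rightarrow> nat) \<Rightarrow> real"
  proof -
    have "(\<Sum>\<xi>\<in>\<Xi> (Suc j). weight \<alpha> \<xi> * (real (\<xi> x) * (\<alpha> y + real (\<xi> y))) *
        (f \<xi> * g (add_at y (remove_at x \<xi>)))) =
      (\<Sum>\<xi>\<in>\<Xi> (Suc j). real (\<xi> x) * (weight \<alpha> \<xi> * (\<alpha> y + real (\<xi> y)) *
        (f \<xi> * g (add_at y (remove_at x \<xi>)))))"
      by (simp add: mult_ac)
    also have "\<dots> = (\<Sum>\<zeta>\<in>\<Xi> j. (real (\<zeta> x + 1) * weight \<alpha> (add_at x \<zeta>)) * (\<alpha> y + real (\<zeta> y)) *
        (f (add_at x \<zeta>) * g (add_at y \<zeta>)))"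
      unfolding sum_\<Xi>_Suc using that by (simp add: mult.assoc add_at_apply)
    also have "\<dots> = (\<Sum>\<zeta>\<in>\<Xi> j. weight \<alpha> \<zeta> * (\<alpha> x + real (\<zeta> x)) * (\<alpha> y + real (\<zeta> y)) *
        (f (add_at x \<zeta>) * g (add_at y \<zeta>)))"
    proof (intro sum.cong refl)
      fix \<zeta>
      show "real (\<zeta> x + 1) * weight \<alpha> (add_at x \<zeta>) * (\<alpha> y + real (\<zeta> y)) *
          (f (add_at x \<zeta>) * g (add_at y \<zeta>)) =
          weight \<alpha> \<zeta> * (\<alpha> x + real (\<zeta> x)) * (\<alpha> y + real (\<zeta> y)) *
          (f (add_at x \<zeta>) * g (add_at y \<zeta>))"
        unfolding weight_add_at[of \<alpha> \<zeta> x, OF assms(1)] by simp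
    qed
    finally show ?thesis .
  qed
  show ?thesis
    unfolding Suc shift[OF assms(2)] shift[OF assms(2)[symmetric]] by (simp add: mult_ac)
qed

text \<open>
  The jump part is symmetric by detailed balance, while the diagonal part of the jumps and the
  killing are multiplication operators.
\<close>

lemma absorbing_gen_symmetric:
  fixes \<alpha> :: "'v::finite \<Rightarrow> real"
  assumes "connected_weighted_graph c" "\<forall>x. 0 < \<alpha> x"
  shows "(\<Sum>\<xi>\<in>\<Xi> k. weight \<alpha> \<xi> * (f \<xi> * absorbing_gen c \<alpha> \<omega> k g \<xi>)) =
    (\<Sum>\<xi>\<in>\<Xi> k. weight \<alpha> \<xi> * (absorbing_gen c \<alpha> \<omega> k f \<xi> * g \<xi>))"
proof -
  define E where "E f g x y = (\<Sum>\<xi>\<in>\<Xi> k. weight \<alpha> \<xi> * (real (\<xi> x) * (\<alpha> y + real (\<xi> y))) *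
      (f \<xi> * g (add_at y (remove_at x \<xi>))))" for f g :: "('v \<Rightarrow> nat) \<Rightarrow> real" and x y
  define E0 where "E0 f g x y = (\<Sum>\<xi>\<in>\<Xi> k. weight \<alpha> \<xi> * (real (\<xi> x) * (\<alpha> y + real (\<xi> y))) * (f \<xi> * g \<xi>))"
    for f g :: "('v \<Rightarrow> nat) \<Rightarrow> real" and x y
  define K where "K f g = (\<Sum>\<xi>\<in>\<Xi> k. weight \<alpha> \<xi> * (\<Sum>x\<in>UNIV. \<omega> x * real (\<xi> x)) * (f \<xi> * g \<xi>))"
    for f g :: "('v \<Rightarrow> nat) \<Rightarrow> real"
  have form: "(\<Sum>\<xi>\<in>\<Xi> k. weight \<alpha> \<xi> * (f \<xi> * absorbing_gen c \<alpha> \<omega> k g \<xi>)) =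
      (\<Sum>x\<in>UNIV. \<Sum>y\<in>UNIV. c x y * (E f g x y - E0 f g x y)) - K f g" for f g
  proof -
    have "(\<Sum>x\<in>UNIV. \<Sum>y\<in>UNIV. c x y * (E f g x y - E0 f g x y)) =
        (\<Sum>x\<in>UNIV. \<Sum>y\<in>UNIV. \<Sum>\<xi>\<in>\<Xi> k. weight \<alpha> \<xi> * (f \<xi> * (c x y * real (\<xi> x) *
          (\<alpha> y + real (\<xi> y)) * (g (add_at y (remove_at x \<xi>)) - g \<xi>))))"
      unfolding E_def E0_def by (simp add: sum_distrib_left algebra_simps flip: sum_subtractf)
    also have "\<dots> = (\<Sum>x\<in>UNIV. \<Sum>\<xi>\<in>\<Xi> k. \<Sum>y\<in>UNIV. weight \<alpha> \<xi> * (f \<xi> * (c x y * real (\<xi> x) *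
          (\<alpha> y + real (\<xi> y)) * (g (add_at y (remove_at x \<xi>)) - g \<xi>))))"
      by (intro sum.cong refl sum.swap)
    also have "\<dots> = (\<Sum>\<xi>\<in>\<Xi> k. \<Sum>x\<in>UNIV. \<Sum>y\<in>UNIV. weight \<alpha> \<xi> * (f \<xi> * (c x y * real (\<xi> x) *
          (\<alpha> y + real (\<xi> y)) * (g (add_at y (remove_at x \<xi>)) - g \<xi>))))"
      by (rule sum.swap)
    finally show ?thesis
      unfolding K_def absorbing_gen_def
      by (simp add: sum_distrib_left algebra_simps flip: sum_subtractf)
  qed
  have "(\<Sum>x\<in>UNIV. \<Sum>y\<in>UNIV. c x y * (E f g x y - E0 f g x y)) =
      (\<Sum>x\<in>UNIV. \<Sum>y\<in>UNIV. c x y * (E g f x y - E0 g f x y))"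
  proof (rule sum_edges_eqI[OF assms(1)])
    fix x y :: 'v
    assume "x \<noteq> y"
    then have "E f g x y = E g f y x" "E f g y x = E g f x y"
      unfolding E_def by (auto intro: sum_weight_exchange[OF assms(2)])
    moreover have "E0 f g x y = E0 g f x y" "E0 f g y x = E0 g f y x"
      unfolding E0_def by (simp_all add: mult_ac)
    ultimately show "E f g x y - E0 f g x y + (E f g y x - E0 f g y x) =
        E g f x y - E0 g f x y + (E g f y x - E0 g f y x)" by simp
  qed
  moreover have "K f g = K g f"
    unfolding K_def by (simp add: mult_ac)
  ultimately show ?thesis
    using form[of f g] form[of g f] by (simp add: mult_ac)
qed

section \<open>The intertwining relation for lifted functions\<close>

lemma \<mu>_eq_pochhammer:
  fixes \<alpha> :: "'v::finite \<Rightarrow> real"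
  assumes "\<forall>x. 0 < \<alpha> x"
  shows "\<mu> \<alpha> k \<xi> = weight \<alpha> \<xi> * (fact k / pochhammer (\<Sum>x\<in>UNIV. \<alpha> x) k)"
proof -
  have "0 < (\<Sum>x\<in>UNIV. \<alpha> x)" using assms by (intro sum_pos) auto
  then show ?thesis
    using less_imp_neq[OF Gamma_real_pos[of "\<Sum>x\<in>UNIV. \<alpha> x"]]
    by (simp add: \<mu>_def Gamma_ratio_pochhammer)
qed

text \<open>
  On the empty configuration \<open>\<mu> \<alpha> 0\<close> and \<open>D\<close> are \<open>1\<close>, so that the separate clause for
  \<open>k = 0\<close> in the definition agrees with the general formula.
\<close>

lemma lifted_eq_sum:
  fixes \<alpha> :: "'v::finite \<Rightarrow> real"
  assumes "\<forall>x. 0 < \<alpha> x" "0 < \<rho>"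
  shows "lifted \<alpha> \<rho> k \<psi> \<eta> = (\<Sum>\<xi>\<in>\<Xi> k. \<mu> \<alpha> k \<xi> * \<psi> \<xi> * D \<alpha> \<rho> \<xi> \<eta>)"
proof (cases "k = 0")
  case True
  have "\<mu> \<alpha> 0 (\<lambda>_. 0) = 1"
    unfolding \<mu>_eq_pochhammer[OF assms(1)] weight_eq_pochhammer[OF assms(1)] by simp
  moreover have "D \<alpha> \<rho> (\<lambda>_. 0) \<eta> = 1"
    using assms by (simp add: D_def d_zero)
  ultimately show ?thesis
    unfolding lifted_def True by (simp add: \<Xi>_0)
next
  case False
  then show ?thesis by (simp only: lifted_def if_False)
qed

lemma open_gen_linear:
  "open_gen c \<alpha> \<omega> \<theta> (\<lambda>\<eta>. a * f \<eta> + g \<eta>) \<eta> =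
     a * open_gen c \<alpha> \<omega> \<theta> f \<eta> + open_gen c \<alpha> \<omega> \<theta> g \<eta>"
proof -
  have "(\<Sum>x\<in>UNIV. \<Sum>y\<in>UNIV. c x y * real (\<eta> x) * (\<alpha> y + real (\<eta> y)) *
        (a * f (add_at y (remove_at x \<eta>)) + g (add_at y (remove_at x \<eta>)) - (a * f \<eta> + g \<eta>))) =
      a * (\<Sum>x\<in>UNIV. \<Sum>y\<in>UNIV. c x y * real (\<eta> x) * (\<alpha> y + real (\<eta> y)) *
        (f (add_at y (remove_at x \<eta>)) - f \<eta>)) +
      (\<Sum>x\<in>UNIV. \<Sum>y\<in>UNIV. c x y * real (\<eta> x) * (\<alpha> y + real (\<eta> y)) *
        (g (add_at y (remove_at x \<eta>)) - g \<eta>))"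
    unfolding sum_distrib_left sum.distrib[symmetric]
    by (intro sum.cong refl) algebra
  moreover have "(\<Sum>x\<in>UNIV. \<omega> x *
        (real (\<eta> x) * (1 + \<theta> x) * (a * f (remove_at x \<eta>) + g (remove_at x \<eta>) - (a * f \<eta> + g \<eta>)) +
         \<theta> x * (\<alpha> x + real (\<eta> x)) * (a * f (add_at x \<eta>) + g (add_at x \<eta>) - (a * f \<eta> + g \<eta>)))) =
      a * (\<Sum>x\<in>UNIV. \<omega> x * (real (\<eta> x) * (1 + \<theta> x) * (f (remove_at x \<eta>) - f \<eta>) +
         \<theta> x * (\<alpha> x + real (\<eta> x)) * (f (add_at x \<eta>) - f \<eta>))) +
      (\<Sum>x\<in>UNIV. \<omega> x * (real (\<eta> x) * (1 + \<theta> x) * (g (remove_at x \<eta>) - g \<eta>) +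
         \<theta> x * (\<alpha> x + real (\<eta> x)) * (g (add_at x \<eta>) - g \<eta>)))"
    unfolding sum_distrib_left sum.distrib[symmetric]
    by (intro sum.cong refl) algebra
  ultimately show ?thesis
    unfolding open_gen_def by (simp only: distrib_left add_ac)
qed

lemma open_gen_sum:
  assumes "finite S"
  shows "open_gen c \<alpha> \<omega> \<theta> (\<lambda>\<eta>. \<Sum>\<xi>\<in>S. a \<xi> * f \<xi> \<eta>) \<eta> = (\<Sum>\<xi>\<in>S. a \<xi> * open_gen c \<alpha> \<omega> \<theta> (f \<xi>) \<eta>)"
  using assms
proof (induction S)
  case empty
  show ?case by (simp add: open_gen_def)
next
  case (insert \<xi> S)
  then show ?case by (simp add: open_gen_linear)
qed

text \<open>
  The intertwining holds for arbitrary \<open>\<psi>\<close>. The lowering term arises by reindexing with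
  \<open>sum_\<Xi>_Suc\<close>; its factor \<open>(j + 1) / (\<bar>\<alpha>\<bar> + j)\<close> is the ratio of the normalisations of
  \<open>\<mu> \<alpha> (j + 1)\<close> and \<open>\<mu> \<alpha> j\<close>.
\<close>

lemma open_gen_lifted:
  fixes \<alpha> :: "'v::finite \<Rightarrow> real"
  assumes "connected_weighted_graph c" "\<forall>x. 0 < \<alpha> x" "0 < \<rho>"
  shows "open_gen c \<alpha> \<omega> \<theta> (lifted \<alpha> \<rho> k \<psi>) \<eta> =
    lifted \<alpha> \<rho> k (absorbing_gen c \<alpha> \<omega> k \<psi>) \<eta> +
    (if k = 0 then 0 else lifted \<alpha> \<rho> (k - 1) (lowering \<alpha> \<omega> \<theta> \<rho> (k - 1) \<psi>) \<eta>)"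
proof -
  define low where "low = (\<Sum>\<xi>\<in>\<Xi> k. \<mu> \<alpha> k \<xi> * \<psi> \<xi> *
    (\<Sum>x\<in>UNIV. \<omega> x * (\<theta> x - \<rho>) * (real (\<xi> x) * D \<alpha> \<rho> (remove_at x \<xi>) \<eta>)))"
  have "lifted \<alpha> \<rho> k \<psi> = (\<lambda>\<eta>. \<Sum>\<xi>\<in>\<Xi> k. \<mu> \<alpha> k \<xi> * \<psi> \<xi> * D \<alpha> \<rho> \<xi> \<eta>)"
    using lifted_eq_sum[OF assms(2,3)] by blast
  then have "open_gen c \<alpha> \<omega> \<theta> (lifted \<alpha> \<rho> k \<psi>) \<eta> =
      (\<Sum>\<xi>\<in>\<Xi> k. \<mu> \<alpha> k \<xi> * \<psi> \<xi> * open_gen c \<alpha> \<omega> \<theta> (D \<alpha> \<rho> \<xi>) \<eta>)"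
    by (simp add: open_gen_sum)
  also have "\<dots> = (\<Sum>\<xi>\<in>\<Xi> k. \<mu> \<alpha> k \<xi> * \<psi> \<xi> * absorbing_gen c \<alpha> \<omega> k (\<lambda>\<xi>. D \<alpha> \<rho> \<xi> \<eta>) \<xi>) + low"
    unfolding low_def
    by (simp add: open_gen_D[OF assms] distrib_left sum.distrib cong: sum.cong)
  also have "(\<Sum>\<xi>\<in>\<Xi> k. \<mu> \<alpha> k \<xi> * \<psi> \<xi> * absorbing_gen c \<alpha> \<omega> k (\<lambda>\<xi>. D \<alpha> \<rho> \<xi> \<eta>) \<xi>) =
      lifted \<alpha> \<rho> k (absorbing_gen c \<alpha> \<omega> k \<psi>) \<eta>"
    using arg_cong[OF absorbing_gen_symmetric[OF assms(1,2), where k = k and f = \<psi> and \<omega> = \<omega> and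
          g = "\<lambda>\<xi>. D \<alpha> \<rho> \<xi> \<eta>"],
        of "\<lambda>t. fact k / pochhammer (\<Sum>x\<in>UNIV. \<alpha> x) k * t"]
    unfolding lifted_eq_sum[OF assms(2,3)] \<mu>_eq_pochhammer[OF assms(2)] sum_distrib_left
    by (simp add: mult_ac)
  also have "low = (if k = 0 then 0 else lifted \<alpha> \<rho> (k - 1) (lowering \<alpha> \<omega> \<theta> \<rho> (k - 1) \<psi>) \<eta>)"
  proof (cases k)
    case 0
    then show ?thesis by (simp add: low_def \<Xi>_0)
  next
    case (Suc j)
    define s where "s = (\<Sum>x\<in>UNIV. \<alpha> x)"
    have s: "0 < s" unfolding s_def using assms(2) by (intro sum_pos) auto
    define z where "z = fact j / pochhammer s j"
    have Z: "fact (Suc j) / pochhammer s (Suc j) = z * (real (Suc j) / (s + real j))"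
      by (simp add: z_def pochhammer_Suc)
    have \<mu>_Suc: "\<mu> \<alpha> (Suc j) \<xi> = z * (real (Suc j) / (s + real j)) * weight \<alpha> \<xi>" for \<xi>
      unfolding \<mu>_eq_pochhammer[OF assms(2)] s_def[symmetric] Z by simp
    have "low = (\<Sum>x\<in>UNIV. \<omega> x * (\<theta> x - \<rho>) * (z * (real (Suc j) / (s + real j))) *
        (\<Sum>\<xi>\<in>\<Xi> (Suc j). real (\<xi> x) * (weight \<alpha> \<xi> * \<psi> \<xi> * D \<alpha> \<rho> (remove_at x \<xi>) \<eta>)))"
      unfolding low_def Suc \<mu>_Suc sum_distrib_left
      by (subst sum.swap) (simp add: mult_ac)
    also have "\<dots> = (\<Sum>x\<in>UNIV. \<omega> x * (\<theta> x - \<rho>) * (z * (real (Suc j) / (s + real j))) *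
        (\<Sum>\<zeta>\<in>\<Xi> j. (real (\<zeta> x + 1) * weight \<alpha> (add_at x \<zeta>)) * \<psi> (add_at x \<zeta>) * D \<alpha> \<rho> \<zeta> \<eta>))"
      unfolding sum_\<Xi>_Suc by (simp add: mult.assoc)
    also have "\<dots> = (\<Sum>x\<in>UNIV. \<Sum>\<zeta>\<in>\<Xi> j. z * weight \<alpha> \<zeta> * (real (Suc j) * (\<omega> x * (\<theta> x - \<rho>) *
        ((\<alpha> x + real (\<zeta> x)) / (s + real j)) * \<psi> (add_at x \<zeta>))) * D \<alpha> \<rho> \<zeta> \<eta>)"
      unfolding sum_distrib_left
    proof (intro sum.cong refl)
      fix x \<zeta>
      show "\<omega> x * (\<theta> x - \<rho>) * (z * (real (Suc j) / (s + real j))) *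
          (real (\<zeta> x + 1) * weight \<alpha> (add_at x \<zeta>) * \<psi> (add_at x \<zeta>) * D \<alpha> \<rho> \<zeta> \<eta>) =
          z * weight \<alpha> \<zeta> * (real (Suc j) * (\<omega> x * (\<theta> x - \<rho>) *
          ((\<alpha> x + real (\<zeta> x)) / (s + real j)) * \<psi> (add_at x \<zeta>))) * D \<alpha> \<rho> \<zeta> \<eta>"
        unfolding weight_add_at[of \<alpha> \<zeta> x, OF assms(2)] by (simp add: mult_ac)
    qed
    also have "\<dots> = lifted \<alpha> \<rho> j (lowering \<alpha> \<omega> \<theta> \<rho> j \<psi>) \<eta>"
      unfolding lifted_eq_sum[OF assms(2,3)] \<mu>_eq_pochhammer[OF assms(2)] lowering_def s_def[symmetric]
        z_def[symmetric]
      by (subst sum.swap) (simp add: sum_distrib_left sum_distrib_right mult_ac)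
    finally show ?thesis using Suc by simp
  qed
  finally show ?thesis .
qed

theorem open_gen_lifted_eigenpair:
  fixes \<alpha> :: "'v::finite \<Rightarrow> real"
  assumes "connected_weighted_graph c" "\<forall>x. 0 < \<alpha> x" "0 < \<rho>"
    and "absorbing_eigenpair c \<alpha> \<omega> k lam \<psi>"
  shows "open_gen c \<alpha> \<omega> \<theta> (lifted \<alpha> \<rho> k \<psi>) \<eta> = - lam * lifted \<alpha> \<rho> k \<psi> \<eta> +
    (if k = 0 then 0 else lifted \<alpha> \<rho> (k - 1) (lowering \<alpha> \<omega> \<theta> \<rho> (k - 1) \<psi>) \<eta>)"
proof -
  have "absorbing_gen c \<alpha> \<omega> k \<psi> \<xi> = - lam * \<psi> \<xi>" if "\<xi> \<in> \<Xi> k" for \<xi>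
    using assms(4) that by (force simp: absorbing_eigenpair_def)
  then have "lifted \<alpha> \<rho> k (absorbing_gen c \<alpha> \<omega> k \<psi>) \<eta> = - lam * lifted \<alpha> \<rho> k \<psi> \<eta>"
    unfolding lifted_eq_sum[OF assms(2,3)] sum_distrib_left by (intro sum.cong) auto
  then show ?thesis
    unfolding open_gen_lifted[OF assms(1-3)] by simp
qed

section \<open>Symmetric operators on functions on a finite set\<close>

text \<open>
  A self-adjoint operator on the functions on a finite set, with a weighted inner product. Functions
  are total, so that \<open>local\<close> expresses that \<open>L u\<close> depends on the values of \<open>u\<close> on \<open>A\<close> only.
  The number of points of the set is not fixed by a type, since the set is \<open>\<Xi> k\<close> with varying \<open>k\<close>.
\<close>

locale symmetric_operator =
  fixes A :: "'a set" and w :: "'a \<Rightarrow> real" and L :: "('a \<Rightarrow> real) \<Rightarrow> 'a \<Rightarrow> real"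
  assumes finite_A: "finite A"
    and w_pos: "a \<in> A \<Longrightarrow> 0 < w a"
    and linear: "a \<in> A \<Longrightarrow> L (\<lambda>b. s * u b + v b) a = s * L u a + L v a"
    and local: "a \<in> A \<Longrightarrow> (\<And>b. b \<in> A \<Longrightarrow> u b = v b) \<Longrightarrow> L u a = L v a"
    and symmetric: "(\<Sum>a\<in>A. w a * (u a * L v a)) = (\<Sum>a\<in>A. w a * (L u a * v a))"
begin

definition ip :: "('a \<Rightarrow> real) \<Rightarrow> ('a \<Rightarrow> real) \<Rightarrow> real" where
  "ip u v = (\<Sum>a\<in>A. w a * (u a * v a))"

lemma ip_commute: "ip u v = ip v u"
  by (simp add: ip_def mult_ac)

lemma ip_cong: "(\<And>a. a \<in> A \<Longrightarrow> u a = u' a) \<Longrightarrow> (\<And>a. a \<in> A \<Longrightarrow> v a = v' a) \<Longrightarrow> ip u v = ip u' v'"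
  by (simp add: ip_def)

lemma ip_restrict [simp]: "ip (restrict u A) v = ip u v" "ip u (restrict v A) = ip u v"
  by (simp_all add: ip_def)

lemma ip_linear_left: "ip (\<lambda>a. s * u a + v a) z = s * ip u z + ip v z"
  by (simp add: ip_def sum_distrib_left sum.distrib[symmetric] algebra_simps)

lemma ip_linear_right: "ip z (\<lambda>a. s * u a + v a) = s * ip z u + ip z v"
  by (simp add: ip_def sum_distrib_left sum.distrib[symmetric] algebra_simps)

lemma ip_sum_left: "ip (\<lambda>a. \<Sum>b\<in>B. k b * g b a) z = (\<Sum>b\<in>B. k b * ip (g b) z)"
  unfolding ip_def sum_distrib_left sum_distrib_right
  by (subst sum.swap) (simp add: mult_ac)

lemma ip_scale: "ip (\<lambda>a. s * u a) z = s * ip u z" "ip z (\<lambda>a. s * u a) = s * ip z u"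
  by (simp_all add: ip_def sum_distrib_left mult_ac)

lemma weighted_square_nonneg: "a \<in> A \<Longrightarrow> 0 \<le> w a * (u a * u a)"
  using w_pos[of a] by simp

lemma ip_nonneg: "0 \<le> ip u u"
  unfolding ip_def by (intro sum_nonneg weighted_square_nonneg)

lemma ip_eq_0D: "ip u u = 0 \<Longrightarrow> a \<in> A \<Longrightarrow> u a = 0"
proof -
  assume "ip u u = 0" and a: "a \<in> A"
  then have "w a * (u a * u a) = 0"
    using sum_nonneg_eq_0_iff[OF finite_A, of "\<lambda>a. w a * (u a * u a)"] weighted_square_nonneg[of _ u]
    by (simp add: ip_def del: mult_eq_0_iff)
  then show "u a = 0" using w_pos[OF a] by simp
qed

lemma ip_pos: "a \<in> A \<Longrightarrow> u a \<noteq> 0 \<Longrightarrow> 0 < ip u u"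
  using ip_nonneg[of u] ip_eq_0D[of u a] by (auto simp: less_le)

lemma symmetric_ip: "ip u (L v) = ip (L u) v"
  using symmetric by (simp add: ip_def)

text \<open>
  The matrix of the operator, which makes the quadratic form visibly continuous in the product
  topology.
\<close>

lemma operator_kernel:
  assumes "a \<in> A"
  shows "L u a = (\<Sum>b\<in>A. u b * L (\<lambda>c. of_bool (c = b)) a)"
proof -
  have L0: "L (\<lambda>_. 0) a = 0"
    using linear[OF assms, of 1 "\<lambda>_. 0" "\<lambda>_. 0"] by simp
  define e where "e b c = (of_bool (c = b) :: real)" for b c :: 'a
  have "L (\<lambda>c. \<Sum>b\<in>S. u b * e b c) a = (\<Sum>b\<in>S. u b * L (e b) a)" if "finite S" for S
    using that by (induction S) (simp_all add: L0 linear[OF assms])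
  moreover have "L u a = L (\<lambda>c. \<Sum>b\<in>A. u b * e b c) a"
    using finite_A by (intro local[OF assms]) (simp add: e_def)
  ultimately show ?thesis using finite_A by (simp add: e_def[abs_def])
qed

lemma continuous_on_ip: "continuous_on UNIV (\<lambda>u. ip u v)" "continuous_on UNIV (\<lambda>u. ip u u)"
  "continuous_on UNIV (\<lambda>u. ip u (L u))"
proof -
  have coord: "continuous_on UNIV (\<lambda>u. u a)" for a :: 'a
    by (rule continuous_on_product_coordinates)
  show "continuous_on UNIV (\<lambda>u. ip u v)" "continuous_on UNIV (\<lambda>u. ip u u)"
    unfolding ip_def by (intro continuous_intros coord)+
  have "ip u (L u) = (\<Sum>a\<in>A. w a * (u a * (\<Sum>b\<in>A. u b * L (\<lambda>c. of_bool (c = b)) a)))" for u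
    unfolding ip_def using operator_kernel[of _ u] by simp
  then show "continuous_on UNIV (\<lambda>u. ip u (L u))"
    by (simp only:) (intro continuous_intros coord)
qed

text \<open>
  The sphere is a closed subset of a product of compact intervals; off \<open>A\<close> the extensional functions
  have the single value \<open>undefined\<close>.
\<close>

lemma compact_unit_sphere:
  "compact {u. u \<in> extensional A \<and> ip u u = 1 \<and> (\<forall>b\<in>B. ip u b = 0)}" (is "compact ?S")
proof -
  define K where "K a = (if a \<in> A then {- (1 + 1 / w a)..1 + 1 / w a} else {undefined::real})" for a
  have "compactin (product_topology (\<lambda>_. euclidean) UNIV) (PiE UNIV K)"
    unfolding compactin_PiE by (auto simp: K_def)
  then have "compact (PiE UNIV K)"
    by (simp add: euclidean_product_topology)
  moreover have "closed ({u. ip u u = 1} \<inter> (\<Inter>b\<in>B. {u. ip u b = 0}))"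
    by (intro closed_Int closed_INT ballI closed_Collect_eq continuous_on_ip continuous_on_const)
  ultimately have "compact (PiE UNIV K \<inter> ({u. ip u u = 1} \<inter> (\<Inter>b\<in>B. {u. ip u b = 0})))"
    by (rule compact_Int_closed)
  moreover have "PiE UNIV K \<inter> ({u. ip u u = 1} \<inter> (\<Inter>b\<in>B. {u. ip u b = 0})) = ?S"
  proof -
    have "u \<in> PiE UNIV K \<longleftrightarrow> u \<in> extensional A" if u: "ip u u = 1" for u
    proof
      assume ext: "u \<in> extensional A"
      have "\<bar>u a\<bar> \<le> 1 + 1 / w a" if "a \<in> A" for a
      proof -
        have "w a * (u a * u a) \<le> ip u u"
          unfolding ip_def
          using that finite_A by (intro member_le_sum) (auto simp: w_pos less_imp_le)
        then have sq: "\<bar>u a\<bar> * \<bar>u a\<bar> \<le> 1 / w a"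
          using u w_pos[OF that] by (simp add: field_simps)
        \<comment> \<open>The bound \<open>1 + 1 / w a\<close> avoids the square root of \<open>1 / w a\<close>.\<close>
        show ?thesis
        proof (cases "\<bar>u a\<bar> \<le> 1")
          case False
          then have "1 * \<bar>u a\<bar> \<le> \<bar>u a\<bar> * \<bar>u a\<bar>" by (intro mult_right_mono) auto
          then show ?thesis using sq by linarith
        next
          case True
          have "0 < 1 / w a" using w_pos[OF that] by simp
          with True show ?thesis by linarith
        qed
      qed
      then have "u a \<in> K a" for a
        using ext abs_le_D1[of "u a" "1 + 1 / w a"] abs_le_D2[of "u a" "1 + 1 / w a"]
        by (cases "a \<in> A") (simp_all add: K_def extensional_def)
      then show "u \<in> PiE UNIV K" by auto
    next
      assume "u \<in> PiE UNIV K"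
      then have K: "u a \<in> K a" for a by auto
      have "u a = undefined" if "a \<notin> A" for a
        using K[of a] that by (simp add: K_def)
      then show "u \<in> extensional A" by (simp add: extensional_def)
    qed
    then show ?thesis by auto
  qed
  ultimately show ?thesis by simp
qed

text \<open>
  The Rayleigh quotient argument: a maximiser of \<open>ip u (L u)\<close> on the unit sphere of the orthogonal
  complement of \<open>B\<close> is an eigenvector. The complement is invariant because \<open>B\<close> consists of
  eigenvectors, and it is nontrivial because it contains \<open>f\<close>.
\<close>

lemma eigenvector_in_complement:
  assumes eig: "\<And>b. b \<in> B \<Longrightarrow> \<exists>lam. \<forall>a\<in>A. L b a = lam * b a"
    and f: "\<And>b. b \<in> B \<Longrightarrow> ip f b = 0" "a \<in> A" "f a \<noteq> 0"
  obtains u lam where "u \<in> extensional A" "ip u u = 1" "\<And>b. b \<in> B \<Longrightarrow> ip u b = 0"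
    "\<And>a. a \<in> A \<Longrightarrow> L u a = lam * u a"
proof -
  let ?S = "{u. u \<in> extensional A \<and> ip u u = 1 \<and> (\<forall>b\<in>B. ip u b = 0)}"
  have normalise: "restrict (\<lambda>a. 1 / sqrt (ip y y) * y a) A \<in> ?S"
    if "0 < ip y y" "\<And>b. b \<in> B \<Longrightarrow> ip y b = 0" for y
    using that unfolding mem_Collect_eq ip_restrict ip_scale by auto
  have "?S \<noteq> {}" using normalise[OF ip_pos[of a f, OF f(2,3)] f(1)] by blast
  then obtain u where u: "u \<in> ?S" and max: "\<And>y. y \<in> ?S \<Longrightarrow> ip y (L y) \<le> ip u (L u)"
    using continuous_attains_sup[OF compact_unit_sphere _ continuous_on_subset[OF continuous_on_ip(3)]]
    by (metis (no_types, lifting) subset_UNIV)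
  define l where "l = ip u (L u)"
  have le: "ip y (L y) \<le> l * ip y y" if "\<And>b. b \<in> B \<Longrightarrow> ip y b = 0" for y
  proof (cases "ip y y = 0")
    case True
    then have "ip y (L y) = 0" using ip_eq_0D[OF True] by (simp add: ip_def)
    then show ?thesis using True by simp
  next
    case False
    then have pos: "0 < ip y y" using ip_nonneg[of y] by simp
    define s where "s = 1 / sqrt (ip y y)"
    define z where "z = (\<lambda>a. s * y a)"
    have "ip (restrict z A) (L (restrict z A)) = ip z (\<lambda>a. s * L y a)"
    proof (rule ip_cong)
      fix a assume a: "a \<in> A"
      have "L (\<lambda>_. 0) a = 0" using linear[OF a, of 1 "\<lambda>_. 0" "\<lambda>_. 0"] by simp
      then have "L z a = s * L y a" unfolding z_def using linear[OF a, of s y "\<lambda>_. 0"] by simp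
      moreover have "L (restrict z A) a = L z a" by (rule local[OF a]) simp
      ultimately show "L (restrict z A) a = s * L y a" by simp
    qed simp
    also have "\<dots> = s\<^sup>2 * ip y (L y)"
      unfolding z_def ip_scale by (simp add: power2_eq_square)
    finally have "s\<^sup>2 * ip y (L y) \<le> l"
      using max[OF normalise[OF pos that]] by (simp add: l_def s_def z_def)
    then show ?thesis using pos by (simp add: s_def power_divide field_simps)
  qed
  \<comment> \<open>The residual \<open>v\<close> is an admissible direction; varying \<open>u\<close> along it forces \<open>v = 0\<close>.\<close>
  define v where "v = (\<lambda>a. l * u a + - 1 * L u a)"
  have v_orth: "ip v b = 0" if "b \<in> B" for b
  proof -
    from eig[OF that] obtain lam where "\<And>a. a \<in> A \<Longrightarrow> L b a = lam * b a" by blast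
    then have "ip u (L b) = ip u (\<lambda>a. lam * b a)" by (intro ip_cong) auto
    also have "\<dots> = lam * ip u b" by (rule ip_scale)
    finally have "ip (L u) b = 0" using u that by (simp add: symmetric_ip)
    moreover have "ip v b = l * ip u b + - 1 * ip (L u) b"
      unfolding v_def by (simp add: ip_def sum_distrib_left sum.distrib[symmetric] algebra_simps flip: sum_subtractf)
    ultimately show ?thesis using u that by simp
  qed
  have quad: "0 \<le> 2 * t * ip v v + t\<^sup>2 * (l * ip v v - ip v (L v))" for t
  proof -
    let ?y = "\<lambda>a. t * v a + u a"
    have le_y: "ip ?y (L ?y) \<le> l * ip ?y ?y"
      using u v_orth by (intro le) (simp add: ip_linear_left)
    have cross: "ip u (L v) = ip v (L u)"
      using symmetric_ip[of u v] ip_commute[of "L u" v] by simp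
    have vv: "ip v v = l * ip v u - ip v (L u)"
    proof -
      have "ip v v = ip v (\<lambda>a. l * u a + - 1 * L u a)" by (simp only: v_def)
      also have "\<dots> = l * ip v u - ip v (L u)" unfolding ip_linear_right ip_scale by simp
      finally show ?thesis .
    qed
    have "ip ?y (L ?y) = ip ?y (\<lambda>a. t * L v a + L u a)"
      by (intro ip_cong) (simp_all add: linear)
    also have "\<dots> = t\<^sup>2 * ip v (L v) + 2 * t * ip v (L u) + l"
      unfolding ip_linear_left ip_linear_right cross l_def[symmetric]
      by (simp add: power2_eq_square algebra_simps)
    finally have form: "ip ?y (L ?y) = t\<^sup>2 * ip v (L v) + 2 * t * ip v (L u) + l" .
    have norm: "ip ?y ?y = t\<^sup>2 * ip v v + 2 * t * ip v u + 1"
      unfolding ip_linear_left ip_linear_right ip_commute[of u v] using u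
      by (simp add: power2_eq_square algebra_simps)
    have "l * ip ?y ?y - ip ?y (L ?y) = 2 * t * ip v v + t\<^sup>2 * (l * ip v v - ip v (L v))"
      unfolding form norm using vv by algebra
    then show ?thesis using le_y by linarith
  qed
  have "ip v v = 0"
  proof (rule ccontr)
    assume "ip v v \<noteq> 0"
    then have P: "0 < ip v v" using ip_nonneg[of v] by simp
    \<comment> \<open>A negative \<open>t\<close> so small that the linear term of \<open>quad\<close> dominates the quadratic one.\<close>
    define Q where "Q = l * ip v v - ip v (L v)"
    define t where "t = - ip v v / (1 + \<bar>Q\<bar>)"
    have t: "t < 0" using P by (simp add: t_def divide_neg_pos)
    have "- (t * Q) \<le> \<bar>t\<bar> * \<bar>Q\<bar>" by (metis abs_ge_minus_self abs_mult)
    also have "\<dots> \<le> ip v v"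
      using P by (simp add: t_def abs_divide field_simps)
    finally have "0 < 2 * ip v v + t * Q" using P by linarith
    then have "t * (2 * ip v v + t * Q) < 0" using t by (simp add: mult_neg_pos)
    then show False using quad[of t] by (simp add: Q_def power2_eq_square algebra_simps)
  qed
  then have "L u a = l * u a" if "a \<in> A" for a
    using ip_eq_0D[of v a] that by (simp add: v_def)
  then show thesis using that[of u l] u by auto
qed

definition orthogonal_eigenvectors :: "('a \<Rightarrow> real) set \<Rightarrow> bool" where
  "orthogonal_eigenvectors B \<longleftrightarrow> finite B \<and> B \<subseteq> extensional A \<and> (\<forall>b\<in>B. 0 < ip b b) \<and>
     (\<forall>b\<in>B. \<exists>lam. \<forall>a\<in>A. L b a = lam * b a) \<and> (\<forall>b\<in>B. \<forall>b'\<in>B. b \<noteq> b' \<longrightarrow> ip b b' = 0)"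

definition projection :: "('a \<Rightarrow> real) set \<Rightarrow> ('a \<Rightarrow> real) \<Rightarrow> 'a \<Rightarrow> real" where
  "projection B f = (\<lambda>a. \<Sum>b\<in>B. ip f b / ip b b * b a)"

lemma ip_projection:
  assumes "orthogonal_eigenvectors B" "b \<in> B"
  shows "ip (projection B f) b = ip f b"
proof -
  have "ip (projection B f) b = (\<Sum>b'\<in>B. ip f b' / ip b' b' * ip b' b)"
    unfolding projection_def by (rule ip_sum_left)
  also have "\<dots> = (\<Sum>b'\<in>B. if b' = b then ip f b else 0)"
    using assms by (intro sum.cong) (auto simp: orthogonal_eigenvectors_def)
  finally show ?thesis using assms by (simp add: orthogonal_eigenvectors_def)
qed

text \<open>
  The squared norm of the residual \<open>f - projection B f\<close> is nonnegative.
\<close>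

lemma bessel:
  assumes "orthogonal_eigenvectors B"
  shows "(\<Sum>b\<in>B. (ip f b)\<^sup>2 / ip b b) \<le> ip f f"
proof -
  let ?p = "projection B f"
  have sum_eq: "ip ?p g = (\<Sum>b\<in>B. ip f b / ip b b * ip b g)" for g
    unfolding projection_def by (rule ip_sum_left)
  have 1: "ip ?p f = (\<Sum>b\<in>B. (ip f b)\<^sup>2 / ip b b)"
    unfolding sum_eq by (simp add: ip_commute[of _ f] power2_eq_square)
  have 2: "ip ?p ?p = ip ?p f"
    unfolding sum_eq using ip_projection[OF assms, of _ f]
    by (intro sum.cong) (simp_all add: ip_commute[of _ f] ip_commute[of _ ?p])
  have "0 \<le> ip (\<lambda>a. - 1 * ?p a + f a) (\<lambda>a. - 1 * ?p a + f a)" by (rule ip_nonneg)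
  also have "\<dots> = ip f f - ip ?p f"
    unfolding ip_linear_left ip_linear_right 2 ip_commute[of f ?p] by simp
  finally show ?thesis using 1 by simp
qed

text \<open>
  A dimension bound without linear algebra: Bessel's inequality for the indicator function of each
  point of \<open>A\<close>, summed over the points with the weights \<open>1 / w a\<close>.
\<close>

lemma card_orthogonal_eigenvectors_le:
  assumes "orthogonal_eigenvectors B"
  shows "card B \<le> card A"
proof -
  have "(\<Sum>b\<in>B. w a * (b a * b a) / ip b b) \<le> 1" if "a \<in> A" for a
  proof -
    have ev: "ip (\<lambda>c. of_bool (c = a)) g = w a * g a" for g
    proof -
      have "w c * (of_bool (c = a) * g c) = (if c = a then w a * g a else 0)" for c by simp
      then show ?thesis unfolding ip_def using that finite_A by (simp only: sum.delta if_True)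
    qed
    have "(\<Sum>b\<in>B. (w a * b a)\<^sup>2 / ip b b) \<le> w a"
      using bessel[OF assms, of "\<lambda>c. of_bool (c = a)"] by (simp add: ev)
    moreover have "(\<Sum>b\<in>B. (w a * b a)\<^sup>2 / ip b b) = w a * (\<Sum>b\<in>B. w a * (b a * b a) / ip b b)"
      by (simp add: sum_distrib_left power2_eq_square mult_ac)
    ultimately show ?thesis using w_pos[OF that] by simp
  qed
  then have "(\<Sum>a\<in>A. \<Sum>b\<in>B. w a * (b a * b a) / ip b b) \<le> (\<Sum>a\<in>A. 1)"
    by (rule sum_mono)
  moreover have "(\<Sum>a\<in>A. \<Sum>b\<in>B. w a * (b a * b a) / ip b b) = (\<Sum>b\<in>B. 1)"
    using assms
    by (subst sum.swap, intro sum.cong refl)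
      (auto simp: orthogonal_eigenvectors_def simp flip: sum_divide_distrib ip_def)
  ultimately show ?thesis by simp
qed

text \<open>
  An orthogonal system of eigenvectors of maximal size spans: otherwise the residual of some
  function would provide another eigenvector orthogonal to the system.
\<close>

theorem spectral_theorem:
  "\<exists>B. orthogonal_eigenvectors B \<and> (\<forall>f. \<forall>a\<in>A. f a = (\<Sum>b\<in>B. ip f b / ip b b * b a))"
proof -
  have "orthogonal_eigenvectors {}" by (simp add: orthogonal_eigenvectors_def)
  then obtain B where B: "orthogonal_eigenvectors B"
    and max: "\<And>B'. orthogonal_eigenvectors B' \<Longrightarrow> card B' \<le> card B"
    using ex_has_greatest_nat[of orthogonal_eigenvectors "{}" card "Suc (card A)"]
      card_orthogonal_eigenvectors_le by (metis le_imp_less_Suc)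
  have "f a = projection B f a" if a: "a \<in> A" for f a
  proof (rule ccontr)
    let ?g = "\<lambda>a. - 1 * projection B f a + f a"
    assume "f a \<noteq> projection B f a"
    then have g: "?g a \<noteq> 0" by simp
    have orth: "ip ?g b = 0" if "b \<in> B" for b
      unfolding ip_linear_left using ip_projection[OF B that] by simp
    have eig: "\<exists>lam. \<forall>a\<in>A. L b a = lam * b a" if "b \<in> B" for b
      using B that by (simp add: orthogonal_eigenvectors_def)
    obtain u lam where u: "u \<in> extensional A" "ip u u = 1" "\<And>b. b \<in> B \<Longrightarrow> ip u b = 0"
      "\<And>a. a \<in> A \<Longrightarrow> L u a = lam * u a"
      by (rule eigenvector_in_complement[OF eig orth a g]) blast+
    have "u \<notin> B" using u(2,3) by force
    moreover have "orthogonal_eigenvectors (insert u B)"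
    proof -
      have "ip b u = 0" if "b \<in> B" for b using u(3)[OF that] ip_commute[of u b] by simp
      moreover have "\<exists>lam. \<forall>a\<in>A. L u a = lam * u a" using u(4) by blast
      ultimately show ?thesis
        using B u(1-3) unfolding orthogonal_eigenvectors_def by simp
    qed
    ultimately show False
      using max[of "insert u B"] B by (simp add: orthogonal_eigenvectors_def)
  qed
  then show ?thesis using B unfolding projection_def by blast
qed

end

section \<open>Integration against the reversible measure\<close>

text \<open>
  A class of functions that contains the duality functions, is closed under products and under
  adding and removing particles, and whose members are all integrable; so no integrability question
  has to be treated individually.
\<close>

definition poly_bounded :: "(('v::finite \<Rightarrow> nat) \<Rightarrow> real) \<Rightarrow> bool" where
  "poly_bounded g \<longleftrightarrow> (\<exists>b j. \<forall>\<eta>. \<bar>g \<eta>\<bar> \<le> b * (1 + real (\<Sum>x\<in>UNIV. \<eta> x)) ^ j)"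

lemma poly_boundedI:
  "(\<And>\<eta>. \<bar>g \<eta>\<bar> \<le> b * (1 + real (\<Sum>x\<in>UNIV. \<eta> x)) ^ j) \<Longrightarrow> poly_bounded g"
  unfolding poly_bounded_def by blast

lemma poly_boundedE:
  assumes "poly_bounded (g :: ('v::finite \<Rightarrow> nat) \<Rightarrow> real)"
  obtains b j where "0 \<le> b" "\<And>\<eta>. \<bar>g \<eta>\<bar> \<le> b * (1 + real (\<Sum>x\<in>UNIV. \<eta> x)) ^ j"
proof -
  obtain b j where bj: "\<And>\<eta>. \<bar>g \<eta>\<bar> \<le> b * (1 + real (\<Sum>x\<in>UNIV. \<eta> x)) ^ j"
    using assms by (auto simp: poly_bounded_def)
  have "0 \<le> b" using bj[of "\<lambda>_. 0"] by simp
  then show thesis using bj that by blast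
qed

lemma poly_bounded_const [intro, simp]: "poly_bounded (\<lambda>_. a)"
  by (rule poly_boundedI[of _ "\<bar>a\<bar>" 0]) simp

lemma poly_bounded_add [intro, simp]:
  assumes "poly_bounded f" "poly_bounded g"
  shows "poly_bounded (\<lambda>\<eta>. f \<eta> + g \<eta>)"
proof -
  obtain b j where f: "0 \<le> b" "\<And>\<eta>. \<bar>f \<eta>\<bar> \<le> b * (1 + real (\<Sum>x\<in>UNIV. \<eta> x)) ^ j"
    using poly_boundedE[OF assms(1)] by blast
  obtain b' j' where g: "0 \<le> b'" "\<And>\<eta>. \<bar>g \<eta>\<bar> \<le> b' * (1 + real (\<Sum>x\<in>UNIV. \<eta> x)) ^ j'"
    using poly_boundedE[OF assms(2)] by blast
  show ?thesis
  proof (rule poly_boundedI)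
    fix \<eta> :: "'a \<Rightarrow> nat"
    let ?s = "1 + real (\<Sum>x\<in>UNIV. \<eta> x)"
    have "\<bar>f \<eta> + g \<eta>\<bar> \<le> b * ?s ^ j + b' * ?s ^ j'"
      using f(2)[of \<eta>] g(2)[of \<eta>] by linarith
    also have "\<dots> \<le> b * ?s ^ (j + j') + b' * ?s ^ (j + j')"
      using f(1) g(1) by (intro add_mono mult_left_mono power_increasing) (simp_all del: of_nat_sum)
    finally show "\<bar>f \<eta> + g \<eta>\<bar> \<le> (b + b') * ?s ^ (j + j')" by (simp add: distrib_right)
  qed
qed

lemma poly_bounded_mult [intro, simp]:
  assumes "poly_bounded f" "poly_bounded g"
  shows "poly_bounded (\<lambda>\<eta>. f \<eta> * g \<eta>)"
proof -
  obtain b j where f: "0 \<le> b" "\<And>\<eta>. \<bar>f \<eta>\<bar> \<le> b * (1 + real (\<Sum>x\<in>UNIV. \<eta> x)) ^ j"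
    using poly_boundedE[OF assms(1)] by blast
  obtain b' j' where g: "0 \<le> b'" "\<And>\<eta>. \<bar>g \<eta>\<bar> \<le> b' * (1 + real (\<Sum>x\<in>UNIV. \<eta> x)) ^ j'"
    using poly_boundedE[OF assms(2)] by blast
  show ?thesis
  proof (rule poly_boundedI)
    fix \<eta> :: "'a \<Rightarrow> nat"
    let ?s = "1 + real (\<Sum>x\<in>UNIV. \<eta> x)"
    have "\<bar>f \<eta> * g \<eta>\<bar> \<le> (b * ?s ^ j) * (b' * ?s ^ j')"
      unfolding abs_mult using f g by (intro mult_mono) (simp_all del: of_nat_sum)
    then show "\<bar>f \<eta> * g \<eta>\<bar> \<le> (b * b') * ?s ^ (j + j')" by (simp add: power_add mult_ac)
  qed
qed

lemma poly_bounded_sum [intro, simp]: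
  "(\<And>i. i \<in> S \<Longrightarrow> poly_bounded (f i)) \<Longrightarrow> poly_bounded (\<lambda>\<eta>. \<Sum>i\<in>S. f i \<eta>)"
  by (induction S rule: infinite_finite_induct) auto

lemma poly_bounded_prod:
  "(\<And>i. i \<in> S \<Longrightarrow> poly_bounded (f i)) \<Longrightarrow> poly_bounded (\<lambda>\<eta>. \<Prod>i\<in>S. f i \<eta>)"
  by (induction S rule: infinite_finite_induct) auto

lemma poly_bounded_power [intro, simp]: "poly_bounded f \<Longrightarrow> poly_bounded (\<lambda>\<eta>. f \<eta> ^ n)"
  by (induction n) auto

lemma poly_bounded_coordinate [intro, simp]: "poly_bounded (\<lambda>\<eta>. real (\<eta> x))"
proof (rule poly_boundedI[of _ 1 1])
  fix \<eta> :: "'a \<Rightarrow> nat"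
  have "real (\<eta> x) \<le> real (\<Sum>x\<in>UNIV. \<eta> x)"
    using member_le_sum[of x UNIV \<eta>] by (simp only: of_nat_le_iff) auto
  then show "\<bar>real (\<eta> x)\<bar> \<le> 1 * (1 + real (\<Sum>x\<in>UNIV. \<eta> x)) ^ 1" by simp
qed

lemma poly_bounded_fun_upd:
  assumes "poly_bounded f" "\<And>n. u n \<le> n + 1"
  shows "poly_bounded (\<lambda>\<eta>. f (\<eta>(x := u (\<eta> x))))"
proof -
  obtain b j where f: "0 \<le> b" "\<And>\<eta>. \<bar>f \<eta>\<bar> \<le> b * (1 + real (\<Sum>x\<in>UNIV. \<eta> x)) ^ j"
    using poly_boundedE[OF assms(1)] by blast
  show ?thesis
  proof (rule poly_boundedI)
    fix \<eta> :: "'a \<Rightarrow> nat"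
    let ?s = "real (\<Sum>x\<in>UNIV. \<eta> x)" and ?\<eta>' = "\<eta>(x := u (\<eta> x))"
    have "(\<Sum>y\<in>UNIV. ?\<eta>' y) \<le> (\<Sum>y\<in>UNIV. \<eta> y) + 1"
      using sum_fun_upd[of \<eta> x "u (\<eta> x)"] assms(2)[of "\<eta> x"] by linarith
    then have "real (\<Sum>y\<in>UNIV. ?\<eta>' y) \<le> real ((\<Sum>y\<in>UNIV. \<eta> y) + 1)"
      by (simp only: of_nat_le_iff)
    moreover have "1 + t \<le> 2 * (1 + s)" if "t \<le> s + 1" "0 \<le> s" for s t :: real
      using that by (simp add: distrib_left)
    ultimately have "1 + real (\<Sum>y\<in>UNIV. ?\<eta>' y) \<le> 2 * (1 + ?s)"
      unfolding of_nat_add of_nat_1 using of_nat_0_le_iff by blast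
    then have "b * (1 + real (\<Sum>y\<in>UNIV. ?\<eta>' y)) ^ j \<le> b * (2 * (1 + ?s)) ^ j"
      using f(1) by (intro mult_left_mono power_mono) (simp_all del: of_nat_sum)
    then show "\<bar>f ?\<eta>'\<bar> \<le> (b * 2 ^ j) * (1 + ?s) ^ j"
      using order_trans[OF f(2)[of ?\<eta>']] unfolding power_mult_distrib mult.assoc by blast
  qed
qed

lemma poly_bounded_add_at [intro, simp]: "poly_bounded f \<Longrightarrow> poly_bounded (\<lambda>\<eta>. f (add_at x \<eta>))"
  unfolding add_at_def by (rule poly_bounded_fun_upd) auto

lemma poly_bounded_remove_at [intro, simp]: "poly_bounded f \<Longrightarrow> poly_bounded (\<lambda>\<eta>. f (remove_at x \<eta>))"
  unfolding remove_at_def by (rule poly_bounded_fun_upd) auto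

locale duality_measure =
  fixes \<alpha> :: "'v::finite \<Rightarrow> real" and \<rho> :: real
  assumes \<alpha>_pos: "\<forall>x. 0 < \<alpha> x" and \<rho>_pos: "0 < \<rho>"
begin

definition mass :: "('v \<Rightarrow> nat) \<Rightarrow> real" where
  "mass \<eta> = (1 + \<rho>) powr (- (\<Sum>x\<in>UNIV. \<alpha> x)) * (\<rho> / (1 + \<rho>)) ^ (\<Sum>x\<in>UNIV. \<eta> x) * weight \<alpha> \<eta>"

lemma mass_pos: "0 < mass \<eta>"
  using weight_pos[OF \<alpha>_pos, of \<eta>] \<rho>_pos by (simp add: mass_def)

lemma mass_add_at:
  "real (\<zeta> x + 1) * mass (add_at x \<zeta>) = \<rho> / (1 + \<rho>) * ((\<alpha> x + real (\<zeta> x)) * mass \<zeta>)"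
proof -
  have sum: "(\<Sum>y\<in>UNIV. add_at x \<zeta> y) = Suc (\<Sum>y\<in>UNIV. \<zeta> y)"
    using sum_fun_upd[of \<zeta> x "\<zeta> x + 1"] by (simp add: add_at_def)
  have "real (\<zeta> x + 1) * mass (add_at x \<zeta>) = (1 + \<rho>) powr (- (\<Sum>x\<in>UNIV. \<alpha> x)) *
      (\<rho> / (1 + \<rho>)) ^ Suc (\<Sum>x\<in>UNIV. \<zeta> x) * (real (\<zeta> x + 1) * weight \<alpha> (add_at x \<zeta>))"
    unfolding mass_def sum by (simp only: mult_ac)
  then show ?thesis
    unfolding weight_add_at[OF \<alpha>_pos] mass_def by simp
qed

lemma measurable_\<nu> [simp]: "(f :: ('v \<Rightarrow> nat) \<Rightarrow> real) \<in> borel_measurable (\<nu> \<alpha> \<rho>)"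
  by (simp add: \<nu>_def)

lemma \<nu>_density: "\<nu> \<alpha> \<rho> = density (count_space UNIV) (\<lambda>\<eta>. ennreal (mass \<eta>))"
  by (simp add: \<nu>_def point_measure_def mass_def)

lemma integrable_\<nu>_iff:
  fixes g :: "('v \<Rightarrow> nat) \<Rightarrow> real"
  shows "integrable (\<nu> \<alpha> \<rho>) g \<longleftrightarrow> Infinite_Set_Sum.abs_summable_on (\<lambda>\<eta>. mass \<eta> * g \<eta>) UNIV"
  unfolding \<nu>_density abs_summable_on_def
  by (subst integrable_real_density) (auto simp: mass_pos less_imp_le)

lemma integral_\<nu>:
  fixes g :: "('v \<Rightarrow> nat) \<Rightarrow> real"
  shows "(\<integral>\<eta>. g \<eta> \<partial>\<nu> \<alpha> \<rho>) = infsetsum (\<lambda>\<eta>. mass \<eta> * g \<eta>) UNIV"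
  unfolding \<nu>_density infsetsum_def
  by (subst integral_real_density) (auto simp: mass_pos less_imp_le)

text \<open>
  Integration by parts: under \<open>\<nu>\<close>, removing a particle with rate \<open>\<eta> x\<close> is adjoint, up to the
  factor \<open>\<rho> / (1 + \<rho>)\<close>, to adding one with rate \<open>\<alpha> x + \<eta> x\<close>. Both sides are the same sum after the
  change of variables that adds a particle at \<open>x\<close>.
\<close>

lemma integral_shift:
  fixes h :: "('v \<Rightarrow> nat) \<Rightarrow> real"
  shows "(\<integral>\<eta>. real (\<eta> x) * h \<eta> \<partial>\<nu> \<alpha> \<rho>) =
    \<rho> / (1 + \<rho>) * (\<integral>\<eta>. (\<alpha> x + real (\<eta> x)) * h (add_at x \<eta>) \<partial>\<nu> \<alpha> \<rho>)"
proof -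
  have inj: "inj (add_at x)" by (metis injI remove_at_add_at)
  have "infsetsum (\<lambda>\<eta>. mass \<eta> * (real (\<eta> x) * h \<eta>)) UNIV =
      infsetsum (\<lambda>\<eta>. mass \<eta> * (real (\<eta> x) * h \<eta>)) (range (add_at x))"
  proof (rule infsetsum_cong_neutral)
    fix \<eta> :: "'v \<Rightarrow> nat" assume "\<eta> \<in> UNIV - range (add_at x)"
    then have "\<eta> x = 0" using add_at_remove_at[of \<eta> x] by (metis Diff_iff gr0I rangeI)
    then show "mass \<eta> * (real (\<eta> x) * h \<eta>) = 0" by simp
  qed auto
  also have "\<dots> = infsetsum (\<lambda>\<eta>. mass (add_at x \<eta>) * (real (add_at x \<eta> x) * h (add_at x \<eta>))) UNIV"
    by (rule infsetsum_reindex[OF inj])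
  also have "\<dots> = infsetsum (\<lambda>\<eta>. \<rho> / (1 + \<rho>) *
      (mass \<eta> * ((\<alpha> x + real (\<eta> x)) * h (add_at x \<eta>)))) UNIV"
  proof (rule infsetsum_cong)
    fix \<eta> :: "'v \<Rightarrow> nat"
    have "mass (add_at x \<eta>) * (real (add_at x \<eta> x) * h (add_at x \<eta>)) =
        (real (\<eta> x + 1) * mass (add_at x \<eta>)) * h (add_at x \<eta>)"
      by (simp add: add_at_apply mult_ac)
    then show "mass (add_at x \<eta>) * (real (add_at x \<eta> x) * h (add_at x \<eta>)) =
        \<rho> / (1 + \<rho>) * (mass \<eta> * ((\<alpha> x + real (\<eta> x)) * h (add_at x \<eta>)))"
      unfolding mass_add_at by (simp add: mult_ac)
  qed simp
  finally show ?thesis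
    unfolding integral_\<nu> by (simp add: infsetsum_def)
qed

lemma summable_poly_geometric:
  fixes r :: real
  assumes "0 < r" "r < 1"
  shows "\<exists>b. \<forall>n. (1 + real n) ^ j * r ^ n \<le> b"
proof -
  let ?f = "\<lambda>n. (1 + real n) ^ j * r ^ n"
  have "(\<lambda>n. ((1 + real (Suc n)) / (1 + real n)) ^ j * r) \<longlonglongrightarrow> 1 ^ j * r"
  proof (intro tendsto_intros)
    have "(\<lambda>n. 1 + inverse (real (Suc n))) \<longlonglongrightarrow> 1 + 0"
      by (intro tendsto_intros LIMSEQ_inverse_real_of_nat)
    moreover have "1 + inverse (real (Suc n)) = (1 + real (Suc n)) / (1 + real n)" for n
      by (simp add: field_simps)
    ultimately show "(\<lambda>n. (1 + real (Suc n)) / (1 + real n)) \<longlonglongrightarrow> 1" by simp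
  qed
  then have "\<forall>\<^sub>F n in sequentially. ((1 + real (Suc n)) / (1 + real n)) ^ j * r < (1 + r) / 2"
    using assms(2) by (intro order_tendstoD(2)) auto
  then obtain N where N: "\<And>n. N \<le> n \<Longrightarrow> ((1 + real (Suc n)) / (1 + real n)) ^ j * r < (1 + r) / 2"
    by (auto simp: eventually_sequentially)
  have "summable ?f"
  proof (rule summable_ratio_test[of "(1 + r) / 2" N])
    fix n assume "N \<le> n"
    have "?f (Suc n) = (((1 + real (Suc n)) / (1 + real n)) ^ j * r) * ?f n"
      by (simp add: power_divide)
    also have "\<dots> \<le> (1 + r) / 2 * ?f n"
      using N[OF \<open>N \<le> n\<close>] assms(1) by (intro mult_right_mono less_imp_le) auto
    finally show "norm (?f (Suc n)) \<le> (1 + r) / 2 * norm (?f n)"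
      using assms(1) by (simp del: of_nat_Suc)
  qed (use assms in auto)
  then have "bounded (range (\<lambda>n. (1 + real n) ^ j * r ^ n))"
    by (intro convergent_imp_bounded) (rule summable_LIMSEQ_zero)
  then show ?thesis by (auto simp: bounded_iff) (metis abs_le_D1)
qed

text \<open>
  The sum factorises over the sites into negative binomial series.
\<close>

lemma weight_geometric_summable:
  assumes "0 < q" "q < 1"
  shows "Infinite_Set_Sum.abs_summable_on (\<lambda>\<eta>. weight \<alpha> \<eta> * q ^ (\<Sum>x\<in>UNIV. \<eta> x)) UNIV"
proof -
  have site: "Infinite_Set_Sum.abs_summable_on (\<lambda>n. pochhammer (\<alpha> x) n / fact n * q ^ n) UNIV" for x
  proof -
    have "summable (\<lambda>n. (- \<alpha> x gchoose n) * (- q) ^ n)"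
      using gen_binomial_real[of "- q" "- \<alpha> x"] assms by (auto simp: sums_iff)
    moreover have "(- \<alpha> x gchoose n) * (- q) ^ n = norm (pochhammer (\<alpha> x) n / fact n * q ^ n)" for n
    proof -
      have "(- 1 :: real) ^ n * (- q) ^ n = q ^ n" by (simp flip: power_mult_distrib)
      then have "(- \<alpha> x gchoose n) * (- q) ^ n = pochhammer (\<alpha> x) n / fact n * q ^ n"
        by (simp add: gbinomial_pochhammer)
      then show ?thesis using \<alpha>_pos assms pochhammer_pos[of "\<alpha> x" n] by simp
    qed
    ultimately show ?thesis by (simp add: abs_summable_on_nat_iff')
  qed
  have "Infinite_Set_Sum.abs_summable_on
      (\<lambda>\<eta>. \<Prod>x\<in>UNIV. pochhammer (\<alpha> x) (\<eta> x) / fact (\<eta> x) * q ^ \<eta> x) (PiE UNIV (\<lambda>_. UNIV))"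
    by (intro abs_summable_on_prod_PiE site) auto
  then show ?thesis
    unfolding weight_eq_pochhammer[OF \<alpha>_pos] power_sum prod.distrib[symmetric] by simp
qed

text \<open>
  A polynomial factor is absorbed by enlarging the ratio \<open>p = \<rho> / (1 + \<rho>)\<close> of the geometric
  decay slightly to some \<open>q < 1\<close>.
\<close>

lemma integrable_poly_bounded:
  assumes "poly_bounded g"
  shows "integrable (\<nu> \<alpha> \<rho>) g"
proof -
  define p where "p = \<rho> / (1 + \<rho>)"
  define q where "q = (p + 1) / 2"
  have p: "0 < p" "p < 1" using \<rho>_pos by (auto simp: p_def)
  then have q: "0 < q" "q < 1" "p < q" by (auto simp: q_def)
  obtain b j where g: "0 \<le> b" "\<And>\<eta>. \<bar>g \<eta>\<bar> \<le> b * (1 + real (\<Sum>x\<in>UNIV. \<eta> x)) ^ j"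
    using poly_boundedE[OF assms] by blast
  obtain e where e: "\<And>n. (1 + real n) ^ j * (p / q) ^ n \<le> e"
    using summable_poly_geometric[of "p / q" j] p q by auto
  define z where "z = (1 + \<rho>) powr (- (\<Sum>x\<in>UNIV. \<alpha> x))"
  have "Infinite_Set_Sum.abs_summable_on
      (\<lambda>\<eta>. (z * b * e) * (weight \<alpha> \<eta> * q ^ (\<Sum>x\<in>UNIV. \<eta> x))) UNIV"
    using weight_geometric_summable[OF q(1,2)] by (rule Infinite_Set_Sum.abs_summable_on_cmult_right)
  then have "Infinite_Set_Sum.abs_summable_on (\<lambda>\<eta>. mass \<eta> * g \<eta>) UNIV"
  proof (rule Infinite_Set_Sum.abs_summable_on_comparison_test')
    fix \<eta> :: "'v \<Rightarrow> nat"
    let ?n = "\<Sum>x\<in>UNIV. \<eta> x"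
    have pq: "p ^ ?n = (p / q) ^ ?n * q ^ ?n" using q by (simp add: power_divide)
    have "\<bar>mass \<eta> * g \<eta>\<bar> \<le> mass \<eta> * (b * (1 + real ?n) ^ j)"
      using g(2)[of \<eta>] mass_pos[of \<eta>] by (simp add: abs_mult del: of_nat_sum)
    also have "mass \<eta> * (b * (1 + real ?n) ^ j) =
        (z * b * ((1 + real ?n) ^ j * (p / q) ^ ?n)) * (weight \<alpha> \<eta> * q ^ ?n)"
      unfolding mass_def z_def[symmetric] p_def[symmetric] pq by (simp only: mult_ac)
    also have "\<dots> \<le> (z * b * e) * (weight \<alpha> \<eta> * q ^ ?n)"
      using e[of ?n] g(1) q weight_pos[OF \<alpha>_pos, of \<eta>]
      by (intro mult_right_mono mult_left_mono) (auto simp: z_def)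
    finally show "norm (mass \<eta> * g \<eta>) \<le> (z * b * e) * (weight \<alpha> \<eta> * q ^ ?n)" by simp
  qed
  then show ?thesis by (simp add: integrable_\<nu>_iff)
qed

section \<open>Orthogonality of the duality functions\<close>

lemma poly_bounded_D [intro, simp]: "poly_bounded (D \<alpha> \<rho> \<xi>)"
proof -
  have "poly_bounded (\<lambda>\<eta>. d (\<alpha> x) \<rho> m (\<eta> x))" for x :: 'v and m
  proof -
    obtain b where b: "0 \<le> b" "\<And>n. \<bar>d (\<alpha> x) \<rho> m n\<bar> \<le> b * (1 + real n) ^ m"
      using abs_d_le[of "\<alpha> x" \<rho> m] \<alpha>_pos \<rho>_pos by auto
    show ?thesis
    proof (rule poly_boundedI)
      fix \<eta> :: "'v \<Rightarrow> nat"
      have "real (\<eta> x) \<le> real (\<Sum>x\<in>UNIV. \<eta> x)"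
        using member_le_sum[of x UNIV \<eta>] by (simp only: of_nat_le_iff) auto
      then have "b * (1 + real (\<eta> x)) ^ m \<le> b * (1 + real (\<Sum>x\<in>UNIV. \<eta> x)) ^ m"
        using b(1) by (intro mult_left_mono power_mono) auto
      then show "\<bar>d (\<alpha> x) \<rho> m (\<eta> x)\<bar> \<le> b * (1 + real (\<Sum>x\<in>UNIV. \<eta> x)) ^ m"
        using b(2)[of "\<eta> x"] by linarith
    qed
  qed
  then show ?thesis unfolding D_def[abs_def] by (intro poly_bounded_prod)
qed

text \<open>
  Minus the generator of the birth-death chain at \<open>x\<close> with death rate \<open>(1 + \<rho>) * n\<close> and birth rate
  \<open>\<rho> * (\<alpha> x + n)\<close>; its polynomial eigenfunctions are the Meixner polynomials, and its reversible
  measure is the marginal of \<open>\<nu>\<close> at \<open>x\<close>.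
\<close>

definition site_operator :: "'v \<Rightarrow> (('v \<Rightarrow> nat) \<Rightarrow> real) \<Rightarrow> ('v \<Rightarrow> nat) \<Rightarrow> real" where
  "site_operator x f \<eta> = (1 + \<rho>) * (real (\<eta> x) * (f \<eta> - f (remove_at x \<eta>))) +
     \<rho> * ((\<alpha> x + real (\<eta> x)) * (f \<eta> - f (add_at x \<eta>)))"

lemma site_operator_D: "site_operator x (D \<alpha> \<rho> \<xi>) \<eta> = real (\<xi> x) * D \<alpha> \<rho> \<xi> \<eta>"
  unfolding site_operator_def
  using D_remove[of \<alpha> \<rho> \<eta> x \<xi>, OF \<alpha>_pos \<rho>_pos] D_mult[of \<alpha> \<rho> \<eta> x \<xi>, OF \<alpha>_pos \<rho>_pos]
    D_add[of \<alpha> \<rho> x \<eta> \<xi>, OF \<alpha>_pos \<rho>_pos] by algebra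

lemma site_operator_symmetric:
  assumes "poly_bounded f" "poly_bounded g"
  shows "(\<integral>\<eta>. site_operator x f \<eta> * g \<eta> \<partial>\<nu> \<alpha> \<rho>) = (\<integral>\<eta>. f \<eta> * site_operator x g \<eta> \<partial>\<nu> \<alpha> \<rho>)"
proof -
  have form: "(\<integral>\<eta>. site_operator x f \<eta> * g \<eta> \<partial>\<nu> \<alpha> \<rho>) =
      (\<integral>\<eta>. ((1 + \<rho>) * real (\<eta> x) + \<rho> * (\<alpha> x + real (\<eta> x))) * (f \<eta> * g \<eta>) \<partial>\<nu> \<alpha> \<rho>) -
      \<rho> * (\<integral>\<eta>. (\<alpha> x + real (\<eta> x)) * (f \<eta> * g (add_at x \<eta>)) \<partial>\<nu> \<alpha> \<rho>) -
      \<rho> * (\<integral>\<eta>. (\<alpha> x + real (\<eta> x)) * (f (add_at x \<eta>) * g \<eta>) \<partial>\<nu> \<alpha> \<rho>)"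
    if f: "poly_bounded f" and g: "poly_bounded g" for f g
  proof -
    let ?A = "\<lambda>\<eta>. ((1 + \<rho>) * real (\<eta> x) + \<rho> * (\<alpha> x + real (\<eta> x))) * (f \<eta> * g \<eta>)"
    let ?B = "\<lambda>\<eta>. real (\<eta> x) * (f (remove_at x \<eta>) * g \<eta>)"
    let ?C = "\<lambda>\<eta>. (\<alpha> x + real (\<eta> x)) * (f (add_at x \<eta>) * g \<eta>)"
    have int: "integrable (\<nu> \<alpha> \<rho>) ?A" "integrable (\<nu> \<alpha> \<rho>) ?B" "integrable (\<nu> \<alpha> \<rho>) ?C"
      using f g by (intro integrable_poly_bounded poly_bounded_mult poly_bounded_add; simp)+
    have "(\<integral>\<eta>. site_operator x f \<eta> * g \<eta> \<partial>\<nu> \<alpha> \<rho>) =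
        (\<integral>\<eta>. ?A \<eta> - (1 + \<rho>) * ?B \<eta> - \<rho> * ?C \<eta> \<partial>\<nu> \<alpha> \<rho>)"
      unfolding site_operator_def by (intro Bochner_Integration.integral_cong refl) algebra
    also have "\<dots> = (\<integral>\<eta>. ?A \<eta> \<partial>\<nu> \<alpha> \<rho>) - (1 + \<rho>) * (\<integral>\<eta>. ?B \<eta> \<partial>\<nu> \<alpha> \<rho>) - \<rho> * (\<integral>\<eta>. ?C \<eta> \<partial>\<nu> \<alpha> \<rho>)"
      using int by (simp only: Bochner_Integration.integral_diff Bochner_Integration.integrable_diff
          integrable_mult_right integral_mult_right_zero)
    also have "(1 + \<rho>) * (\<integral>\<eta>. ?B \<eta> \<partial>\<nu> \<alpha> \<rho>) =
        \<rho> * (\<integral>\<eta>. (\<alpha> x + real (\<eta> x)) * (f \<eta> * g (add_at x \<eta>)) \<partial>\<nu> \<alpha> \<rho>)"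
      using \<rho>_pos integral_shift[of x "\<lambda>\<eta>. f (remove_at x \<eta>) * g \<eta>"] by simp
    finally show ?thesis .
  qed
  have "(\<integral>\<eta>. f \<eta> * site_operator x g \<eta> \<partial>\<nu> \<alpha> \<rho>) = (\<integral>\<eta>. site_operator x g \<eta> * f \<eta> \<partial>\<nu> \<alpha> \<rho>)"
    by (simp add: mult.commute)
  then show ?thesis
    unfolding form[OF assms] form[OF assms(2,1)] by (simp add: mult_ac)
qed

text \<open>
  Eigenfunctions of the symmetric operator at a site where \<open>\<xi>\<close> and \<open>\<xi>'\<close> differ, with different
  eigenvalues.
\<close>

lemma D_orthogonal:
  assumes "\<xi> \<noteq> \<xi>'"
  shows "(\<integral>\<eta>. D \<alpha> \<rho> \<xi> \<eta> * D \<alpha> \<rho> \<xi>' \<eta> \<partial>\<nu> \<alpha> \<rho>) = 0"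
proof -
  obtain x where x: "\<xi> x \<noteq> \<xi>' x" using assms by auto
  have "real (\<xi> x) * (\<integral>\<eta>. D \<alpha> \<rho> \<xi> \<eta> * D \<alpha> \<rho> \<xi>' \<eta> \<partial>\<nu> \<alpha> \<rho>) =
      real (\<xi>' x) * (\<integral>\<eta>. D \<alpha> \<rho> \<xi> \<eta> * D \<alpha> \<rho> \<xi>' \<eta> \<partial>\<nu> \<alpha> \<rho>)"
    using site_operator_symmetric[OF poly_bounded_D[of \<xi>] poly_bounded_D[of \<xi>'], of x]
    by (simp only: site_operator_D mult.assoc mult.left_commute[of "D _ _ _ _"] integral_mult_right_zero)
  then show ?thesis using x by simp
qed

definition D_norm :: "('v \<Rightarrow> nat) \<Rightarrow> real" where
  "D_norm \<xi> = (\<integral>\<eta>. (D \<alpha> \<rho> \<xi> \<eta>)\<^sup>2 \<partial>\<nu> \<alpha> \<rho>)"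

lemma integral_D_combination:
  "(\<integral>\<eta>. (a * D \<alpha> \<rho> \<xi>\<^sub>1 \<eta> + b * D \<alpha> \<rho> \<xi>\<^sub>2 \<eta> + e * D \<alpha> \<rho> \<xi>\<^sub>3 \<eta>) * D \<alpha> \<rho> \<xi> \<eta> \<partial>\<nu> \<alpha> \<rho>) =
    a * (\<integral>\<eta>. D \<alpha> \<rho> \<xi>\<^sub>1 \<eta> * D \<alpha> \<rho> \<xi> \<eta> \<partial>\<nu> \<alpha> \<rho>) + b * (\<integral>\<eta>. D \<alpha> \<rho> \<xi>\<^sub>2 \<eta> * D \<alpha> \<rho> \<xi> \<eta> \<partial>\<nu> \<alpha> \<rho>) +
    e * (\<integral>\<eta>. D \<alpha> \<rho> \<xi>\<^sub>3 \<eta> * D \<alpha> \<rho> \<xi> \<eta> \<partial>\<nu> \<alpha> \<rho>)"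
  by (simp add: distrib_right mult.assoc integrable_poly_bounded)

text \<open>
  The ladder relation for the norms. Removing a particle from \<open>D \<alpha> \<rho> \<zeta>\<close> and adding one to
  \<open>D \<alpha> \<rho> (add_at x \<zeta>)\<close> are adjoint; expanding both sides of \<open>integral_shift\<close> in duality
  functions, orthogonality leaves one norm on each side.
\<close>

lemma D_norm_add_at:
  "(\<alpha> x + real (\<zeta> x)) * D_norm (add_at x \<zeta>) = \<rho> * (1 + \<rho>) * (real (\<zeta> x + 1) * D_norm \<zeta>)"
proof -
  let ?\<xi> = "add_at x \<zeta>"
  have ne: "\<zeta> \<noteq> ?\<xi>" "remove_at x \<zeta> \<noteq> ?\<xi>" "add_at x ?\<xi> \<noteq> \<zeta>"
    by (auto simp: fun_eq_iff add_at_apply remove_at_apply intro!: exI[of _ x])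
  have "(\<integral>\<eta>. real (\<eta> x) * (D \<alpha> \<rho> \<zeta> (remove_at x \<eta>) * D \<alpha> \<rho> ?\<xi> \<eta>) \<partial>\<nu> \<alpha> \<rho>) =
      (\<integral>\<eta>. ((\<alpha> x + real (\<zeta> x)) * D \<alpha> \<rho> ?\<xi> \<eta> + (\<rho> * (\<alpha> x + 2 * real (\<zeta> x))) * D \<alpha> \<rho> \<zeta> \<eta> +
        (\<rho>\<^sup>2 * real (\<zeta> x)) * D \<alpha> \<rho> (remove_at x \<zeta>) \<eta>) * D \<alpha> \<rho> ?\<xi> \<eta> \<partial>\<nu> \<alpha> \<rho>)"
    using D_remove[of \<alpha> \<rho> _ x \<zeta>, OF \<alpha>_pos \<rho>_pos]
    by (simp only: mult.assoc[symmetric])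
  also have "\<dots> = (\<alpha> x + real (\<zeta> x)) * D_norm ?\<xi>"
    unfolding integral_D_combination D_orthogonal[OF ne(1)] D_orthogonal[OF ne(2)]
    by (simp add: D_norm_def power2_eq_square)
  finally have lhs: "(\<integral>\<eta>. real (\<eta> x) * (D \<alpha> \<rho> \<zeta> (remove_at x \<eta>) * D \<alpha> \<rho> ?\<xi> \<eta>) \<partial>\<nu> \<alpha> \<rho>) =
      (\<alpha> x + real (\<zeta> x)) * D_norm ?\<xi>" .
  have "(\<integral>\<eta>. (\<alpha> x + real (\<eta> x)) * (D \<alpha> \<rho> \<zeta> \<eta> * D \<alpha> \<rho> ?\<xi> (add_at x \<eta>)) \<partial>\<nu> \<alpha> \<rho>) =
      (\<integral>\<eta>. ((\<alpha> x + real (?\<xi> x)) * D \<alpha> \<rho> (add_at x ?\<xi>) \<eta> +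
        ((1 + \<rho>) * (\<alpha> x + 2 * real (?\<xi> x))) * D \<alpha> \<rho> ?\<xi> \<eta> +
        ((1 + \<rho>)\<^sup>2 * real (?\<xi> x)) * D \<alpha> \<rho> (remove_at x ?\<xi>) \<eta>) * D \<alpha> \<rho> \<zeta> \<eta> \<partial>\<nu> \<alpha> \<rho>)"
    using D_add[of \<alpha> \<rho> x _ ?\<xi>, OF \<alpha>_pos \<rho>_pos]
    by (simp only: mult.assoc[symmetric] mult.commute[of "D \<alpha> \<rho> \<zeta> _"])
  also have "\<dots> = (1 + \<rho>)\<^sup>2 * real (\<zeta> x + 1) * D_norm \<zeta>"
    unfolding integral_D_combination D_orthogonal[OF ne(1)[symmetric]] D_orthogonal[OF ne(3)]
      remove_at_add_at
    by (simp add: D_norm_def power2_eq_square add_at_apply)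
  finally have rhs: "(\<integral>\<eta>. (\<alpha> x + real (\<eta> x)) * (D \<alpha> \<rho> \<zeta> \<eta> * D \<alpha> \<rho> ?\<xi> (add_at x \<eta>)) \<partial>\<nu> \<alpha> \<rho>) =
      (1 + \<rho>)\<^sup>2 * real (\<zeta> x + 1) * D_norm \<zeta>" .
  have "(\<alpha> x + real (\<zeta> x)) * D_norm ?\<xi> = \<rho> / (1 + \<rho>) * ((1 + \<rho>)\<^sup>2 * real (\<zeta> x + 1) * D_norm \<zeta>)"
    using integral_shift[of x "\<lambda>\<eta>. D \<alpha> \<rho> \<zeta> (remove_at x \<eta>) * D \<alpha> \<rho> ?\<xi> \<eta>"]
    unfolding lhs remove_at_add_at rhs .
  then show ?thesis using \<rho>_pos by (simp add: power2_eq_square)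
qed

definition total_mass :: real where
  "total_mass = (\<integral>\<eta>. 1 \<partial>\<nu> \<alpha> \<rho>)"

lemma total_mass_pos: "0 < total_mass"
proof -
  have "0 < mass (\<lambda>_. 0)" by (rule mass_pos)
  also have "mass (\<lambda>_. 0) = infsetsum mass {\<lambda>_. 0}" by simp
  also have "\<dots> \<le> infsetsum mass UNIV"
    using integrable_poly_bounded[OF poly_bounded_const[of 1]]
    by (intro infsetsum_mono_neutral_left) (auto simp: integrable_\<nu>_iff mass_pos less_imp_le)
  finally show ?thesis unfolding total_mass_def integral_\<nu> by simp
qed

text \<open>
  The ladder relations for \<open>D_norm\<close> and for \<open>weight\<close> have reciprocal coefficients, up to the factor
  \<open>\<rho> * (1 + \<rho>)\<close> for every particle.
\<close>

lemma weight_D_norm: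
  assumes "\<xi> \<in> \<Xi> k"
  shows "weight \<alpha> \<xi> * D_norm \<xi> = total_mass * (\<rho> * (1 + \<rho>)) ^ k"
  using assms
proof (induction k arbitrary: \<xi>)
  case 0
  then have "\<xi> = (\<lambda>_. 0)" by (simp add: \<Xi>_0)
  then show ?case
    using \<alpha>_pos \<rho>_pos
    by (simp add: D_norm_def D_def d_zero weight_eq_pochhammer total_mass_def)
next
  case (Suc k)
  have "\<exists>x. 0 < \<xi> x"
  proof (rule ccontr)
    assume "\<not> ?thesis"
    then have "(\<Sum>x\<in>UNIV. \<xi> x) = 0" by simp
    then show False using Suc.prems by (simp add: \<Xi>_def)
  qed
  then obtain x where x: "0 < \<xi> x" by blast
  define \<zeta> where "\<zeta> = remove_at x \<xi>"
  have \<xi>: "\<xi> = add_at x \<zeta>" and \<zeta>: "\<zeta> \<in> \<Xi> k"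
    using x Suc.prems by (simp_all add: \<zeta>_def add_at_remove_at remove_at_in_\<Xi>)
  have "real (\<zeta> x + 1) * (weight \<alpha> \<xi> * D_norm \<xi>) =
      weight \<alpha> \<zeta> * ((\<alpha> x + real (\<zeta> x)) * D_norm (add_at x \<zeta>))"
    unfolding \<xi> mult.assoc[symmetric] weight_add_at[OF \<alpha>_pos, of \<zeta> x] by (simp only: mult_ac)
  also have "\<dots> = real (\<zeta> x + 1) * (\<rho> * (1 + \<rho>) * (weight \<alpha> \<zeta> * D_norm \<zeta>))"
    unfolding D_norm_add_at by (simp only: mult_ac)
  finally have "weight \<alpha> \<xi> * D_norm \<xi> = \<rho> * (1 + \<rho>) * (weight \<alpha> \<zeta> * D_norm \<zeta>)"
    by (simp del: of_nat_Suc)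
  then show ?case using Suc.IH[OF \<zeta>] by simp
qed

lemma D_norm_pos: "0 < D_norm \<xi>"
proof -
  have "0 < weight \<alpha> \<xi> * D_norm \<xi>"
    using weight_D_norm[of \<xi> "\<Sum>x\<in>UNIV. \<xi> x"] total_mass_pos \<rho>_pos by (simp add: \<Xi>_def)
  then show ?thesis using weight_pos[OF \<alpha>_pos, of \<xi>] by (simp add: zero_less_mult_iff)
qed

lemma D_self_dual:
  "(- \<rho>) ^ (\<Sum>x\<in>UNIV. \<eta> x) * D \<alpha> \<rho> \<xi> \<eta> = (- \<rho>) ^ (\<Sum>x\<in>UNIV. \<xi> x) * D \<alpha> \<rho> \<eta> \<xi>"
  unfolding D_def power_sum prod.distrib[symmetric]
  using \<alpha>_pos \<rho>_pos by (intro prod.cong refl d_self_dual) auto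

end

section \<open>Approximation in mean square\<close>

lemma square_integrable_lincomb:
  assumes "square_integrable M f" "square_integrable M g"
  shows "square_integrable M (\<lambda>x. s * f x + g x)"
proof -
  have [measurable]: "f \<in> borel_measurable M" "g \<in> borel_measurable M"
    using assms by (auto simp: square_integrable_def)
  have "integrable M (\<lambda>x. (2 * s\<^sup>2) * (f x)\<^sup>2 + 2 * (g x)\<^sup>2)"
    using assms by (auto simp: square_integrable_def)
  then have "integrable M (\<lambda>x. (s * f x + g x)\<^sup>2)"
  proof (rule Bochner_Integration.integrable_bound)
    have "(s * f x + g x)\<^sup>2 \<le> (2 * s\<^sup>2) * (f x)\<^sup>2 + 2 * (g x)\<^sup>2" for x
      using zero_le_power2[of "s * f x - g x"] by (simp add: power2_eq_square algebra_simps)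
    then show "AE x in M. norm ((s * f x + g x)\<^sup>2) \<le> norm ((2 * s\<^sup>2) * (f x)\<^sup>2 + 2 * (g x)\<^sup>2)"
      by (intro AE_I2) (smt (verit) real_norm_def zero_le_power2)
  qed measurable
  then show ?thesis by (simp add: square_integrable_def)
qed

lemma integral_square_lincomb_le:
  assumes "square_integrable M f" "square_integrable M g"
  shows "(\<integral>x. (s * f x + g x)\<^sup>2 \<partial>M) \<le> 2 * s\<^sup>2 * (\<integral>x. (f x)\<^sup>2 \<partial>M) + 2 * (\<integral>x. (g x)\<^sup>2 \<partial>M)"
proof -
  have int: "integrable M (\<lambda>x. (f x)\<^sup>2)" "integrable M (\<lambda>x. (g x)\<^sup>2)"
    using assms by (auto simp: square_integrable_def)
  have "(\<integral>x. (s * f x + g x)\<^sup>2 \<partial>M) \<le> (\<integral>x. (2 * s\<^sup>2) * (f x)\<^sup>2 + 2 * (g x)\<^sup>2 \<partial>M)"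
  proof (rule integral_mono)
    show "integrable M (\<lambda>x. (s * f x + g x)\<^sup>2)"
      using square_integrable_lincomb[OF assms, of s] by (simp add: square_integrable_def)
    show "integrable M (\<lambda>x. (2 * s\<^sup>2) * (f x)\<^sup>2 + 2 * (g x)\<^sup>2)" using int by auto
    show "(s * f x + g x)\<^sup>2 \<le> (2 * s\<^sup>2) * (f x)\<^sup>2 + 2 * (g x)\<^sup>2" for x
      using zero_le_power2[of "s * f x - g x"] by (simp add: power2_eq_square algebra_simps)
  qed
  also have "\<dots> = 2 * s\<^sup>2 * (\<integral>x. (f x)\<^sup>2 \<partial>M) + 2 * (\<integral>x. (g x)\<^sup>2 \<partial>M)"
    using int by simp
  finally show ?thesis .
qed

lemma square_integrable_zero: "square_integrable M (\<lambda>_. 0)"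
  by (simp add: square_integrable_def)

lemma square_integrable_sum:
  assumes "finite J" "\<And>i. i \<in> J \<Longrightarrow> square_integrable M (e i)"
  shows "square_integrable M (\<lambda>x. \<Sum>i\<in>J. a i * e i x)"
  using assms by (induction J) (simp_all add: square_integrable_zero square_integrable_lincomb)

lemma square_integrable_diff:
  assumes "square_integrable M f" "square_integrable M g"
  shows "square_integrable M (\<lambda>x. f x - g x)"
  using square_integrable_lincomb[OF assms(2,1), of "- 1"] by simp

text \<open>
  Membership in the closed linear span of the family \<open>e\<close>, in the form needed for the density part of
  an orthogonal basis.
\<close>

definition L2_approximable :: "'a measure \<Rightarrow> 'i set \<Rightarrow> ('i \<Rightarrow> 'a \<Rightarrow> real) \<Rightarrow> ('a \<Rightarrow> real) \<Rightarrow> bool" where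
  "L2_approximable M I e f \<longleftrightarrow> square_integrable M f \<and>
     (\<forall>\<epsilon>>0. \<exists>J a. finite J \<and> J \<subseteq> I \<and> (\<integral>x. (f x - (\<Sum>i\<in>J. a i * e i x))\<^sup>2 \<partial>M) < \<epsilon>)"

lemma L2_approximable_zero: "L2_approximable M I e (\<lambda>_. 0)"
  unfolding L2_approximable_def by (auto simp: square_integrable_zero intro!: exI[of _ "{}"])

lemma L2_approximable_base:
  assumes "i \<in> I" "square_integrable M (e i)"
  shows "L2_approximable M I e (e i)"
  unfolding L2_approximable_def using assms
  by (auto intro!: exI[of _ "{i}"] exI[of _ "\<lambda>_. 1"])

lemma L2_approximable_lincomb:
  assumes e: "\<And>i. i \<in> I \<Longrightarrow> square_integrable M (e i)"
    and f: "L2_approximable M I e f" and g: "L2_approximable M I e g"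
  shows "L2_approximable M I e (\<lambda>x. s * f x + g x)"
  unfolding L2_approximable_def
proof (intro conjI allI impI)
  have sq: "square_integrable M f" "square_integrable M g"
    using f g by (auto simp: L2_approximable_def)
  then show "square_integrable M (\<lambda>x. s * f x + g x)" by (rule square_integrable_lincomb)
  fix \<epsilon> :: real assume \<epsilon>: "0 < \<epsilon>"
  \<comment> \<open>Chosen such that \<open>2 * s\<^sup>2 * \<delta> + 2 * \<delta> = \<epsilon>\<close> in \<open>integral_square_lincomb_le\<close>.\<close>
  define \<delta> where "\<delta> = \<epsilon> / (2 * s\<^sup>2 + 2)"
  have pos: "0 < 2 * s\<^sup>2 + 2" by (simp add: add_nonneg_pos)
  have \<delta>: "0 < \<delta>" using \<epsilon> pos by (simp add: \<delta>_def)
  obtain J a where J: "finite J" "J \<subseteq> I" "(\<integral>x. (f x - (\<Sum>i\<in>J. a i * e i x))\<^sup>2 \<partial>M) < \<delta>"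
    using f \<delta> unfolding L2_approximable_def by blast
  obtain K b where K: "finite K" "K \<subseteq> I" "(\<integral>x. (g x - (\<Sum>i\<in>K. b i * e i x))\<^sup>2 \<partial>M) < \<delta>"
    using g \<delta> unfolding L2_approximable_def by blast
  define c where "c i = s * (if i \<in> J then a i else 0) + (if i \<in> K then b i else 0)" for i
  have sum: "(\<Sum>i\<in>J \<union> K. c i * e i x) = s * (\<Sum>i\<in>J. a i * e i x) + (\<Sum>i\<in>K. b i * e i x)" for x
  proof -
    have "(\<Sum>i\<in>J \<union> K. c i * e i x) = s * (\<Sum>i\<in>J \<union> K. if i \<in> J then a i * e i x else 0) +
        (\<Sum>i\<in>J \<union> K. if i \<in> K then b i * e i x else 0)"
      unfolding sum_distrib_left sum.distrib[symmetric]
      by (intro sum.cong refl) (simp add: c_def algebra_simps)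
    moreover have "(\<Sum>i\<in>J \<union> K. if i \<in> J then a i * e i x else 0) = (\<Sum>i\<in>J. a i * e i x)"
      using J K by (intro sum.mono_neutral_cong_right) auto
    moreover have "(\<Sum>i\<in>J \<union> K. if i \<in> K then b i * e i x else 0) = (\<Sum>i\<in>K. b i * e i x)"
      using J K by (intro sum.mono_neutral_cong_right) auto
    ultimately show ?thesis by simp
  qed
  have "(\<integral>x. (s * f x + g x - (\<Sum>i\<in>J \<union> K. c i * e i x))\<^sup>2 \<partial>M) =
      (\<integral>x. (s * (f x - (\<Sum>i\<in>J. a i * e i x)) + (g x - (\<Sum>i\<in>K. b i * e i x)))\<^sup>2 \<partial>M)"
    unfolding sum by (intro Bochner_Integration.integral_cong refl) (simp add: algebra_simps)
  also have "\<dots> \<le> 2 * s\<^sup>2 * (\<integral>x. (f x - (\<Sum>i\<in>J. a i * e i x))\<^sup>2 \<partial>M) +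
      2 * (\<integral>x. (g x - (\<Sum>i\<in>K. b i * e i x))\<^sup>2 \<partial>M)"
    using J K sq by (intro integral_square_lincomb_le square_integrable_diff square_integrable_sum e) auto
  also have "\<dots> < (2 * s\<^sup>2) * \<delta> + 2 * \<delta>"
    using J(3) K(3) by (intro add_le_less_mono mult_left_mono) auto
  also have "\<dots> = (2 * s\<^sup>2 + 2) * \<delta>" by (simp only: distrib_right)
  also have "\<dots> = \<epsilon>"
    unfolding \<delta>_def using less_imp_neq[OF pos] by (simp only: nonzero_mult_div_cancel_left times_divide_eq_right)
  finally show "\<exists>J a. finite J \<and> J \<subseteq> I \<and>
      (\<integral>x. (s * f x + g x - (\<Sum>i\<in>J. a i * e i x))\<^sup>2 \<partial>M) < \<epsilon>"
    using J(1,2) K(1,2) by (intro exI[of _ "J \<union> K"] exI[of _ c]) auto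
qed

lemma L2_approximable_sum:
  assumes "\<And>i. i \<in> I \<Longrightarrow> square_integrable M (e i)" "finite S"
    and "\<And>j. j \<in> S \<Longrightarrow> L2_approximable M I e (g j)"
  shows "L2_approximable M I e (\<lambda>x. \<Sum>j\<in>S. a j * g j x)"
  using assms(2,3)
  by (induction S) (simp_all add: L2_approximable_zero L2_approximable_lincomb[OF assms(1)])

lemma L2_approximable_limit:
  assumes e: "\<And>i. i \<in> I \<Longrightarrow> square_integrable M (e i)" and f: "square_integrable M f"
    and lim: "\<And>\<epsilon>. 0 < \<epsilon> \<Longrightarrow> \<exists>g. L2_approximable M I e g \<and> (\<integral>x. (f x - g x)\<^sup>2 \<partial>M) < \<epsilon>"
  shows "L2_approximable M I e f"
  unfolding L2_approximable_def
proof (intro conjI allI impI f)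
  fix \<epsilon> :: real assume "0 < \<epsilon>"
  then have \<delta>: "0 < \<epsilon> / 4" by simp
  obtain g where g: "L2_approximable M I e g" "(\<integral>x. (f x - g x)\<^sup>2 \<partial>M) < \<epsilon> / 4"
    using lim[OF \<delta>] by blast
  then have sq: "square_integrable M g" by (simp add: L2_approximable_def)
  obtain J a where J: "finite J" "J \<subseteq> I" "(\<integral>x. (g x - (\<Sum>i\<in>J. a i * e i x))\<^sup>2 \<partial>M) < \<epsilon> / 4"
    using g(1) \<delta> unfolding L2_approximable_def by blast
  have "(\<integral>x. (f x - (\<Sum>i\<in>J. a i * e i x))\<^sup>2 \<partial>M) =
      (\<integral>x. (1 * (f x - g x) + (g x - (\<Sum>i\<in>J. a i * e i x)))\<^sup>2 \<partial>M)"
    by simp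
  also have "\<dots> \<le> 2 * 1\<^sup>2 * (\<integral>x. (f x - g x)\<^sup>2 \<partial>M) + 2 * (\<integral>x. (g x - (\<Sum>i\<in>J. a i * e i x))\<^sup>2 \<partial>M)"
    using J f sq by (intro integral_square_lincomb_le square_integrable_diff square_integrable_sum e) auto
  also have "\<dots> < \<epsilon>" using g(2) J(3) by simp
  finally show "\<exists>J a. finite J \<and> J \<subseteq> I \<and> (\<integral>x. (f x - (\<Sum>i\<in>J. a i * e i x))\<^sup>2 \<partial>M) < \<epsilon>"
    using J(1,2) by blast
qed

section \<open>Completeness of the duality functions\<close>

context duality_measure
begin

lemma square_integrable_poly_bounded: "poly_bounded f \<Longrightarrow> square_integrable (\<nu> \<alpha> \<rho>) f"
  by (simp add: square_integrable_def integrable_poly_bounded)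

lemma integral_finite_support:
  fixes h :: "('v \<Rightarrow> nat) \<Rightarrow> real"
  assumes "finite T"
  shows "(\<integral>\<eta>. (if \<eta> \<in> T then h \<eta> else 0) \<partial>\<nu> \<alpha> \<rho>) = (\<Sum>\<eta>\<in>T. mass \<eta> * h \<eta>)"
proof -
  have "(\<integral>\<eta>. (if \<eta> \<in> T then h \<eta> else 0) \<partial>\<nu> \<alpha> \<rho>) =
      infsetsum (\<lambda>\<eta>. mass \<eta> * (if \<eta> \<in> T then h \<eta> else 0)) UNIV"
    by (rule integral_\<nu>)
  also have "\<dots> = infsetsum (\<lambda>\<eta>. mass \<eta> * h \<eta>) T"
    by (rule infsetsum_cong_neutral) auto
  finally show ?thesis using assms by simp
qed

lemma integrable_finite_support:
  fixes h :: "('v \<Rightarrow> nat) \<Rightarrow> real"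
  assumes "finite T"
  shows "integrable (\<nu> \<alpha> \<rho>) (\<lambda>\<eta>. if \<eta> \<in> T then h \<eta> else 0)"
proof -
  have "Infinite_Set_Sum.abs_summable_on (\<lambda>\<eta>. mass \<eta> * h \<eta>) T" using assms by simp
  also have "?this \<longleftrightarrow> Infinite_Set_Sum.abs_summable_on (\<lambda>\<eta>. mass \<eta> * (if \<eta> \<in> T then h \<eta> else 0)) UNIV"
    by (rule abs_summable_on_cong_neutral) auto
  finally show ?thesis by (simp add: integrable_\<nu>_iff)
qed

lemma integral_finite_approximation:
  assumes "integrable (\<nu> \<alpha> \<rho>) g" "0 < \<epsilon>"
  shows "\<exists>T. finite T \<and> (\<integral>\<eta>. g \<eta> \<partial>\<nu> \<alpha> \<rho>) - (\<Sum>\<eta>\<in>T. mass \<eta> * g \<eta>) < \<epsilon>"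
proof -
  let ?g = "\<lambda>\<eta>. mass \<eta> * g \<eta>"
  have abs: "Infinite_Set_Sum.abs_summable_on ?g UNIV"
    using assms(1) by (simp add: integrable_\<nu>_iff)
  then have "?g summable_on UNIV"
    using abs_summable_equivalent abs_summable_summable by blast
  then have "(sum ?g \<longlongrightarrow> infsetsum ?g UNIV) (finite_subsets_at_top UNIV)"
    using has_sum_infsum[of ?g UNIV] infsetsum_infsum[OF abs] by (simp add: has_sum_def)
  then have "\<forall>\<^sub>F T in finite_subsets_at_top UNIV. infsetsum ?g UNIV - \<epsilon> < sum ?g T"
    using assms(2) by (intro order_tendstoD(1)) auto
  then obtain T where "finite T" "infsetsum ?g UNIV - \<epsilon> < sum ?g T"
    unfolding eventually_finite_subsets_at_top by blast
  then show ?thesis unfolding integral_\<nu> by (intro exI[of _ T]) auto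
qed

lemma integral_D_sums:
  assumes "finite S" "finite T"
  shows "(\<integral>\<eta>. (\<Sum>\<xi>\<in>S. a \<xi> * D \<alpha> \<rho> \<xi> \<eta>) * (\<Sum>\<xi>\<in>T. b \<xi> * D \<alpha> \<rho> \<xi> \<eta>) \<partial>\<nu> \<alpha> \<rho>) =
    (\<Sum>\<xi>\<in>S \<inter> T. a \<xi> * b \<xi> * D_norm \<xi>)"
proof -
  have "(\<integral>\<eta>. (\<Sum>\<xi>\<in>S. a \<xi> * D \<alpha> \<rho> \<xi> \<eta>) * (\<Sum>\<xi>\<in>T. b \<xi> * D \<alpha> \<rho> \<xi> \<eta>) \<partial>\<nu> \<alpha> \<rho>) =
      (\<integral>\<eta>. (\<Sum>\<xi>\<in>S. \<Sum>\<xi>'\<in>T. a \<xi> * b \<xi>' * (D \<alpha> \<rho> \<xi> \<eta> * D \<alpha> \<rho> \<xi>' \<eta>)) \<partial>\<nu> \<alpha> \<rho>)"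
    by (simp add: sum_product mult_ac)
  also have "\<dots> = (\<Sum>\<xi>\<in>S. \<Sum>\<xi>'\<in>T. a \<xi> * b \<xi>' * (\<integral>\<eta>. D \<alpha> \<rho> \<xi> \<eta> * D \<alpha> \<rho> \<xi>' \<eta> \<partial>\<nu> \<alpha> \<rho>))"
    by (simp add: Bochner_Integration.integral_sum integrable_poly_bounded)
  also have "\<dots> = (\<Sum>\<xi>\<in>S. \<Sum>\<xi>'\<in>T. if \<xi>' = \<xi> then a \<xi> * b \<xi> * D_norm \<xi> else 0)"
    by (intro sum.cong refl) (auto simp: D_orthogonal D_norm_def power2_eq_square)
  also have "\<dots> = (\<Sum>\<xi>\<in>S. if \<xi> \<in> T then a \<xi> * b \<xi> * D_norm \<xi> else 0)"
    using assms by simp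
  also have "\<dots> = (\<Sum>\<xi>\<in>S \<inter> T. a \<xi> * b \<xi> * D_norm \<xi>)"
    using assms(1) by (simp add: sum.inter_restrict)
  finally show ?thesis .
qed

text \<open>
  Pythagoras for the partial orthogonal expansions of the indicator of \<open>\<zeta>\<close>. Its Fourier
  coefficient with respect to \<open>D \<alpha> \<rho> \<xi>\<close> is \<open>mass \<zeta> * D \<alpha> \<rho> \<xi> \<zeta> / D_norm \<xi>\<close>.
\<close>

lemma point_mass_expansion_error:
  fixes \<zeta> :: "'v \<Rightarrow> nat"
  assumes "finite T"
  shows "(\<integral>\<eta>. ((if \<eta> \<in> {\<zeta>} then 1 else 0) -
      (\<Sum>\<xi>\<in>T. mass \<zeta> * D \<alpha> \<rho> \<xi> \<zeta> / D_norm \<xi> * D \<alpha> \<rho> \<xi> \<eta>))\<^sup>2 \<partial>\<nu> \<alpha> \<rho>) =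
    mass \<zeta> - (\<Sum>\<xi>\<in>T. (mass \<zeta> * D \<alpha> \<rho> \<xi> \<zeta>)\<^sup>2 / D_norm \<xi>)"
proof -
  define a where "a \<xi> = mass \<zeta> * D \<alpha> \<rho> \<xi> \<zeta> / D_norm \<xi>" for \<xi>
  define s where "s \<eta> = (\<Sum>\<xi>\<in>T. a \<xi> * D \<alpha> \<rho> \<xi> \<eta>)" for \<eta>
  let ?B = "\<Sum>\<xi>\<in>T. (mass \<zeta> * D \<alpha> \<rho> \<xi> \<zeta>)\<^sup>2 / D_norm \<xi>"
  have "poly_bounded s" unfolding s_def by (intro poly_bounded_sum poly_bounded_mult) auto
  then have int_s: "integrable (\<nu> \<alpha> \<rho>) (\<lambda>\<eta>. s \<eta> * s \<eta>)" by (intro integrable_poly_bounded) auto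
  have "(\<integral>\<eta>. ((if \<eta> \<in> {\<zeta>} then 1 else 0) - s \<eta>)\<^sup>2 \<partial>\<nu> \<alpha> \<rho>) =
      (\<integral>\<eta>. (if \<eta> \<in> {\<zeta>} then 1 - 2 * s \<eta> else 0) + s \<eta> * s \<eta> \<partial>\<nu> \<alpha> \<rho>)"
    by (intro Bochner_Integration.integral_cong refl) (auto simp: power2_eq_square algebra_simps)
  also have "\<dots> = mass \<zeta> * (1 - 2 * s \<zeta>) + (\<integral>\<eta>. s \<eta> * s \<eta> \<partial>\<nu> \<alpha> \<rho>)"
    using int_s integrable_finite_support[of "{\<zeta>}"] integral_finite_support[of "{\<zeta>}" "\<lambda>\<eta>. 1 - 2 * s \<eta>"]
    by (subst Bochner_Integration.integral_add) auto
  also have "mass \<zeta> * s \<zeta> = ?B"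
    unfolding s_def a_def sum_distrib_left by (simp add: power2_eq_square mult_ac)
  then have "mass \<zeta> * (1 - 2 * s \<zeta>) = mass \<zeta> - 2 * ?B" by (simp add: algebra_simps)
  also have "(\<integral>\<eta>. s \<eta> * s \<eta> \<partial>\<nu> \<alpha> \<rho>) = ?B"
    unfolding s_def integral_D_sums[OF assms assms] using D_norm_pos
    by (intro sum.cong) (auto simp: a_def power2_eq_square less_imp_neq[symmetric])
  finally show ?thesis unfolding s_def a_def by simp
qed

text \<open>
  By self-duality and the formula for the norms, the squared Fourier coefficients of the indicator of
  \<open>\<zeta>\<close>, as a function of \<open>\<xi>\<close>, are proportional to \<open>mass \<xi> * (D \<alpha> \<rho> \<zeta> \<xi>)\<^sup>2\<close>. Their sum is
  therefore a multiple of \<open>D_norm \<zeta>\<close>, and the formula for the norm of \<open>D \<alpha> \<rho> \<zeta>\<close> shows that it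
  is exactly \<open>mass \<zeta>\<close>, the squared norm of the indicator.
\<close>

lemma point_mass_parseval:
  fixes \<zeta> :: "'v \<Rightarrow> nat"
  assumes "0 < \<epsilon>"
  shows "\<exists>T. finite T \<and> mass \<zeta> - (\<Sum>\<xi>\<in>T. (mass \<zeta> * D \<alpha> \<rho> \<xi> \<zeta>)\<^sup>2 / D_norm \<xi>) < \<epsilon>"
proof -
  define z where "z = (1 + \<rho>) powr (- (\<Sum>x\<in>UNIV. \<alpha> x))"
  define n where "n = (\<Sum>x\<in>UNIV. \<zeta> x)"
  have z: "0 < z" using \<rho>_pos by (simp add: z_def)
  \<comment> \<open>The constant of proportionality.\<close>
  define K where "K = (mass \<zeta>)\<^sup>2 / (\<rho> ^ (2 * n) * total_mass * z)"
  have K: "0 < K" using mass_pos[of \<zeta>] z total_mass_pos \<rho>_pos by (simp add: K_def)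
  have norm: "D_norm \<xi> = total_mass * (\<rho> * (1 + \<rho>)) ^ (\<Sum>x\<in>UNIV. \<xi> x) / weight \<alpha> \<xi>" for \<xi>
    using weight_D_norm[of \<xi> "\<Sum>x\<in>UNIV. \<xi> x"] weight_pos[OF \<alpha>_pos, of \<xi>]
    by (simp add: \<Xi>_def field_simps)
  have term_eq: "(mass \<zeta> * D \<alpha> \<rho> \<xi> \<zeta>)\<^sup>2 / D_norm \<xi> = K * (mass \<xi> * (D \<alpha> \<rho> \<zeta> \<xi>)\<^sup>2)" for \<xi>
  proof -
    define m where "m = (\<Sum>x\<in>UNIV. \<xi> x)"
    have "((- \<rho>) ^ n * D \<alpha> \<rho> \<xi> \<zeta>)\<^sup>2 = ((- \<rho>) ^ m * D \<alpha> \<rho> \<zeta> \<xi>)\<^sup>2"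
      unfolding n_def m_def by (simp only: D_self_dual)
    then have dual: "\<rho> ^ (2 * n) * (D \<alpha> \<rho> \<xi> \<zeta>)\<^sup>2 = \<rho> ^ (2 * m) * (D \<alpha> \<rho> \<zeta> \<xi>)\<^sup>2"
      by (simp add: power_mult_distrib power_mult[symmetric] mult.commute[of _ 2])
    then have D2: "(D \<alpha> \<rho> \<xi> \<zeta>)\<^sup>2 = \<rho> ^ (2 * m) * (D \<alpha> \<rho> \<zeta> \<xi>)\<^sup>2 / \<rho> ^ (2 * n)"
      using \<rho>_pos by (simp add: field_simps)
    have "\<rho> ^ (2 * m) = (\<rho> / (1 + \<rho>)) ^ m * (\<rho> * (1 + \<rho>)) ^ m"
      using \<rho>_pos by (simp add: power_mult_distrib[symmetric] power_mult power2_eq_square)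
    then have "(mass \<zeta> * D \<alpha> \<rho> \<xi> \<zeta>)\<^sup>2 / D_norm \<xi> =
        (mass \<zeta>)\<^sup>2 * ((\<rho> / (1 + \<rho>)) ^ m * (\<rho> * (1 + \<rho>)) ^ m * (D \<alpha> \<rho> \<zeta> \<xi>)\<^sup>2 / \<rho> ^ (2 * n)) /
        (total_mass * (\<rho> * (1 + \<rho>)) ^ m / weight \<alpha> \<xi>)"
      unfolding power_mult_distrib[of "mass \<zeta>"] D2 norm m_def by simp
    also have "\<dots> = K * (z * (\<rho> / (1 + \<rho>)) ^ m * weight \<alpha> \<xi> * (D \<alpha> \<rho> \<zeta> \<xi>)\<^sup>2)"
    proof -
      have "(\<rho> * (1 + \<rho>)) ^ m \<noteq> 0" using \<rho>_pos by simp
      then show ?thesis unfolding K_def using z total_mass_pos \<rho>_pos by simp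
    qed
    finally show ?thesis by (simp add: mass_def z_def m_def mult.assoc)
  qed
  have K_norm: "K * D_norm \<zeta> = mass \<zeta>"
  proof -
    have "\<rho> ^ (2 * n) = (\<rho> / (1 + \<rho>)) ^ n * (\<rho> * (1 + \<rho>)) ^ n"
      using \<rho>_pos by (simp add: power_mult_distrib[symmetric] power_mult power2_eq_square)
    then have "\<rho> ^ (2 * n) * total_mass * z = mass \<zeta> * D_norm \<zeta>"
      using weight_pos[OF \<alpha>_pos, of \<zeta>] by (simp add: norm mass_def z_def n_def)
    then show ?thesis
      using mass_pos[of \<zeta>] D_norm_pos[of \<zeta>] by (simp add: K_def power2_eq_square)
  qed
  have "integrable (\<nu> \<alpha> \<rho>) (\<lambda>\<eta>. (D \<alpha> \<rho> \<zeta> \<eta>)\<^sup>2)" by (intro integrable_poly_bounded) auto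
  moreover have "0 < \<epsilon> / K" using assms K by simp
  ultimately obtain T where T: "finite T"
    "D_norm \<zeta> - (\<Sum>\<xi>\<in>T. mass \<xi> * (D \<alpha> \<rho> \<zeta> \<xi>)\<^sup>2) < \<epsilon> / K"
    unfolding D_norm_def using integral_finite_approximation by blast
  have "K * (D_norm \<zeta> - (\<Sum>\<xi>\<in>T. mass \<xi> * (D \<alpha> \<rho> \<zeta> \<xi>)\<^sup>2)) < K * (\<epsilon> / K)"
    using T(2) K by (rule mult_strict_left_mono)
  then have "mass \<zeta> - (\<Sum>\<xi>\<in>T. (mass \<zeta> * D \<alpha> \<rho> \<xi> \<zeta>)\<^sup>2 / D_norm \<xi>) < \<epsilon>"
    unfolding term_eq using K by (simp add: right_diff_distrib K_norm sum_distrib_left)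
  then show ?thesis using T(1) by blast
qed

text \<open>
  Indicators of single configurations are limits of combinations of duality functions by Parseval's
  identity, and square integrable functions are limits of combinations of these indicators by
  truncation to finite sets.
\<close>

theorem L2_approximable_if_D_approximable:
  assumes e: "\<And>i. i \<in> I \<Longrightarrow> square_integrable (\<nu> \<alpha> \<rho>) (e i)"
    and D: "\<And>\<xi>. L2_approximable (\<nu> \<alpha> \<rho>) I e (D \<alpha> \<rho> \<xi>)"
    and f: "square_integrable (\<nu> \<alpha> \<rho>) f"
  shows "L2_approximable (\<nu> \<alpha> \<rho>) I e f"
proof -
  have point: "L2_approximable (\<nu> \<alpha> \<rho>) I e (\<lambda>\<eta>. if \<eta> \<in> {\<zeta>} then 1 else 0)" for \<zeta>
  proof (rule L2_approximable_limit[OF e])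
    have "poly_bounded (\<lambda>\<eta>. if \<eta> \<in> {\<zeta>} then 1 else 0)"
      by (rule poly_boundedI[of _ 1 0]) simp
    then show "square_integrable (\<nu> \<alpha> \<rho>) (\<lambda>\<eta>. if \<eta> \<in> {\<zeta>} then 1 else 0)"
      by (rule square_integrable_poly_bounded)
    fix \<epsilon> :: real assume "0 < \<epsilon>"
    then obtain T where T: "finite T"
      "mass \<zeta> - (\<Sum>\<xi>\<in>T. (mass \<zeta> * D \<alpha> \<rho> \<xi> \<zeta>)\<^sup>2 / D_norm \<xi>) < \<epsilon>"
      using point_mass_parseval by blast
    let ?g = "\<lambda>\<eta>. \<Sum>\<xi>\<in>T. mass \<zeta> * D \<alpha> \<rho> \<xi> \<zeta> / D_norm \<xi> * D \<alpha> \<rho> \<xi> \<eta>"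
    have "L2_approximable (\<nu> \<alpha> \<rho>) I e ?g"
      by (rule L2_approximable_sum[OF e T(1) D])
    moreover have "(\<integral>\<eta>. ((if \<eta> \<in> {\<zeta>} then 1 else 0) - ?g \<eta>)\<^sup>2 \<partial>\<nu> \<alpha> \<rho>) < \<epsilon>"
      unfolding point_mass_expansion_error[OF T(1)] by (rule T(2))
    ultimately show "\<exists>g. L2_approximable (\<nu> \<alpha> \<rho>) I e g \<and>
        (\<integral>\<eta>. ((if \<eta> \<in> {\<zeta>} then 1 else 0) - g \<eta>)\<^sup>2 \<partial>\<nu> \<alpha> \<rho>) < \<epsilon>"
      by (intro exI[of _ ?g] conjI)
  qed
  show ?thesis
  proof (rule L2_approximable_limit[OF e f])
    fix \<epsilon> :: real assume \<epsilon>: "0 < \<epsilon>"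
    have int: "integrable (\<nu> \<alpha> \<rho>) (\<lambda>\<eta>. (f \<eta>)\<^sup>2)" using f by (simp add: square_integrable_def)
    obtain T where T: "finite T"
      "(\<integral>\<eta>. (f \<eta>)\<^sup>2 \<partial>\<nu> \<alpha> \<rho>) - (\<Sum>\<eta>\<in>T. mass \<eta> * (f \<eta>)\<^sup>2) < \<epsilon>"
      using integral_finite_approximation[OF int \<epsilon>] by blast
    define g where "g \<eta> = (\<Sum>\<zeta>\<in>T. f \<zeta> * (if \<eta> \<in> {\<zeta>} then 1 else 0))" for \<eta>
    have g_eq: "g \<eta> = (if \<eta> \<in> T then f \<eta> else 0)" for \<eta>
      unfolding g_def using T(1) by (simp add: if_distrib cong: if_cong)
    have "(\<integral>\<eta>. (f \<eta> - g \<eta>)\<^sup>2 \<partial>\<nu> \<alpha> \<rho>) =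
        (\<integral>\<eta>. (f \<eta>)\<^sup>2 - (if \<eta> \<in> T then (f \<eta>)\<^sup>2 else 0) \<partial>\<nu> \<alpha> \<rho>)"
      by (intro Bochner_Integration.integral_cong refl) (simp add: g_eq)
    also have "\<dots> = (\<integral>\<eta>. (f \<eta>)\<^sup>2 \<partial>\<nu> \<alpha> \<rho>) - (\<Sum>\<eta>\<in>T. mass \<eta> * (f \<eta>)\<^sup>2)"
      using int integrable_finite_support[OF T(1)] integral_finite_support[OF T(1), of "\<lambda>\<eta>. (f \<eta>)\<^sup>2"]
      by (subst Bochner_Integration.integral_diff) auto
    finally have "(\<integral>\<eta>. (f \<eta> - g \<eta>)\<^sup>2 \<partial>\<nu> \<alpha> \<rho>) < \<epsilon>" using T(2) by simp
    moreover have "L2_approximable (\<nu> \<alpha> \<rho>) I e g"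
      unfolding g_def by (rule L2_approximable_sum[OF e T(1) point])
    ultimately show "\<exists>g. L2_approximable (\<nu> \<alpha> \<rho>) I e g \<and> (\<integral>\<eta>. (f \<eta> - g \<eta>)\<^sup>2 \<partial>\<nu> \<alpha> \<rho>) < \<epsilon>"
      by (intro exI[of _ g] conjI)
  qed
qed

section \<open>The orthogonal basis of lifted eigenfunctions\<close>

lemma \<mu>_pos: "0 < \<mu> \<alpha> k \<xi>"
proof -
  have "0 < (\<Sum>x\<in>UNIV. \<alpha> x)" using \<alpha>_pos by (intro sum_pos) auto
  then show ?thesis
    unfolding \<mu>_eq_pochhammer[OF \<alpha>_pos] using weight_pos[OF \<alpha>_pos, of \<xi>] by (simp add: pochhammer_pos)
qed

lemma poly_bounded_lifted: "poly_bounded (lifted \<alpha> \<rho> k \<psi>)"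
proof -
  have "poly_bounded (\<lambda>\<eta>. \<Sum>\<xi>\<in>\<Xi> k. \<mu> \<alpha> k \<xi> * \<psi> \<xi> * D \<alpha> \<rho> \<xi> \<eta>)"
    by (intro poly_bounded_sum poly_bounded_mult) auto
  then show ?thesis unfolding lifted_eq_sum[OF \<alpha>_pos \<rho>_pos, symmetric] .
qed

lemma integral_lifted_product:
  "(\<integral>\<eta>. lifted \<alpha> \<rho> k \<psi> \<eta> * lifted \<alpha> \<rho> l \<phi> \<eta> \<partial>\<nu> \<alpha> \<rho>) =
    (\<Sum>\<xi>\<in>\<Xi> k \<inter> \<Xi> l. \<mu> \<alpha> k \<xi> * \<psi> \<xi> * (\<mu> \<alpha> l \<xi> * \<phi> \<xi>) * D_norm \<xi>)"
  unfolding lifted_eq_sum[OF \<alpha>_pos \<rho>_pos] by (rule integral_D_sums) simp_all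

lemma integral_lifted_different_degree:
  assumes "k \<noteq> l"
  shows "(\<integral>\<eta>. lifted \<alpha> \<rho> k \<psi> \<eta> * lifted \<alpha> \<rho> l \<phi> \<eta> \<partial>\<nu> \<alpha> \<rho>) = 0"
proof -
  have "\<Xi> k \<inter> \<Xi> l = ({} :: ('v \<Rightarrow> nat) set)" using assms by (auto simp: \<Xi>_def)
  then show ?thesis by (simp add: integral_lifted_product)
qed

text \<open>
  Lifting is an isometry up to the constant \<open>r\<close>, because \<open>weight \<alpha> \<xi> * D_norm \<xi>\<close> is constant on
  \<open>\<Xi> k\<close>.
\<close>

lemma integral_lifted_same_degree:
  "\<exists>r>0. \<forall>\<psi> \<phi>. (\<integral>\<eta>. lifted \<alpha> \<rho> k \<psi> \<eta> * lifted \<alpha> \<rho> k \<phi> \<eta> \<partial>\<nu> \<alpha> \<rho>) =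
    r * (\<Sum>\<xi>\<in>\<Xi> k. weight \<alpha> \<xi> * (\<psi> \<xi> * \<phi> \<xi>))"
proof -
  define z where "z = fact k / pochhammer (\<Sum>x\<in>UNIV. \<alpha> x) k"
  define r where "r = z\<^sup>2 * (total_mass * (\<rho> * (1 + \<rho>)) ^ k)"
  have "0 < (\<Sum>x\<in>UNIV. \<alpha> x)" using \<alpha>_pos by (intro sum_pos) auto
  then have "0 < z" by (simp add: z_def pochhammer_pos)
  then have "0 < r" using total_mass_pos \<rho>_pos by (simp add: r_def)
  moreover have "(\<integral>\<eta>. lifted \<alpha> \<rho> k \<psi> \<eta> * lifted \<alpha> \<rho> k \<phi> \<eta> \<partial>\<nu> \<alpha> \<rho>) =
      r * (\<Sum>\<xi>\<in>\<Xi> k. weight \<alpha> \<xi> * (\<psi> \<xi> * \<phi> \<xi>))" for \<psi> \<phi>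
    unfolding integral_lifted_product Int_absorb sum_distrib_left
  proof (intro sum.cong refl)
    fix \<xi> :: "'v \<Rightarrow> nat" assume \<xi>: "\<xi> \<in> \<Xi> k"
    have "\<mu> \<alpha> k \<xi> * \<psi> \<xi> * (\<mu> \<alpha> k \<xi> * \<phi> \<xi>) * D_norm \<xi> =
        z\<^sup>2 * (weight \<alpha> \<xi> * D_norm \<xi>) * (weight \<alpha> \<xi> * (\<psi> \<xi> * \<phi> \<xi>))"
      unfolding \<mu>_eq_pochhammer[OF \<alpha>_pos] z_def[symmetric] by (simp add: power2_eq_square mult_ac)
    then show "\<mu> \<alpha> k \<xi> * \<psi> \<xi> * (\<mu> \<alpha> k \<xi> * \<phi> \<xi>) * D_norm \<xi> = r * (weight \<alpha> \<xi> * (\<psi> \<xi> * \<phi> \<xi>))"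
      unfolding weight_D_norm[OF \<xi>] r_def .
  qed
  ultimately show ?thesis by blast
qed

text \<open>
  The duality function of \<open>\<zeta>\<close> is the lift of a multiple of the indicator of \<open>\<zeta>\<close>, which is then
  expanded in the spanning set.
\<close>

lemma D_eq_sum_lifted:
  assumes "\<And>f. \<exists>a. \<forall>\<xi>\<in>\<Xi> k. f \<xi> = (\<Sum>b\<in>B. a b * b \<xi>)" "\<zeta> \<in> \<Xi> k"
  obtains a where "D \<alpha> \<rho> \<zeta> = (\<lambda>\<eta>. \<Sum>b\<in>B. a b * lifted \<alpha> \<rho> k b \<eta>)"
proof -
  obtain a where a: "\<And>\<xi>. \<xi> \<in> \<Xi> k \<Longrightarrow> (if \<xi> = \<zeta> then 1 / \<mu> \<alpha> k \<zeta> else 0) = (\<Sum>b\<in>B. a b * b \<xi>)"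
    using assms(1)[of "\<lambda>\<xi>. if \<xi> = \<zeta> then 1 / \<mu> \<alpha> k \<zeta> else 0"] by blast
  have "D \<alpha> \<rho> \<zeta> \<eta> = (\<Sum>b\<in>B. a b * lifted \<alpha> \<rho> k b \<eta>)" for \<eta>
  proof -
    have "(\<Sum>b\<in>B. a b * lifted \<alpha> \<rho> k b \<eta>) =
        (\<Sum>\<xi>\<in>\<Xi> k. \<mu> \<alpha> k \<xi> * (\<Sum>b\<in>B. a b * b \<xi>) * D \<alpha> \<rho> \<xi> \<eta>)"
      unfolding lifted_eq_sum[OF \<alpha>_pos \<rho>_pos] sum_distrib_left sum_distrib_right
      by (subst sum.swap) (simp add: mult_ac)
    also have "\<dots> = (\<Sum>\<xi>\<in>\<Xi> k. if \<xi> = \<zeta> then D \<alpha> \<rho> \<zeta> \<eta> else 0)"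
      using \<mu>_pos[of k \<zeta>] by (intro sum.cong refl) (simp flip: a)
    also have "\<dots> = D \<alpha> \<rho> \<zeta> \<eta>" using assms(2) by simp
    finally show ?thesis ..
  qed
  then show thesis using that by blast
qed

text \<open>
  Orthogonality across levels holds because the sets \<open>\<Xi> k\<close> are disjoint, and within a level
  because lifting is an isometry up to a constant. Density follows since every duality function is a
  combination of lifted basis elements of its own level.
\<close>

theorem lifted_orthogonal_basis:
  assumes finite: "\<And>k. finite (\<Psi> k)"
    and nonzero: "\<And>k \<psi>. \<psi> \<in> \<Psi> k \<Longrightarrow> (\<Sum>\<xi>\<in>\<Xi> k. weight \<alpha> \<xi> * (\<psi> \<xi> * \<psi> \<xi>)) \<noteq> 0"
    and orthogonal: "\<And>k \<psi> \<phi>. \<psi> \<in> \<Psi> k \<Longrightarrow> \<phi> \<in> \<Psi> k \<Longrightarrow> \<psi> \<noteq> \<phi> \<Longrightarrow>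
      (\<Sum>\<xi>\<in>\<Xi> k. weight \<alpha> \<xi> * (\<psi> \<xi> * \<phi> \<xi>)) = 0"
    and spanning: "\<And>k f. \<exists>a. \<forall>\<xi>\<in>\<Xi> k. f \<xi> = (\<Sum>b\<in>\<Psi> k. a b * b \<xi>)"
  shows "orthogonal_basis_L2 (\<nu> \<alpha> \<rho>) (SIGMA k:UNIV. \<Psi> k) (\<lambda>(k, \<psi>). lifted \<alpha> \<rho> k \<psi>)"
proof -
  let ?I = "SIGMA k:UNIV. \<Psi> k" and ?e = "\<lambda>(k, \<psi>). lifted \<alpha> \<rho> k \<psi>"
  have sq: "square_integrable (\<nu> \<alpha> \<rho>) (?e i)" for i
    by (cases i) (simp add: square_integrable_poly_bounded poly_bounded_lifted)
  have "L2_approximable (\<nu> \<alpha> \<rho>) ?I ?e (D \<alpha> \<rho> \<zeta>)" for \<zeta>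
  proof -
    define k where "k = (\<Sum>x\<in>UNIV. \<zeta> x)"
    have \<zeta>: "\<zeta> \<in> \<Xi> k" by (simp add: \<Xi>_def k_def)
    obtain a where a: "D \<alpha> \<rho> \<zeta> = (\<lambda>\<eta>. \<Sum>b\<in>\<Psi> k. a b * lifted \<alpha> \<rho> k b \<eta>)"
      using D_eq_sum_lifted[OF spanning \<zeta>] by blast
    have "L2_approximable (\<nu> \<alpha> \<rho>) ?I ?e (lifted \<alpha> \<rho> k b)" if "b \<in> \<Psi> k" for b
      using L2_approximable_base[of "(k, b)" ?I "\<nu> \<alpha> \<rho>" ?e] that sq[of "(k, b)"] by simp
    then show ?thesis unfolding a by (intro L2_approximable_sum sq finite)
  qed
  then have approx: "L2_approximable (\<nu> \<alpha> \<rho>) ?I ?e f" if "square_integrable (\<nu> \<alpha> \<rho>) f" for f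
    using L2_approximable_if_D_approximable[of ?I ?e f] sq that by blast
  show ?thesis
    unfolding orthogonal_basis_L2_def
  proof (intro conjI ballI allI impI)
    show "square_integrable (\<nu> \<alpha> \<rho>) (?e i)" for i by (rule sq)
  next
    fix i assume "i \<in> ?I"
    then obtain k \<psi> where i: "i = (k, \<psi>)" "\<psi> \<in> \<Psi> k" by auto
    obtain r where "0 < r" "\<And>\<psi> \<phi>. (\<integral>\<eta>. lifted \<alpha> \<rho> k \<psi> \<eta> * lifted \<alpha> \<rho> k \<phi> \<eta> \<partial>\<nu> \<alpha> \<rho>) =
        r * (\<Sum>\<xi>\<in>\<Xi> k. weight \<alpha> \<xi> * (\<psi> \<xi> * \<phi> \<xi>))"
      using integral_lifted_same_degree by blast
    then show "(\<integral>\<eta>. (?e i \<eta>)\<^sup>2 \<partial>\<nu> \<alpha> \<rho>) \<noteq> 0"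
      using nonzero[OF i(2)] by (simp add: i power2_eq_square)
  next
    fix i j assume "i \<in> ?I" "j \<in> ?I" "i \<noteq> j"
    then obtain k \<psi> l \<phi> where ij: "i = (k, \<psi>)" "\<psi> \<in> \<Psi> k" "j = (l, \<phi>)" "\<phi> \<in> \<Psi> l" "k \<noteq> l \<or> \<psi> \<noteq> \<phi>"
      by auto
    show "(\<integral>\<eta>. ?e i \<eta> * ?e j \<eta> \<partial>\<nu> \<alpha> \<rho>) = 0"
    proof (cases "k = l")
      case True
      obtain r where "\<And>\<psi> \<phi>. (\<integral>\<eta>. lifted \<alpha> \<rho> k \<psi> \<eta> * lifted \<alpha> \<rho> k \<phi> \<eta> \<partial>\<nu> \<alpha> \<rho>) =
          r * (\<Sum>\<xi>\<in>\<Xi> k. weight \<alpha> \<xi> * (\<psi> \<xi> * \<phi> \<xi>))"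
        using integral_lifted_same_degree by blast
      then show ?thesis using ij True orthogonal by simp
    next
      case False
      then show ?thesis using ij by (simp add: integral_lifted_different_degree)
    qed
  next
    fix f :: "('v \<Rightarrow> nat) \<Rightarrow> real" and \<epsilon> :: real
    assume "square_integrable (\<nu> \<alpha> \<rho>) f" "0 < \<epsilon>"
    then obtain J a where J: "finite J" "J \<subseteq> ?I" "(\<integral>\<eta>. (f \<eta> - (\<Sum>i\<in>J. a i * ?e i \<eta>))\<^sup>2 \<partial>\<nu> \<alpha> \<rho>) < \<epsilon>\<^sup>2"
      using approx unfolding L2_approximable_def by (meson zero_less_power)
    then have "sqrt (\<integral>\<eta>. (f \<eta> - (\<Sum>i\<in>J. a i * ?e i \<eta>))\<^sup>2 \<partial>\<nu> \<alpha> \<rho>) < \<epsilon>"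
      using \<open>0 < \<epsilon>\<close> by (intro real_less_lsqrt) auto
    then show "\<exists>J a. finite J \<and> J \<subseteq> ?I \<and>
        sqrt (\<integral>\<eta>. (f \<eta> - (\<Sum>i\<in>J. a i * ?e i \<eta>))\<^sup>2 \<partial>\<nu> \<alpha> \<rho>) < \<epsilon>"
      using J(1,2) by blast
  qed
qed

end

lemma absorbing_gen_linear:
  assumes "\<xi> \<in> \<Xi> k"
  shows "absorbing_gen c \<alpha> \<omega> k (\<lambda>\<xi>. a * f \<xi> + g \<xi>) \<xi> =
    a * absorbing_gen c \<alpha> \<omega> k f \<xi> + absorbing_gen c \<alpha> \<omega> k g \<xi>"
proof -
  have "(\<Sum>x\<in>UNIV. \<Sum>y\<in>UNIV. c x y * real (\<xi> x) * (\<alpha> y + real (\<xi> y)) *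
        (a * f (add_at y (remove_at x \<xi>)) + g (add_at y (remove_at x \<xi>)) - (a * f \<xi> + g \<xi>))) =
      a * (\<Sum>x\<in>UNIV. \<Sum>y\<in>UNIV. c x y * real (\<xi> x) * (\<alpha> y + real (\<xi> y)) *
        (f (add_at y (remove_at x \<xi>)) - f \<xi>)) +
      (\<Sum>x\<in>UNIV. \<Sum>y\<in>UNIV. c x y * real (\<xi> x) * (\<alpha> y + real (\<xi> y)) *
        (g (add_at y (remove_at x \<xi>)) - g \<xi>))"
    unfolding sum_distrib_left sum.distrib[symmetric]
    by (intro sum.cong refl) algebra
  then show ?thesis
    unfolding absorbing_gen_def restrict_apply'[OF assms] by algebra
qed

lemma absorbing_gen_cong:
  assumes "\<xi> \<in> \<Xi> k" "\<And>\<zeta>. \<zeta> \<in> \<Xi> k \<Longrightarrow> f \<zeta> = g \<zeta>"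
  shows "absorbing_gen c \<alpha> \<omega> k f \<xi> = absorbing_gen c \<alpha> \<omega> k g \<xi>"
proof -
  have hop: "c x y * real (\<xi> x) * (\<alpha> y + real (\<xi> y)) * (f (add_at y (remove_at x \<xi>)) - f \<xi>) =
      c x y * real (\<xi> x) * (\<alpha> y + real (\<xi> y)) * (g (add_at y (remove_at x \<xi>)) - g \<xi>)" for x y
    using assms(2)[OF move_in_\<Xi>[OF assms(1), of x y]] assms(2)[OF assms(1)]
    by (cases "\<xi> x = 0") auto
  show ?thesis
    unfolding absorbing_gen_def restrict_apply'[OF assms(1)] hop
    unfolding assms(2)[OF assms(1)] by (rule refl)
qed

text \<open>
  On \<open>\<Xi> k\<close> the measures \<open>\<mu> \<alpha> k\<close> and \<open>weight \<alpha>\<close> differ by a constant factor, so orthogonality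
  means the same for both.
\<close>

definition absorbing_eigenbasis ::
  "('v::finite \<Rightarrow> 'v \<Rightarrow> real) \<Rightarrow> ('v \<Rightarrow> real) \<Rightarrow> ('v \<Rightarrow> real) \<Rightarrow> nat \<Rightarrow> ('v config \<Rightarrow> real) set \<Rightarrow> bool" where
  "absorbing_eigenbasis c \<alpha> \<omega> k B \<longleftrightarrow>
    finite B \<and> (\<forall>\<psi>\<in>B. \<exists>lam. absorbing_eigenpair c \<alpha> \<omega> k lam \<psi>) \<and>
    (\<forall>\<psi>\<in>B. (\<Sum>\<xi>\<in>\<Xi> k. weight \<alpha> \<xi> * (\<psi> \<xi> * \<psi> \<xi>)) \<noteq> 0) \<and>
    (\<forall>\<psi>\<in>B. \<forall>\<phi>\<in>B. \<psi> \<noteq> \<phi> \<longrightarrow> (\<Sum>\<xi>\<in>\<Xi> k. weight \<alpha> \<xi> * (\<psi> \<xi> * \<phi> \<xi>)) = 0) \<and>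
    (\<forall>f. \<exists>a. \<forall>\<xi>\<in>\<Xi> k. f \<xi> = (\<Sum>b\<in>B. a b * b \<xi>))"

theorem absorbing_eigenbasis_exists:
  fixes \<alpha> :: "'v::finite \<Rightarrow> real"
  assumes "connected_weighted_graph c" "\<forall>x. 0 < \<alpha> x"
  shows "\<exists>B. absorbing_eigenbasis c \<alpha> \<omega> k B"
proof -
  interpret symmetric_operator "\<Xi> k" "weight \<alpha>" "absorbing_gen c \<alpha> \<omega> k"
  proof
    show "finite (\<Xi> k :: ('v \<Rightarrow> nat) set)" by simp
    show "0 < weight \<alpha> \<xi>" for \<xi> by (rule weight_pos[OF assms(2)])
    show "absorbing_gen c \<alpha> \<omega> k (\<lambda>\<zeta>. s * u \<zeta> + v \<zeta>) \<xi> =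
        s * absorbing_gen c \<alpha> \<omega> k u \<xi> + absorbing_gen c \<alpha> \<omega> k v \<xi>" if "\<xi> \<in> \<Xi> k" for \<xi> s u v
      using that by (rule absorbing_gen_linear)
    show "absorbing_gen c \<alpha> \<omega> k u \<xi> = absorbing_gen c \<alpha> \<omega> k v \<xi>"
      if "\<xi> \<in> \<Xi> k" "\<And>\<zeta>. \<zeta> \<in> \<Xi> k \<Longrightarrow> u \<zeta> = v \<zeta>" for \<xi> u v
      using that by (rule absorbing_gen_cong)
    show "(\<Sum>\<xi>\<in>\<Xi> k. weight \<alpha> \<xi> * (u \<xi> * absorbing_gen c \<alpha> \<omega> k v \<xi>)) =
        (\<Sum>\<xi>\<in>\<Xi> k. weight \<alpha> \<xi> * (absorbing_gen c \<alpha> \<omega> k u \<xi> * v \<xi>))" for u v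
      by (rule absorbing_gen_symmetric[OF assms])
  qed
  obtain B where "orthogonal_eigenvectors B \<and>
      (\<forall>f. \<forall>\<xi>\<in>\<Xi> k. f \<xi> = (\<Sum>b\<in>B. ip f b / ip b b * b \<xi>))"
    using spectral_theorem by (rule exE)
  then have B: "orthogonal_eigenvectors B"
    and span: "\<forall>f. \<forall>\<xi>\<in>\<Xi> k. f \<xi> = (\<Sum>b\<in>B. ip f b / ip b b * b \<xi>)"
    by (rule conjunct1, rule conjunct2)
  from B have finite: "finite B" and ext: "B \<subseteq> extensional (\<Xi> k)" and pos: "\<forall>b\<in>B. 0 < ip b b"
    and eig: "\<forall>b\<in>B. \<exists>lam. \<forall>\<xi>\<in>\<Xi> k. absorbing_gen c \<alpha> \<omega> k b \<xi> = lam * b \<xi>"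
    and orth: "\<forall>b\<in>B. \<forall>b'\<in>B. b \<noteq> b' \<longrightarrow> ip b b' = 0"
    unfolding orthogonal_eigenvectors_def by - (elim conjE, assumption)+
  have "\<forall>\<psi>\<in>B. \<exists>lam. absorbing_eigenpair c \<alpha> \<omega> k lam \<psi>"
  proof
    fix \<psi> assume \<psi>: "\<psi> \<in> B"
    from bspec[OF eig \<psi>] obtain lam where
      lam: "\<forall>\<xi>\<in>\<Xi> k. absorbing_gen c \<alpha> \<omega> k \<psi> \<xi> = lam * \<psi> \<xi>" by (rule exE)
    have "\<psi> \<in> fun_\<Xi> k" using ext \<psi> by (auto simp: fun_\<Xi>_def PiE_def)
    moreover have "\<exists>\<xi>\<in>\<Xi> k. \<psi> \<xi> \<noteq> 0"
    proof (rule ccontr)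
      assume "\<not> ?thesis"
      then have "ip \<psi> \<psi> = 0" by (simp add: ip_def)
      then show False using bspec[OF pos \<psi>] by simp
    qed
    ultimately have "absorbing_eigenpair c \<alpha> \<omega> k (- lam) \<psi>"
      unfolding absorbing_eigenpair_def using lam by simp
    then show "\<exists>lam. absorbing_eigenpair c \<alpha> \<omega> k lam \<psi>" by (rule exI)
  qed
  moreover have "\<forall>f. \<exists>a. \<forall>\<xi>\<in>\<Xi> k. f \<xi> = (\<Sum>b\<in>B. a b * b \<xi>)"
  proof
    fix f
    show "\<exists>a. \<forall>\<xi>\<in>\<Xi> k. f \<xi> = (\<Sum>b\<in>B. a b * b \<xi>)"
      by (rule exI[of _ "\<lambda>b. ip f b / ip b b"]) (rule spec[OF span])
  qed
  moreover have "\<forall>\<psi>\<in>B. (\<Sum>\<xi>\<in>\<Xi> k. weight \<alpha> \<xi> * (\<psi> \<xi> * \<psi> \<xi>)) \<noteq> 0"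
    using pos unfolding ip_def by (metis less_irrefl)
  ultimately show ?thesis
    using finite orth unfolding absorbing_eigenbasis_def ip_def by (intro exI[of _ B] conjI)
qed

theorem theorem6p3:
  fixes c :: "'v::finite \<Rightarrow> 'v \<Rightarrow> real"
    and \<alpha> \<omega> \<theta> :: "'v \<Rightarrow> real"
    and \<rho> :: real
  assumes "connected_weighted_graph c"
    and "\<forall>x. 0 < \<alpha> x"
    and "\<forall>x. 0 \<le> \<omega> x"
    and "\<forall>x. 0 \<le> \<theta> x"
    and "0 < \<rho>"
  shows "(\<forall>k lam \<psi>. absorbing_eigenpair c \<alpha> \<omega> k lam \<psi> \<longrightarrow>
            (\<forall>\<eta>. open_gen c \<alpha> \<omega> \<theta> (lifted \<alpha> \<rho> k \<psi>) \<eta> =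
                 - lam * lifted \<alpha> \<rho> k \<psi> \<eta> +
                 (if k = 0 then 0
                  else lifted \<alpha> \<rho> (k - 1) (lowering \<alpha> \<omega> \<theta> \<rho> (k - 1) \<psi>) \<eta>))) \<and>
         (\<exists>\<Psi>. (\<forall>k. \<forall>\<psi>\<in>\<Psi> k. \<psi> \<in> fun_\<Xi> k \<and> (\<exists>lam. absorbing_eigenpair c \<alpha> \<omega> k lam \<psi>)) \<and>
              orthogonal_basis_L2 (\<nu> \<alpha> \<rho>) (SIGMA k:UNIV. \<Psi> k) (\<lambda>(k, \<psi>). lifted \<alpha> \<rho> k \<psi>))"
proof
  show "\<forall>k lam \<psi>. absorbing_eigenpair c \<alpha> \<omega> k lam \<psi> \<longrightarrow>
      (\<forall>\<eta>. open_gen c \<alpha> \<omega> \<theta> (lifted \<alpha> \<rho> k \<psi>) \<eta> = - lam * lifted \<alpha> \<rho> k \<psi> \<eta> +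
        (if k = 0 then 0 else lifted \<alpha> \<rho> (k - 1) (lowering \<alpha> \<omega> \<theta> \<rho> (k - 1) \<psi>) \<eta>))"
    by (intro allI impI) (rule open_gen_lifted_eigenpair[OF assms(1,2,5)])
next
  interpret duality_measure \<alpha> \<rho> by unfold_locales (use assms in auto)
  have "\<forall>k. \<exists>B. absorbing_eigenbasis c \<alpha> \<omega> k B"
    by (intro allI absorbing_eigenbasis_exists assms(1,2))
  from choice[OF this] obtain \<Psi> where \<Psi>: "\<forall>k. absorbing_eigenbasis c \<alpha> \<omega> k (\<Psi> k)"
    by (rule exE)
  have "orthogonal_basis_L2 (\<nu> \<alpha> \<rho>) (SIGMA k:UNIV. \<Psi> k) (\<lambda>(k, \<psi>). lifted \<alpha> \<rho> k \<psi>)"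
    using \<Psi> unfolding absorbing_eigenbasis_def by (intro lifted_orthogonal_basis) simp_all
  moreover have "\<forall>k. \<forall>\<psi>\<in>\<Psi> k. \<psi> \<in> fun_\<Xi> k \<and> (\<exists>lam. absorbing_eigenpair c \<alpha> \<omega> k lam \<psi>)"
  proof (intro allI ballI)
    fix k \<psi> assume \<psi>: "\<psi> \<in> \<Psi> k"
    have "\<forall>\<psi>\<in>\<Psi> k. \<exists>lam. absorbing_eigenpair c \<alpha> \<omega> k lam \<psi>"
      using spec[OF \<Psi>, of k] unfolding absorbing_eigenbasis_def by (elim conjE)
    from bspec[OF this \<psi>] obtain lam where lam: "absorbing_eigenpair c \<alpha> \<omega> k lam \<psi>" by (rule exE)
    then have "\<psi> \<in> fun_\<Xi> k" by (simp add: absorbing_eigenpair_def)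
    with lam show "\<psi> \<in> fun_\<Xi> k \<and> (\<exists>lam. absorbing_eigenpair c \<alpha> \<omega> k lam \<psi>)" by blast
  qed
  ultimately show "\<exists>\<Psi>. (\<forall>k. \<forall>\<psi>\<in>\<Psi> k. \<psi> \<in> fun_\<Xi> k \<and>
      (\<exists>lam. absorbing_eigenpair c \<alpha> \<omega> k lam \<psi>)) \<and>
      orthogonal_basis_L2 (\<nu> \<alpha> \<rho>) (SIGMA k:UNIV. \<Psi> k) (\<lambda>(k, \<psi>). lifted \<alpha> \<rho> k \<psi>)"
    by (intro exI[of _ \<Psi>] conjI)
qed

end
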